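(* Let $d\ge 1$ be an integer, let $a_j,b_j$ ($j=1,\dots,d$) and $c$ belong to $C_b^\infty(\mathbb{R}^d)$, put $b=(b_1,\dots,b_d)$, suppose $c(x)\le 0$ for all $x\in\mathbb{R}^d$, and suppose there is a constant $\varkappa>0$ such that $$\sum_{j=1}^d (a_j(x))^2\xi_j^2\ \ge\ \varkappa\sum_{j=1}^d\xi_j^2\qquad\text{for all }x\in\mathbb{R}^d\text{ and all }\xi=(\xi_1,\dots,\xi_d)\in\mathbb{R}^d.$$ Let $H$ be the operator in $UC_b(\mathbb{R}^d)$ with domain $C_b^\infty(\mathbb{R}^d)$ given by $$(H\varphi)(x)=\sum_{j=1}^d (a_j(x))^2\,\frac{\partial^2\varphi}{\partial x_j^2}(x)+\langle b(x),\nabla\varphi(x)\rangle+c(x)\varphi(x).$$ Then: (I) for all $\lambda>0$ we have $C_b^\infty(\mathbb{R}^d)\subset (H-\lambda I)\big(C_b^\infty(\mathbb{R}^d)\big)$; (II) the operator $(H,C_b^\infty(\mathbb{R}^d))$ is dissipative; (III) the closure of $(H,C_b^\infty(\mathbb{R}^d))$ is a dissipative operator that generates a contraction $C_0$-semigroup $(e^{tH})_{t\ge0}$ in $UC_b(\mathbb{R}^d)$; (IV) for each $u_0\in UC_b(\mathbb{R}^d)$ the Cauchy problem $$u'_t(t,x)=\sum_{j=1}^d (a_j(x))^2u''_{x_jx_j}(t,x)+\langle b(x),\nabla u(t,x)\rangle+c(x)u(t,x),\qquad u(0,x)=u_0(x),$$ has the solution $u(t,x)=(e^{tH}u_0)(x)$,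 and it satisfies $\sup_{x\in\mathbb{R}^d}|u(t,x)|\le\sup_{x\in\mathbb{R}^d}|u_0(x)|$ for all $t\ge 0$.
   Context: $UC_b(\mathbb{R}^d)$ is the Banach space of all bounded uniformly continuous functions $f\colon\mathbb{R}^d\to\mathbb{R}$ with norm $\|f\|=\sup_{x\in\mathbb{R}^d}|f(x)|$. $C_b^\infty(\mathbb{R}^d)$ is the space of infinitely differentiable real-valued functions on $\mathbb{R}^d$ that are bounded together with all their partial derivatives of all orders. $I$ is the identity operator, $\langle\cdot,\cdot\rangle$ the standard scalar product in $\mathbb{R}^d$, $\nabla$ the gradient in $x$. A linear operator $(A,\mathrm{Dom}(A))$ in a Banach space is dissipative if $\|\lambda\varphi-A\varphi\|\ge\lambda\|\varphi\|$ for all $\lambda>0$ and $\varphi\in \mathrm{Dom}(A)$. A contraction $C_0$-semigroup is a $C_0$-semigroup $(V(t))_{t\ge0}$ with $\|V(t)\|\le 1$ for all $t\ge 0$. The notation $(e^{tH})_{t\ge0}$ denotes the $C_0$-semigroup generated by the closure $\overline H$ of $(H,C_b^\infty(\mathbb{R}^d))$. "Solution of the Cauchy problem" is understood in the sense of $C_0$-semigroup theory, with $u(t,\cdot)\in UC_b(\mathbb{R}^d)$ and the right-hand side of the equation read as $\overline H u(t,\cdot)$: for general $u_0\in UC_b(\mathbb{R}^d)$ it is the mild solution, i.e. $t\mapsto u(t,\cdot)$ is continuous into $UC_b(\mathbb{R}^d)$, and for all $t\ge0$ one has $\int_0^t u(s,\cdot)\,ds\in \mathrm{Dom}(\overline H)$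 and $u(t,\cdot)=u_0+\overline H\int_0^t u(s,\cdot)\,ds$. *)

theory Defs
  imports "HOL-Analysis.Analysis"
begin

subsection \<open>Bounded uniformly continuous functions with the supremum norm\<close>

typedef (overloaded) 'a ucb =
  "{f :: 'a::metric_space \<Rightarrow> real. bounded (range f) \<and> uniformly_continuous_on UNIV f}"
  morphisms apply_ucb Ucb
  by (rule exI[of _ "\<lambda>_. 0"]) (auto simp: uniformly_continuous_on_const)

setup_lifting type_definition_ucb

lemma ucb_eqI: "(\<And>x. apply_ucb f x = apply_ucb g x) \<Longrightarrow> f = g"
  by transfer auto

instantiation ucb :: (metric_space) real_vector
begin

lift_definition zero_ucb :: "'a ucb" is "\<lambda>_. 0"
  by (auto simp: uniformly_continuous_on_const)

lift_definition plus_ucb :: "'a ucb \<Rightarrow> 'a ucb \<Rightarrow> 'a ucb" is "\<lambda>f g x. f x + g x"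
  by (auto intro: bounded_plus_comp uniformly_continuous_on_add)

lift_definition minus_ucb :: "'a ucb \<Rightarrow> 'a ucb \<Rightarrow> 'a ucb" is "\<lambda>f g x. f x - g x"
  by (auto intro: bounded_minus_comp uniformly_continuous_on_diff)

lift_definition uminus_ucb :: "'a ucb \<Rightarrow> 'a ucb" is "\<lambda>f x. - f x"
  by (auto intro: uniformly_continuous_on_minus)

lift_definition scaleR_ucb :: "real \<Rightarrow> 'a ucb \<Rightarrow> 'a ucb" is "\<lambda>r f x. r * f x"
proof safe
  fix r and f :: "'a \<Rightarrow> real"
  assume f: "bounded (range f)" "uniformly_continuous_on UNIV f"
  show "bounded (range (\<lambda>x. r * f x))"
    using bounded_scaleR_comp[OF f(1), of r] by simp
  show "uniformly_continuous_on UNIV (\<lambda>x. r * f x)"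
    using uniformly_continuous_on_cmul[OF f(2), of r] by simp
qed

lemmas apply_ucb_simps [simp] =
  zero_ucb.rep_eq plus_ucb.rep_eq minus_ucb.rep_eq uminus_ucb.rep_eq scaleR_ucb.rep_eq

instance
  by standard (auto intro!: ucb_eqI simp: algebra_simps)

end

instantiation ucb :: (metric_space) real_normed_vector
begin

definition norm_ucb :: "'a ucb \<Rightarrow> real"
  where "norm_ucb f = (SUP x. \<bar>apply_ucb f x\<bar>)"

definition dist_ucb :: "'a ucb \<Rightarrow> 'a ucb \<Rightarrow> real"
  where "dist_ucb f g = norm (f - g)"

definition sgn_ucb :: "'a ucb \<Rightarrow> 'a ucb"
  where "sgn_ucb f = f /\<^sub>R norm f"

definition uniformity_ucb :: "('a ucb \<times> 'a ucb) filter"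
  where "uniformity_ucb = (INF e\<in>{0 <..}. principal {(x, y). dist x y < e})"

definition open_ucb :: "'a ucb set \<Rightarrow> bool"
  where "open_ucb S = (\<forall>x\<in>S. \<forall>\<^sub>F (x', y) in uniformity. x' = x \<longrightarrow> y \<in> S)"

lemma abs_apply_ucb_le: "\<bar>apply_ucb f x\<bar> \<le> norm f"
proof -
  have "bounded (range (\<lambda>x. \<bar>apply_ucb f x\<bar>))"
    using apply_ucb[of f] by (auto simp: bounded_iff)
  then show ?thesis
    unfolding norm_ucb_def by (intro cSUP_upper bounded_imp_bdd_above) auto
qed

lemma norm_ucb_le: "(\<And>x. \<bar>apply_ucb f x\<bar> \<le> b) \<Longrightarrow> norm f \<le> b"
  unfolding norm_ucb_def by (intro cSUP_least) auto

instance
proof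
  fix r :: real and f g :: "'a ucb"
  have nonneg: "0 \<le> norm h" for h :: "'a ucb"
    using abs_apply_ucb_le[of h undefined] by linarith
  show "(norm f = 0) \<longleftrightarrow> (f = 0)"
  proof
    assume "norm f = 0"
    then show "f = 0"
      by (intro ucb_eqI) (metis abs_apply_ucb_le abs_le_zero_iff zero_ucb.rep_eq)
  next
    assume "f = 0"
    then show "norm f = 0"
      using norm_ucb_le[of f 0] nonneg[of f] by auto
  qed
  show "norm (f + g) \<le> norm f + norm g"
  proof (rule norm_ucb_le)
    fix x show "\<bar>apply_ucb (f + g) x\<bar> \<le> norm f + norm g"
      using abs_apply_ucb_le[of f x] abs_apply_ucb_le[of g x] by auto
  qed
  have le: "norm (s *\<^sub>R h) \<le> \<bar>s\<bar> * norm h" for s and h :: "'a ucb"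
    by (rule norm_ucb_le) (auto simp: abs_mult intro!: mult_left_mono abs_apply_ucb_le)
  show "norm (r *\<^sub>R f) = \<bar>r\<bar> * norm f"
  proof (cases "r = 0")
    case True
    then show ?thesis using le[of r f] nonneg[of "r *\<^sub>R f"] by simp
  next
    case False
    have "norm f = norm (inverse r *\<^sub>R (r *\<^sub>R f))" using False by simp
    also have "\<dots> \<le> \<bar>inverse r\<bar> * norm (r *\<^sub>R f)" by (rule le)
    finally have "\<bar>r\<bar> * norm f \<le> norm (r *\<^sub>R f)"
      using False by (simp add: field_simps)
    then show ?thesis using le[of r f] by linarith
  qed
qed (simp_all add: dist_ucb_def sgn_ucb_def uniformity_ucb_def open_ucb_def)

end

instance ucb :: (metric_space) banach
proof
  fix X :: "nat \<Rightarrow> 'a ucb"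
  assume C: "Cauchy X"
  have dle: "dist (apply_ucb f x) (apply_ucb g x) \<le> dist f g" for f g :: "'a ucb" and x
    using abs_apply_ucb_le[of "f - g" x] by (simp add: dist_norm)
  have "\<exists>l. \<forall>e>0. \<exists>N. \<forall>n x. N \<le> n \<and> True \<longrightarrow> dist (apply_ucb (X n) x) (l x) < e"
    unfolding uniformly_convergent_eq_cauchy
    using C dle unfolding Cauchy_def by (meson le_less_trans)
  then obtain l where l: "\<And>e. e > 0 \<Longrightarrow> \<exists>N. \<forall>n\<ge>N. \<forall>x. dist (apply_ucb (X n) x) (l x) < e"
    by meson
  obtain N where N: "\<And>x. dist (apply_ucb (X N) x) (l x) < 1"
    using l[of 1] by auto
  have "\<bar>l x\<bar> \<le> norm (X N) + 1" for x
    using N[of x] abs_apply_ucb_le[of "X N" x] by (simp add: dist_real_def)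
  then have bd: "bounded (range l)"
    by (auto simp: bounded_iff)
  have uc: "uniformly_continuous_on UNIV l"
    unfolding uniformly_continuous_on_def
  proof (intro allI impI)
    fix e :: real assume "e > 0"
    then obtain M where M: "\<And>x. dist (apply_ucb (X M) x) (l x) < e / 3"
      using l[of "e / 3"] by auto
    obtain d where "d > 0" and d: "\<And>x y. dist y x < d \<Longrightarrow> dist (apply_ucb (X M) y) (apply_ucb (X M) x) < e / 3"
      using apply_ucb[of "X M"] \<open>e > 0\<close>
      unfolding uniformly_continuous_on_def by (auto dest!: spec[of _ "e / 3"])
    have "dist (l y) (l x) < e" if "dist y x < d" for x y
      using M[of x] M[of y] d[OF that] unfolding dist_real_def by linarith
    then show "\<exists>d>0. \<forall>x\<in>UNIV. \<forall>x'\<in>UNIV. dist x' x < d \<longrightarrow> dist (l x') (l x) < e"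
      using \<open>d > 0\<close> by auto
  qed
  have app: "apply_ucb (Ucb l) = l"
    using bd uc by (simp add: Ucb_inverse)
  have "X \<longlonglongrightarrow> Ucb l"
    unfolding lim_sequentially
  proof (intro allI impI)
    fix e :: real assume "e > 0"
    then obtain M where M: "\<And>n x. n \<ge> M \<Longrightarrow> dist (apply_ucb (X n) x) (l x) < e / 2"
      using l[of "e / 2"] by auto
    have "dist (X n) (Ucb l) \<le> e / 2" if "n \<ge> M" for n
      unfolding dist_norm
      by (rule norm_ucb_le) (use M[OF that] in \<open>simp add: app dist_real_def less_imp_le\<close>)
    then show "\<exists>M. \<forall>n\<ge>M. dist (X n) (Ucb l) < e"
      using \<open>e > 0\<close> by (intro exI[of _ M]) fastforce
  qed
  then show "convergent X"
    by (rule convergentI)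
qed


subsection \<open>Unbounded operators and one-parameter semigroups\<close>

text \<open>An operator $(A, \mathrm{Dom}(A))$ is identified with its graph, a set of pairs $(x, Ax)$;
  its domain is \<^const>\<open>Domain\<close> of the graph, and the graph of the closure
  is the \<^const>\<open>closure\<close> of the graph in the product space.\<close>

definition linear_operator :: "('a::real_vector \<times> 'a) set \<Rightarrow> bool" where
  "linear_operator A \<longleftrightarrow> subspace A \<and> single_valued A"

definition dissipative :: "('a::real_normed_vector \<times> 'a) set \<Rightarrow> bool" where
  "dissipative A \<longleftrightarrow> linear_operator A \<and>
     (\<forall>lam>0. \<forall>(x, y)\<in>A. norm (lam *\<^sub>R x - y) \<ge> lam * norm x)"

text \<open>Only the values \<open>V t\<close> with \<open>t \<ge> 0\<close> are relevant.\<close>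

definition C0_semigroup :: "(real \<Rightarrow> 'a::real_normed_vector \<Rightarrow>\<^sub>L 'a) \<Rightarrow> bool" where
  "C0_semigroup V \<longleftrightarrow>
     V 0 = id_blinfun \<and>
     (\<forall>s\<ge>0. \<forall>t\<ge>0. V (s + t) = V s o\<^sub>L V t) \<and>
     (\<forall>x. continuous_on {0..} (\<lambda>t. blinfun_apply (V t) x))"

definition contraction_C0_semigroup :: "(real \<Rightarrow> 'a::real_normed_vector \<Rightarrow>\<^sub>L 'a) \<Rightarrow> bool" where
  "contraction_C0_semigroup V \<longleftrightarrow> C0_semigroup V \<and> (\<forall>t\<ge>0. norm (V t) \<le> 1)"

definition generator :: "(real \<Rightarrow> 'a::real_normed_vector \<Rightarrow>\<^sub>L 'a) \<Rightarrow> ('a \<times> 'a) set" where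
  "generator V = {(x, y). ((\<lambda>t. (blinfun_apply (V t) x - x) /\<^sub>R t) \<longlongrightarrow> y) (at_right 0)}"

definition mild_solution :: "('a::banach \<times> 'a) set \<Rightarrow> 'a \<Rightarrow> (real \<Rightarrow> 'a) \<Rightarrow> bool" where
  "mild_solution A u0 u \<longleftrightarrow>
     continuous_on {0..} u \<and>
     (\<forall>t\<ge>0. \<exists>y. (integral {0..t} u, y) \<in> A \<and> u t = u0 + y)"


subsection \<open>Smooth functions with bounded derivatives\<close>

definition partial_deriv :: "'d::finite \<Rightarrow> (real^'d \<Rightarrow> real) \<Rightarrow> real^'d \<Rightarrow> real" where
  "partial_deriv j f x = deriv (\<lambda>t. f (x + t *\<^sub>R axis j 1)) 0"

definition gradient :: "(real^'d::finite \<Rightarrow> real) \<Rightarrow> real^'d \<Rightarrow> real^'d" where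
  "gradient f x = (\<chi> j. partial_deriv j f x)"

text \<open>The list \<open>js\<close> runs through all finite sequences of differentiation directions. Since all
  iterated partial derivatives are totally differentiable, they are all continuous.\<close>

definition Cb_inf :: "(real^'d::finite \<Rightarrow> real) set" where
  "Cb_inf = {f. \<forall>js. (\<forall>x. fold partial_deriv js f differentiable (at x)) \<and>
                     bounded (range (fold partial_deriv js f))}"

definition elliptic_expr ::
    "('d::finite \<Rightarrow> real^'d \<Rightarrow> real) \<Rightarrow> ('d \<Rightarrow> real^'d \<Rightarrow> real) \<Rightarrow> (real^'d \<Rightarrow> real) \<Rightarrow>
     (real^'d \<Rightarrow> real) \<Rightarrow> (real^'d \<Rightarrow> real)" where
  "elliptic_expr a b c f x =
     (\<Sum>j\<in>UNIV. (a j x)\<^sup>2 * partial_deriv j (partial_deriv j f) x) +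
     (\<chi> j. b j x) \<bullet> gradient f x + c x * f x"

text \<open>The lemmas \<open>Domain_elliptic_operator\<close> and \<open>elliptic_operator_iff\<close> below show that no
  element of the domain is lost and that the values of \<^const>\<open>Ucb\<close> used here are meaningful.\<close>

definition elliptic_operator ::
    "('d::finite \<Rightarrow> real^'d \<Rightarrow> real) \<Rightarrow> ('d \<Rightarrow> real^'d \<Rightarrow> real) \<Rightarrow> (real^'d \<Rightarrow> real) \<Rightarrow>
     ((real^'d) ucb \<times> (real^'d) ucb) set" where
  "elliptic_operator a b c = {(Ucb f, Ucb (elliptic_expr a b c f)) | f. f \<in> Cb_inf}"

lemma partial_deriv_eq:
  assumes "(f has_derivative f') (at x)"
  shows "partial_deriv j f x = f' (axis j 1)"
proof -
  have "((\<lambda>t. f (x + t *\<^sub>R axis j 1)) has_derivative (\<lambda>t. f' (t *\<^sub>R axis j 1))) (at 0)"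
    by (rule has_derivative_compose[of "\<lambda>t. x + t *\<^sub>R axis j 1" "\<lambda>t. t *\<^sub>R axis j 1" 0 UNIV f f'])
       (use assms in \<open>auto intro!: derivative_eq_intros\<close>)
  moreover have "f' (t *\<^sub>R axis j 1) = f' (axis j 1) * t" for t
    using linear_scale[OF has_derivative_linear[OF assms], of t "axis j 1"] by simp
  ultimately have "((\<lambda>t. f (x + t *\<^sub>R axis j 1)) has_field_derivative f' (axis j 1)) (at 0)"
    by (simp add: has_field_derivative_def)
  then show ?thesis
    unfolding partial_deriv_def by (rule DERIV_imp_deriv)
qed

lemma Cb_infD:
  assumes "f \<in> Cb_inf"
  shows "f differentiable (at x)" "bounded (range f)" "partial_deriv j f \<in> Cb_inf"
proof -
  have 1: "\<And>js x. fold partial_deriv js f differentiable (at x)"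
    and 2: "\<And>js. bounded (range (fold partial_deriv js f))"
    using assms by (auto simp: Cb_inf_def)
  show "f differentiable (at x)" "bounded (range f)"
    using 1[of "[]"] 2[of "[]"] by auto
  show "partial_deriv j f \<in> Cb_inf"
    using 1[of "j # _"] 2[of "j # _"] by (auto simp: Cb_inf_def)
qed

lemma Cb_inf_coinduct:
  assumes "f \<in> S"
    and "\<And>f x. f \<in> S \<Longrightarrow> f differentiable (at x)"
    and "\<And>f. f \<in> S \<Longrightarrow> bounded (range f)"
    and "\<And>f j. f \<in> S \<Longrightarrow> partial_deriv j f \<in> S"
  shows "f \<in> Cb_inf"
proof -
  have "fold partial_deriv js f \<in> S" for js
    using assms(1) by (induction js arbitrary: f) (auto intro: assms(4))
  then show ?thesis
    using assms(2,3) by (auto simp: Cb_inf_def)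
qed

inductive_set Cb_inf_alg :: "(real^'d::finite \<Rightarrow> real) set" where
  base: "f \<in> Cb_inf \<Longrightarrow> f \<in> Cb_inf_alg"
| add: "f \<in> Cb_inf_alg \<Longrightarrow> g \<in> Cb_inf_alg \<Longrightarrow> (\<lambda>x. f x + g x) \<in> Cb_inf_alg"
| mult: "f \<in> Cb_inf_alg \<Longrightarrow> g \<in> Cb_inf_alg \<Longrightarrow> (\<lambda>x. f x * g x) \<in> Cb_inf_alg"

lemma partial_deriv_add:
  assumes "f differentiable (at x)" "g differentiable (at x)"
  shows "partial_deriv j (\<lambda>x. f x + g x) x = partial_deriv j f x + partial_deriv j g x"
proof -
  obtain f' g' where f: "(f has_derivative f') (at x)" and g: "(g has_derivative g') (at x)"
    using assms by (auto simp: differentiable_def)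
  show ?thesis
    by (simp add: partial_deriv_eq[OF has_derivative_add[OF f g]]
        partial_deriv_eq[OF f] partial_deriv_eq[OF g])
qed

lemma partial_deriv_mult:
  assumes "f differentiable (at x)" "g differentiable (at x)"
  shows "partial_deriv j (\<lambda>x. f x * g x) x = f x * partial_deriv j g x + partial_deriv j f x * g x"
proof -
  obtain f' g' where f: "(f has_derivative f') (at x)" and g: "(g has_derivative g') (at x)"
    using assms by (auto simp: differentiable_def)
  show ?thesis
    by (simp add: partial_deriv_eq[OF has_derivative_mult[OF f g]]
        partial_deriv_eq[OF f] partial_deriv_eq[OF g])
qed

lemma Cb_inf_alg_props:
  assumes "f \<in> Cb_inf_alg"
  shows "(\<forall>x. f differentiable (at x)) \<and> bounded (range f) \<and> (\<forall>j. partial_deriv j f \<in> Cb_inf_alg)"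
  using assms
proof induction
  case (base f)
  then show ?case by (auto intro: Cb_infD Cb_inf_alg.base)
next
  case (add f g)
  then have "partial_deriv j (\<lambda>x. f x + g x) = (\<lambda>x. partial_deriv j f x + partial_deriv j g x)" for j
    by (intro ext partial_deriv_add) auto
  then show ?case
    using add by (auto intro: bounded_plus_comp Cb_inf_alg.intros)
next
  case (mult f g)
  then have "partial_deriv j (\<lambda>x. f x * g x) =
      (\<lambda>x. f x * partial_deriv j g x + partial_deriv j f x * g x)" for j
    by (intro ext partial_deriv_mult) auto
  moreover have "bounded (range (\<lambda>x. f x * g x))"
  proof -
    obtain B C where "\<And>x. \<bar>f x\<bar> \<le> B" "\<And>x. \<bar>g x\<bar> \<le> C"
      using mult by (auto simp: bounded_iff)
    then have "\<bar>f x * g x\<bar> \<le> B * C" for x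
      by (auto simp: abs_mult intro!: mult_mono' )
    then show ?thesis by (auto simp: bounded_iff)
  qed
  moreover have "(\<lambda>x. f x * partial_deriv j g x + partial_deriv j f x * g x) \<in> Cb_inf_alg" for j
    using mult by (intro Cb_inf_alg.add Cb_inf_alg.mult) auto
  ultimately show ?case
    using mult by auto
qed

lemma Cb_inf_alg_eq: "Cb_inf_alg = (Cb_inf :: (real^'d::finite \<Rightarrow> real) set)"
proof
  show "Cb_inf_alg \<subseteq> (Cb_inf :: (real^'d \<Rightarrow> real) set)"
  proof
    fix f :: "real^'d \<Rightarrow> real"
    assume "f \<in> Cb_inf_alg"
    then show "f \<in> Cb_inf"
      by (rule Cb_inf_coinduct) (use Cb_inf_alg_props in blast)+
  qed
qed (auto intro: Cb_inf_alg.base)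

lemma Cb_inf_add: "f \<in> Cb_inf \<Longrightarrow> g \<in> Cb_inf \<Longrightarrow> (\<lambda>x. f x + g x) \<in> Cb_inf"
  using Cb_inf_alg.add unfolding Cb_inf_alg_eq .

lemma Cb_inf_mult: "f \<in> Cb_inf \<Longrightarrow> g \<in> Cb_inf \<Longrightarrow> (\<lambda>x. f x * g x) \<in> Cb_inf"
  using Cb_inf_alg.mult unfolding Cb_inf_alg_eq .

lemma partial_deriv_const: "partial_deriv j (\<lambda>_. r) = (\<lambda>_. 0)"
  by (rule ext) (simp add: partial_deriv_def)

lemma Cb_inf_const: "(\<lambda>_. r) \<in> Cb_inf"
  by (rule Cb_inf_coinduct[of _ "range (\<lambda>r _. r)"]) (auto simp: partial_deriv_const)

lemma Cb_inf_sum: "(\<And>i. i \<in> I \<Longrightarrow> f i \<in> Cb_inf) \<Longrightarrow> (\<lambda>x. \<Sum>i\<in>I. f i x) \<in> Cb_inf"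
  by (induction I rule: infinite_finite_induct) (auto intro: Cb_inf_const Cb_inf_add)

lemma elliptic_expr_Cb_inf:
  assumes "\<And>j. a j \<in> Cb_inf" "\<And>j. b j \<in> Cb_inf" "c \<in> Cb_inf" "f \<in> Cb_inf"
  shows "elliptic_expr a b c f \<in> Cb_inf"
proof -
  have "elliptic_expr a b c f = (\<lambda>x.
     (\<Sum>j\<in>UNIV. (a j x * a j x) * partial_deriv j (partial_deriv j f) x) +
     (\<Sum>j\<in>UNIV. b j x * partial_deriv j f x) + c x * f x)"
    by (rule ext) (simp add: elliptic_expr_def gradient_def inner_vec_def power2_eq_square)
  then show ?thesis
    using assms by (auto intro!: Cb_inf_add Cb_inf_mult Cb_inf_sum Cb_infD)
qed

lemma Cb_inf_uniformly_continuous: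
  fixes f :: "real^'d::finite \<Rightarrow> real"
  assumes "f \<in> Cb_inf"
  shows "uniformly_continuous_on UNIV f"
proof -
  have "\<exists>B. \<forall>x. \<bar>partial_deriv j f x\<bar> \<le> B" for j
    using Cb_infD(2)[OF Cb_infD(3)[OF assms, of j]] by (auto simp: bounded_iff)
  then obtain B where B: "\<And>j x. \<bar>partial_deriv j f x\<bar> \<le> B j"
    by metis
  define f' where "f' x = frechet_derivative f (at x)" for x
  have f': "(f has_derivative f' x) (at x)" for x
    unfolding f'_def using Cb_infD(1)[OF assms] by (simp add: frechet_derivative_works[symmetric])
  have "norm (f' x h) \<le> sum B UNIV * norm h" for x h
  proof -
    have lin: "linear (f' x)" using f' by (rule has_derivative_linear)
    have "f' x h = f' x (\<Sum>j\<in>UNIV. (h $ j) *\<^sub>R axis j 1)"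
      using basis_expansion[of h] by (simp add: scalar_mult_eq_scaleR)
    also have "\<dots> = (\<Sum>j\<in>UNIV. h $ j * partial_deriv j f x)"
      by (simp add: linear_sum[OF lin] linear_scale[OF lin] partial_deriv_eq[OF f'])
    also have "norm \<dots> \<le> (\<Sum>j\<in>UNIV. norm h * B j)"
      by (intro sum_norm_le) (auto simp: abs_mult intro!: mult_mono component_le_norm_cart B)
    finally show ?thesis by (simp add: sum_distrib_left mult.commute)
  qed
  then have "onorm (f' x) \<le> sum B UNIV" for x
    by (intro onorm_bound) (auto intro!: sum_nonneg order_trans[OF abs_ge_zero B])
  then have "norm (f x - f y) \<le> sum B UNIV * norm (x - y)" for x y
    by (intro differentiable_bound[of UNIV f f']) (auto intro: f')
  then have "(sum B UNIV)-lipschitz_on UNIV f"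
    by (intro lipschitz_onI) (auto simp: dist_norm intro!: sum_nonneg order_trans[OF abs_ge_zero B])
  then show ?thesis
    by (rule lipschitz_on_uniformly_continuous)
qed

lemma apply_Ucb_Cb_inf: "f \<in> Cb_inf \<Longrightarrow> apply_ucb (Ucb f) = f"
  by (simp add: Ucb_inverse Cb_inf_uniformly_continuous Cb_infD)

lemma Domain_elliptic_operator:
  "Domain (elliptic_operator a b c) = {f. apply_ucb f \<in> Cb_inf}"
proof -
  have "\<exists>g. f = Ucb g \<and> g \<in> Cb_inf" if "apply_ucb f \<in> Cb_inf" for f :: "(real^'d) ucb"
    using that apply_ucb_inverse[of f] by metis
  then show ?thesis
    by (fastforce simp: elliptic_operator_def Domain_iff apply_Ucb_Cb_inf)
qed

lemma elliptic_operator_iff: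
  assumes "\<And>j. a j \<in> Cb_inf" "\<And>j. b j \<in> Cb_inf" "c \<in> Cb_inf"
  shows "(f, g) \<in> elliptic_operator a b c \<longleftrightarrow>
     apply_ucb f \<in> Cb_inf \<and> apply_ucb g = elliptic_expr a b c (apply_ucb f)"
proof
  assume "(f, g) \<in> elliptic_operator a b c"
  then show "apply_ucb f \<in> Cb_inf \<and> apply_ucb g = elliptic_expr a b c (apply_ucb f)"
    using elliptic_expr_Cb_inf[of a b c, OF assms]
    by (auto simp: elliptic_operator_def apply_Ucb_Cb_inf)
next
  assume r: "apply_ucb f \<in> Cb_inf \<and> apply_ucb g = elliptic_expr a b c (apply_ucb f)"
  then have "g = Ucb (elliptic_expr a b c (apply_ucb f))"
    by (metis apply_ucb_inverse)
  then show "(f, g) \<in> elliptic_operator a b c"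
    unfolding elliptic_operator_def using r by (auto intro!: exI[of _ "apply_ucb f"] simp: apply_ucb_inverse)
qed

end

theory Submission
  imports Defs "HOL-Probability.Probability"
begin

text \<open>Everything rests on solving \<open>\<lambda> u - H u = f\<close> smoothly for every \<open>\<lambda> > 0\<close>. The second derivative in
  direction \<open>j\<close> is replaced by \<open>\<partial>\<^sub>j\<^sup>2 (1 - r\<^sup>2 \<partial>\<^sub>j\<^sup>2)\<inverse>\<close>, the first derivative by
  \<open>\<partial>\<^sub>j (1 - r\<^sup>2 \<partial>\<^sub>j\<^sup>2)\<inverse>\<close>. Both are bounded combinations of the exponential averages
  \<open>(1 \<mp> r \<partial>\<^sub>j)\<inverse>\<close>, which commute with derivatives, and for small \<open>r\<close> the resulting bounded operator
  satisfies the maximum principle. Its resolvent equation is solved by iteration. Bernstein's method,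
  applied to \<open>\<Sum> (\<partial>\<^sup>\<alpha> u)\<^sup>2\<close> over \<open>|\<alpha>| = k\<close> plus a large multiple of the same sum over \<open>|\<alpha>| < k\<close>, bounds
  all derivatives uniformly in \<open>r\<close>: with the exponential kernel, Jensen's inequality alone controls the
  commutator terms by the carre du champ of the derivatives. The solutions are Cauchy as \<open>r \<rightarrow> 0\<close>, and
  the limit solves the equation. Dissipativity is the limit of the maximum principle,
  and density of the smooth functions together with the Hille--Yosida theorem gives the semigroup.\<close>

subsection \<open>Bounded operators as a Banach algebra\<close>

text \<open>The choice of the approximation is dictated by several demands at once: bounded
  operators, so that the equation can be iterated; commutation with derivatives, so that only the
  coefficients create commutators; nonnegative jump rates; and commutators that the gain in
  Bernstein's method can absorb. Exponential averages meet the last demand through the exact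
  identity \<open>D2 r j f = D1 r j (partial_deriv j f)\<close>. A commutator with a derivative of
  order k contains second order quotients of derivatives of order k - 1; these become first order
  quotients of derivatives of order k, whose squares are dominated by \<open>Dsq\<close> at order k,
  and this is what the maximum principle supplies with the factor kappa / 2. The derivatives of
  order k themselves are recovered from \<open>Dsq\<close> up to a term with the factor r^2, which
  is absorbed for small r. Since the second order part is diagonal, jumps along the axes suffice and
  each direction is averaged separately. The space is not compact and suprema need not be attained;
  for the bounded jump operator a near-maximum is enough.\<close>

typedef (overloaded) 'a blinop = "UNIV :: ('a::real_normed_vector \<Rightarrow>\<^sub>L 'a) set"
  morphisms blin Blinop by simp

setup_lifting type_definition_blinop

instantiation blinop :: (real_normed_vector) real_vector
begin
lift_definition zero_blinop :: "'a blinop" is 0 .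
lift_definition plus_blinop :: "'a blinop \<Rightarrow> 'a blinop \<Rightarrow> 'a blinop" is "(+)" .
lift_definition minus_blinop :: "'a blinop \<Rightarrow> 'a blinop \<Rightarrow> 'a blinop" is "(-)" .
lift_definition uminus_blinop :: "'a blinop \<Rightarrow> 'a blinop" is uminus .
lift_definition scaleR_blinop :: "real \<Rightarrow> 'a blinop \<Rightarrow> 'a blinop" is "(*\<^sub>R)" .
instance by standard (transfer; simp add: algebra_simps)+
end

instantiation blinop :: (real_normed_vector) real_normed_vector
begin
lift_definition norm_blinop :: "'a blinop \<Rightarrow> real" is norm .
definition dist_blinop :: "'a blinop \<Rightarrow> 'a blinop \<Rightarrow> real"
  where "dist_blinop f g = norm (f - g)"
definition sgn_blinop :: "'a blinop \<Rightarrow> 'a blinop"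
  where "sgn_blinop f = f /\<^sub>R norm f"
definition uniformity_blinop :: "('a blinop \<times> 'a blinop) filter"
  where "uniformity_blinop = (INF e\<in>{0 <..}. principal {(x, y). dist x y < e})"
definition open_blinop :: "'a blinop set \<Rightarrow> bool"
  where "open_blinop S = (\<forall>x\<in>S. \<forall>\<^sub>F (x', y) in uniformity. x' = x \<longrightarrow> y \<in> S)"
instance
  by standard
    (auto simp: dist_blinop_def sgn_blinop_def uniformity_blinop_def open_blinop_def,
      (transfer; simp add: norm_triangle_ineq)+)
end

instance blinop :: (banach) banach
proof
  fix X :: "nat \<Rightarrow> 'a blinop"
  have dist: "dist f g = dist (blin f) (blin g)" for f g :: "'a blinop"
    unfolding dist_blinop_def dist_norm by transfer simp
  assume "Cauchy X"
  then have "Cauchy (\<lambda>n. blin (X n))"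
    by (simp add: Cauchy_def dist)
  then obtain l where "(\<lambda>n. blin (X n)) \<longlonglongrightarrow> l"
    by (auto simp: Cauchy_convergent_iff convergent_def)
  then have "X \<longlonglongrightarrow> Blinop l"
    by (simp add: lim_sequentially dist Blinop_inverse)
  then show "convergent X"
    by (rule convergentI)
qed

text \<open>A class instance cannot be attached to the diagonal case of the two-argument type of
  bounded linear maps, hence the copy \<open>blinop\<close>. The algebra structure gives access to
  \<open>exp\<close>. The sort \<open>perfect_space\<close> excludes the zero space, in which 0 and
  1 coincide.\<close>

instantiation blinop :: ("{banach, perfect_space}") real_normed_algebra_1
begin
lift_definition one_blinop :: "'a blinop" is id_blinfun .
lift_definition times_blinop :: "'a blinop \<Rightarrow> 'a blinop \<Rightarrow> 'a blinop" is "(o\<^sub>L)" .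
instance
proof
  fix a b c :: "'a blinop" and r :: real
  show "a * b * c = a * (b * c)" "1 * a = a" "a * 1 = a" "(a + b) * c = a * c + b * c"
    "a * (b + c) = a * b + a * c" "r *\<^sub>R a * b = r *\<^sub>R (a * b)" "a * r *\<^sub>R b = r *\<^sub>R (a * b)"
    by (transfer; auto intro!: blinfun_eqI simp: blinfun.bilinear_simps)+
  show "norm (a * b) \<le> norm a * norm b" "norm (1 :: 'a blinop) = 1"
    by (transfer; simp add: norm_blinfun_compose)+
  have "norm (0 :: 'a blinop) \<noteq> norm (1 :: 'a blinop)"
    by (transfer; simp)
  then show "(0 :: 'a blinop) \<noteq> 1" by metis
qed
end

definition bl :: "'a::real_normed_vector blinop \<Rightarrow> 'a \<Rightarrow> 'a"
  where "bl f = blinfun_apply (blin f)"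

lemma bl_simps [simp]:
  fixes f g :: "'a::{banach, perfect_space} blinop"
  shows "bl (f * g) x = bl f (bl g x)" "bl 1 x = x" "bl (f + g) x = bl f x + bl g x"
    "bl (f - g) x = bl f x - bl g x" "bl (r *\<^sub>R f) x = r *\<^sub>R bl f x" "bl 0 x = 0"
  unfolding bl_def by (transfer; simp add: blinfun.bilinear_simps)+

lemma norm_bl: "norm (bl f x) \<le> norm f * norm x"
  unfolding bl_def by transfer (rule norm_blinfun)

lemma bounded_bilinear_bl: "bounded_bilinear (bl :: 'a::{banach, perfect_space} blinop \<Rightarrow> 'a \<Rightarrow> 'a)"
  by (rule bounded_bilinear.intro)
    (auto simp: bl_def blinfun.bilinear_simps plus_blinop.rep_eq scaleR_blinop.rep_eq norm_blinop.rep_eq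
      intro!: exI[of _ 1] norm_blinfun)

interpretation bl: bounded_bilinear "bl :: 'a::{banach, perfect_space} blinop \<Rightarrow> 'a \<Rightarrow> 'a"
  by (rule bounded_bilinear_bl)

lemma blinop_eqI: "(\<And>x. bl f x = bl g x) \<Longrightarrow> f = g"
  unfolding bl_def by transfer (auto intro: blinfun_eqI)

lemma dissipativeD:
  assumes "dissipative A" "(x, y) \<in> A" "lam > 0"
  shows "lam * norm x \<le> norm (lam *\<^sub>R x - y)"
  using assms unfolding dissipative_def by auto

lemma linear_operatorD:
  assumes "linear_operator A"
  shows "(0, 0) \<in> A" "(x, y) \<in> A \<Longrightarrow> (x', y') \<in> A \<Longrightarrow> (x + x', y + y') \<in> A"
    "(x, y) \<in> A \<Longrightarrow> (x', y') \<in> A \<Longrightarrow> (x - x', y - y') \<in> A"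
    "(x, y) \<in> A \<Longrightarrow> (r *\<^sub>R x, r *\<^sub>R y) \<in> A"
    "(x, y) \<in> A \<Longrightarrow> (x, z) \<in> A \<Longrightarrow> y = z"
proof -
  have s: "subspace A" and v: "single_valued A" using assms by (auto simp: linear_operator_def)
  show "(0, 0) \<in> A" using subspace_0[OF s] by (simp add: zero_prod_def)
  show "(x, y) \<in> A \<Longrightarrow> (x', y') \<in> A \<Longrightarrow> (x + x', y + y') \<in> A"
    using subspace_add[OF s, of "(x, y)" "(x', y')"] by simp
  show "(x, y) \<in> A \<Longrightarrow> (x', y') \<in> A \<Longrightarrow> (x - x', y - y') \<in> A"
    using subspace_diff[OF s, of "(x, y)" "(x', y')"] by simp
  show "(x, y) \<in> A \<Longrightarrow> (r *\<^sub>R x, r *\<^sub>R y) \<in> A"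
    using subspace_scale[OF s, of "(x, y)" r] by simp
  show "(x, y) \<in> A \<Longrightarrow> (x, z) \<in> A \<Longrightarrow> y = z"
    using v by (auto simp: single_valued_def)
qed

lemma dissipative_linear: "dissipative A \<Longrightarrow> linear_operator A"
  by (simp add: dissipative_def)

lemma dissipative_inj:
  assumes "dissipative A" "lam > 0" "(x, y) \<in> A" "(x', y') \<in> A"
    and "lam *\<^sub>R x - y = lam *\<^sub>R x' - y'"
  shows "x = x'"
proof -
  have "lam * norm (x - x') \<le> norm (lam *\<^sub>R (x - x') - (y - y'))"
    using linear_operatorD(3)[OF dissipative_linear[OF assms(1)] assms(3,4)]
    by (intro dissipativeD[OF assms(1)]) (auto simp: assms(2))
  also have "lam *\<^sub>R (x - x') - (y - y') = 0" using assms(5) by (simp add: algebra_simps)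
  finally show ?thesis using assms(2) by (simp add: mult_le_0_iff)
qed

subsection \<open>Closures of dissipative operators\<close>

lemma closure_prodE:
  fixes A :: "('a::metric_space \<times> 'b::metric_space) set"
  assumes "(x, y) \<in> closure A"
  obtains X Y where "\<And>n. (X n, Y n) \<in> A" "X \<longlonglongrightarrow> x" "Y \<longlonglongrightarrow> y"
proof -
  obtain Z where Z: "\<And>n. Z n \<in> A" "Z \<longlonglongrightarrow> (x, y)"
    using assms by (auto simp: closure_sequential)
  show ?thesis
    using Z(1) tendsto_fst[OF Z(2)] tendsto_snd[OF Z(2)]
    by (intro that[of "\<lambda>n. fst (Z n)" "\<lambda>n. snd (Z n)"]) auto
qed

lemma closure_prodI:
  fixes A :: "('a::metric_space \<times> 'b::metric_space) set"
  assumes "\<And>n. (X n, Y n) \<in> A" "X \<longlonglongrightarrow> x" "Y \<longlonglongrightarrow> y"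
  shows "(x, y) \<in> closure A"
  unfolding closure_sequential
  by (rule exI[of _ "\<lambda>n. (X n, Y n)"]) (use assms tendsto_Pair[OF assms(2,3)] in blast)

lemma subspace_closure_graph:
  fixes A :: "('a::real_normed_vector \<times> 'a) set"
  assumes "subspace A"
  shows "subspace (closure A)"
proof (rule subspaceI)
  show "0 \<in> closure A" using subspace_0[OF assms] closure_subset by blast
next
  fix z w assume "z \<in> closure A" "w \<in> closure A"
  then obtain Z W where ZW: "\<And>n. Z n \<in> A" "Z \<longlonglongrightarrow> z" "\<And>n. W n \<in> A" "W \<longlonglongrightarrow> w"
    by (auto simp: closure_sequential)
  show "z + w \<in> closure A"
    unfolding closure_sequential
    by (rule exI[of _ "\<lambda>n. Z n + W n"]) (auto intro: ZW tendsto_add subspace_add[OF assms])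
next
  fix r z assume "z \<in> closure A"
  then obtain Z where Z: "\<And>n. Z n \<in> A" "Z \<longlonglongrightarrow> z"
    by (auto simp: closure_sequential)
  show "r *\<^sub>R z \<in> closure A"
    unfolding closure_sequential
    by (rule exI[of _ "\<lambda>n. r *\<^sub>R Z n"])
      (auto intro: Z tendsto_scaleR[OF tendsto_const] subspace_scale[OF assms])
qed

lemma closure_dissipativity_estimate:
  fixes A :: "('a::real_normed_vector \<times> 'a) set"
  assumes "dissipative A" "(x, y) \<in> closure A" "lam > 0"
  shows "lam * norm x \<le> norm (lam *\<^sub>R x - y)"
proof -
  obtain X Y where XY: "\<And>n. (X n, Y n) \<in> A" "X \<longlonglongrightarrow> x" "Y \<longlonglongrightarrow> y"
    using closure_prodE[OF assms(2)] by blast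
  have "(\<lambda>n. lam * norm (X n)) \<longlonglongrightarrow> lam * norm x"
    "(\<lambda>n. norm (lam *\<^sub>R X n - Y n)) \<longlonglongrightarrow> norm (lam *\<^sub>R x - y)"
    by (intro tendsto_intros XY)+
  then show ?thesis
    by (rule LIMSEQ_le) (use dissipativeD[OF assms(1) XY(1) assms(3)] in auto)
qed

text \<open>Density of the domain makes a dissipative operator closable. If (0, y) lies in the
  closure and (z, w) in \<open>A\<close>, the estimate with \<open>lam = 1 / e\<close> at (e z, y +
  e w) gives norm z \<le> norm (z - y - e w), hence norm z \<le> norm (z - y) as e tends to 0;
  letting z approach y forces y = 0.\<close>

lemma dissipative_closure:
  fixes A :: "('a::real_normed_vector \<times> 'a) set"
  assumes A: "dissipative A" and dense: "closure (Domain A) = UNIV"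
  shows "dissipative (closure A)"
proof -
  have lin: "linear_operator A" using A by (rule dissipative_linear)
  have sub: "subspace (closure A)"
    using lin by (intro subspace_closure_graph) (simp add: linear_operator_def)
  have zero: "y = 0" if y: "(0, y) \<in> closure A" for y
  proof -
    have step: "norm z \<le> norm (z - y)" if "(z, w) \<in> A" for z w
    proof -
      have "norm z \<le> norm (z - y - e *\<^sub>R w)" if e: "e > 0" for e
      proof -
        have "(e *\<^sub>R z, e *\<^sub>R w) \<in> closure A"
          using linear_operatorD(4)[OF lin \<open>(z, w) \<in> A\<close>] closure_subset by blast
        then have "(e *\<^sub>R z, y + e *\<^sub>R w) \<in> closure A"
          using subspace_add[OF sub y, of "(e *\<^sub>R z, e *\<^sub>R w)"] by simp
        from closure_dissipativity_estimate[OF A this, of "1 / e"]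
        show ?thesis using e by (simp add: algebra_simps)
      qed
      moreover have "((\<lambda>e. norm (z - y - e *\<^sub>R w)) \<longlongrightarrow> norm (z - y - 0 *\<^sub>R w)) (at_right 0)"
        by (intro tendsto_intros)
      ultimately show ?thesis
        by (intro tendsto_lowerbound[where F = "at_right 0"])
          (auto simp: eventually_at_right_less eventually_at_filter intro!: always_eventually)
    qed
    have "y \<in> closure (Domain A)" by (simp add: dense)
    then obtain z where z: "\<And>n. z n \<in> Domain A" "z \<longlonglongrightarrow> y"
      by (auto simp: closure_sequential)
    have "(\<lambda>n. norm (z n)) \<longlonglongrightarrow> norm y" "(\<lambda>n. norm (z n - y)) \<longlonglongrightarrow> norm (y - y)"
      by (intro tendsto_intros z)+
    then have "norm y \<le> norm (y - y)"
      by (rule LIMSEQ_le) (use z(1) step in blast)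
    then show ?thesis by simp
  qed
  have "single_valued (closure A)"
  proof (rule single_valuedI)
    fix x y z assume "(x, y) \<in> closure A" "(x, z) \<in> closure A"
    then have "(0, y - z) \<in> closure A"
      using subspace_diff[OF sub, of "(x, y)" "(x, z)"] by simp
    from zero[OF this] show "y = z" by simp
  qed
  then show ?thesis
    using sub closure_dissipativity_estimate[OF A]
    by (auto simp: dissipative_def linear_operator_def)
qed

text \<open>Dissipativity bounds the distance of two preimages by that of their images divided by
  \<open>lam\<close>. Preimages of a convergent sequence are therefore Cauchy, and completeness
  supplies their limit.\<close>

lemma dissipative_closure_range:
  fixes A :: "('a::banach \<times> 'a) set"
  assumes A: "dissipative A" and lam: "lam > 0"
    and dense: "closure ((\<lambda>(x, y). lam *\<^sub>R x - y) ` A) = UNIV"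
  shows "\<exists>x y. (x, y) \<in> closure A \<and> lam *\<^sub>R x - y = z"
proof -
  have lin: "linear_operator A" using A by (rule dissipative_linear)
  have "z \<in> closure ((\<lambda>(x, y). lam *\<^sub>R x - y) ` A)" by (simp add: dense)
  then obtain Z where Z: "\<And>n. Z n \<in> (\<lambda>(x, y). lam *\<^sub>R x - y) ` A" "Z \<longlonglongrightarrow> z"
    by (auto simp: closure_sequential)
  from Z(1) have "\<exists>x y. (x, y) \<in> A \<and> lam *\<^sub>R x - y = Z n" for n
    unfolding image_iff by (metis (no_types, lifting) case_prod_conv surj_pair)
  then obtain X Y where XY: "\<And>n. (X n, Y n) \<in> A" "\<And>n. lam *\<^sub>R X n - Y n = Z n"
    by metis
  have dX: "lam * dist (X m) (X n) \<le> dist (Z m) (Z n)" for m n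
  proof -
    have "lam * norm (X m - X n) \<le> norm (lam *\<^sub>R (X m - X n) - (Y m - Y n))"
      by (rule dissipativeD[OF A linear_operatorD(3)[OF lin XY(1) XY(1)] lam])
    also have "lam *\<^sub>R (X m - X n) - (Y m - Y n) = Z m - Z n"
      by (simp add: XY(2)[symmetric] algebra_simps)
    finally show ?thesis by (simp add: dist_norm)
  qed
  have "Cauchy X"
    unfolding Cauchy_def
  proof (intro allI impI)
    fix e :: real assume "e > 0"
    then obtain M where M: "\<And>m n. m \<ge> M \<Longrightarrow> n \<ge> M \<Longrightarrow> dist (Z m) (Z n) < lam * e"
      using LIMSEQ_imp_Cauchy[OF Z(2)] lam unfolding Cauchy_def by (meson mult_pos_pos)
    have "dist (X m) (X n) < e" if "m \<ge> M" "n \<ge> M" for m n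
      using le_less_trans[OF dX M[OF that]] lam by simp
    then show "\<exists>M. \<forall>m\<ge>M. \<forall>n\<ge>M. dist (X m) (X n) < e" by blast
  qed
  then obtain x where x: "X \<longlonglongrightarrow> x" by (auto simp: Cauchy_convergent_iff convergent_def)
  have "(\<lambda>n. lam *\<^sub>R X n - Z n) \<longlonglongrightarrow> lam *\<^sub>R x - z"
    by (intro tendsto_intros x Z)
  moreover have "lam *\<^sub>R X n - Z n = Y n" for n by (simp add: XY(2)[symmetric])
  ultimately have "(x, lam *\<^sub>R x - z) \<in> closure A"
    by (intro closure_prodI[OF XY(1) x]) simp
  then show ?thesis by (intro exI[of _ x] exI[of _ "lam *\<^sub>R x - z"]) simp
qed

section \<open>Generators of contraction semigroups: dissipativity and maximality\<close>

lemma generator_linear: "linear_operator (generator V)"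
  unfolding linear_operator_def
proof
  show "single_valued (generator V)"
    by (rule single_valuedI) (auto simp: generator_def intro: tendsto_unique[of "at_right (0::real)"])
  show "subspace (generator V)"
  proof (rule subspaceI)
    show "0 \<in> generator V"
      by (auto simp: generator_def zero_prod_def blinfun.bilinear_simps)
  next
    fix z w assume "z \<in> generator V" "w \<in> generator V"
    then show "z + w \<in> generator V"
      by (cases z; cases w)
        (auto simp: generator_def blinfun.bilinear_simps algebra_simps dest: tendsto_add)
  next
    fix r z assume "z \<in> generator V"
    then show "r *\<^sub>R z \<in> generator V"
      by (cases z)
        (auto simp: generator_def blinfun.bilinear_simps algebra_simps dest: tendsto_scaleR[OF tendsto_const, of _ _ _ r])
  qed
qed

text \<open>The vector (lam + 1 / t) x is the sum of lam x minus the difference quotient and V t x /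
  t. By contractivity norm x / t cancels on both sides before t tends to 0.\<close>

lemma generator_dissipative:
  assumes "contraction_C0_semigroup V"
  shows "dissipative (generator V)"
  unfolding dissipative_def
proof (intro conjI generator_linear allI impI ballI, clarify)
  fix lam :: real and x y assume lam: "lam > 0" and xy: "(x, y) \<in> generator V"
  have lim: "((\<lambda>t. (blinfun_apply (V t) x - x) /\<^sub>R t) \<longlongrightarrow> y) (at_right 0)"
    using xy by (simp add: generator_def)
  have "((\<lambda>t. norm (lam *\<^sub>R x - (blinfun_apply (V t) x - x) /\<^sub>R t)) \<longlongrightarrow> norm (lam *\<^sub>R x - y)) (at_right 0)"
    by (intro tendsto_intros lim)
  moreover have "lam * norm x \<le> norm (lam *\<^sub>R x - (blinfun_apply (V t) x - x) /\<^sub>R t)" if t: "t > 0" for t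
  proof -
    have "norm (blinfun_apply (V t) x) \<le> 1 * norm x"
      using assms t norm_blinfun[of "V t" x]
      by (intro order_trans[OF norm_blinfun] mult_right_mono) (auto simp: contraction_C0_semigroup_def)
    then have le: "norm (blinfun_apply (V t) x) / t \<le> norm x / t"
      using t by (simp add: divide_right_mono)
    have "lam * norm x + norm x / t = norm ((lam + 1 / t) *\<^sub>R x)"
      unfolding norm_scaleR using t lam by (simp add: distrib_right)
    also have "(lam + 1 / t) *\<^sub>R x =
        (lam *\<^sub>R x - (blinfun_apply (V t) x - x) /\<^sub>R t) + blinfun_apply (V t) x /\<^sub>R t"
      using t by (simp add: algebra_simps inverse_eq_divide)
    also have "norm \<dots> \<le> norm (lam *\<^sub>R x - (blinfun_apply (V t) x - x) /\<^sub>R t) + norm (blinfun_apply (V t) x) / t"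
      using t by (intro order_trans[OF norm_triangle_ineq]) (simp add: divide_inverse mult.commute)
    finally show ?thesis using le by linarith
  qed
  ultimately show "lam * norm x \<le> norm (lam *\<^sub>R x - y)"
    by (intro tendsto_lowerbound[where F = "at_right 0"])
      (auto simp: eventually_at_filter intro!: always_eventually)
qed

text \<open>When 1 - A is onto there is no proper dissipative extension, since 1 - B is injective
  for dissipative B. This later turns the inclusion of an operator in a generator into
  equality.\<close>

lemma dissipative_extension_eq:
  assumes "A \<subseteq> B" "dissipative B" "\<And>z. \<exists>x y. (x, y) \<in> A \<and> x - y = z"
  shows "A = B"
proof
  show "B \<subseteq> A"
  proof clarify
    fix x y assume xy: "(x, y) \<in> B"
    obtain x' y' where A: "(x', y') \<in> A" "x' - y' = x - y" using assms(3) by blast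
    have "x' = x"
      using A xy assms(1) by (intro dissipative_inj[OF assms(2), of 1 x' y' x y]) auto
    with A show "(x, y) \<in> A" by (simp add: algebra_simps)
  qed
qed (rule assms(1))

subsection \<open>The Hille--Yosida theorem\<close>

lemma exp_commute_mult:
  fixes a b :: "'a::{real_normed_algebra_1, banach}"
  assumes "a * b = b * a"
  shows "exp a * b = b * exp a"
proof -
  have c: "a ^ n * b = b * a ^ n" for n
    by (induction n) (simp_all add: mult.assoc assms, metis assms mult.assoc)
  have "(\<lambda>n. (a ^ n /\<^sub>R fact n) * b) sums (exp a * b)"
    by (rule sums_mult2[OF exp_converges])
  moreover have "(\<lambda>n. b * (a ^ n /\<^sub>R fact n)) sums (b * exp a)"
    by (rule sums_mult[OF exp_converges])
  moreover have "(\<lambda>n. (a ^ n /\<^sub>R fact n) * b) = (\<lambda>n. b * (a ^ n /\<^sub>R fact n))"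
    by (simp add: c)
  ultimately show ?thesis by (metis sums_unique2)
qed

lemma has_vector_derivative_exp_bl:
  fixes B :: "'a::{banach, perfect_space} blinop"
  shows "((\<lambda>t. bl (exp (t *\<^sub>R B)) x) has_vector_derivative bl (exp (t *\<^sub>R B)) (bl B x)) (at t within S)"
proof -
  have "((\<lambda>t. bl (exp (t *\<^sub>R B)) x) has_vector_derivative bl (exp (t *\<^sub>R B) * B) x) (at t within S)"
    by (rule bounded_linear.has_vector_derivative[OF bl.bounded_linear_left exp_scaleR_has_vector_derivative_right])
  then show ?thesis by simp
qed

lemma vector_derivative_bound:
  fixes f :: "real \<Rightarrow> 'a::real_normed_vector"
  assumes "0 \<le> t" "\<And>s. 0 \<le> s \<Longrightarrow> s \<le> t \<Longrightarrow> (f has_vector_derivative f' s) (at s within {0..t})"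
    "\<And>s. 0 \<le> s \<Longrightarrow> s \<le> t \<Longrightarrow> norm (f' s) \<le> B"
  shows "norm (f t - f 0) \<le> B * t"
proof -
  have "norm (f t - f 0) \<le> B * norm (t - 0)"
  proof (rule differentiable_bound[of "{0..t}" f "\<lambda>s h. h *\<^sub>R f' s"])
    fix s assume s: "s \<in> {0..t}"
    show "(f has_derivative (\<lambda>h. h *\<^sub>R f' s)) (at s within {0..t})"
      using assms(2) s by (simp add: has_vector_derivative_def)
    show "onorm (\<lambda>h. h *\<^sub>R f' s) \<le> B"
    proof (rule onorm_bound)
      show "0 \<le> B" using assms(3)[of s] s order_trans[OF norm_ge_zero] by auto
      show "norm (h *\<^sub>R f' s) \<le> B * norm h" for h
        using mult_right_mono[OF assms(3)[of s], of "norm h"] s by (simp add: mult.commute)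
    qed
  qed (use assms(1) in auto)
  then show ?thesis using assms(1) by simp
qed

text \<open>The setting of the Lumer--Phillips theorem: the resolvent bound 1 / lam of Hille and
  Yosida is not assumed but comes from dissipativity.\<close>

locale max_dissipative =
  fixes A :: "('a::{banach, perfect_space} \<times> 'a) set"
  assumes diss: "dissipative A"
    and range: "\<And>lam z. lam > 0 \<Longrightarrow> \<exists>x y. (x, y) \<in> A \<and> lam *\<^sub>R x - y = z"
    and dense: "closure (Domain A) = UNIV"
begin

lemmas lin = linear_operatorD[OF dissipative_linear[OF diss]]

lemma dense_obtain: "e > 0 \<Longrightarrow> \<exists>x y. (x, y) \<in> A \<and> dist x z < e"
  using dense UNIV_I[of z] unfolding closure_approachable by (metis Domain.cases closure_approachable)

section \<open>Resolvents and Yosida approximations\<close>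

lemma resolvent_ex:
  assumes lam: "lam > 0"
  shows "\<exists>R. norm R \<le> 1 / lam \<and> (\<forall>z. (bl R z, lam *\<^sub>R bl R z - z) \<in> A)"
proof -
  have "\<exists>x. (x, lam *\<^sub>R x - z) \<in> A" for z
  proof -
    obtain x y where "(x, y) \<in> A" "lam *\<^sub>R x - y = z" using range[OF lam] by blast
    moreover from this have "y = lam *\<^sub>R x - z" by (simp add: algebra_simps)
    ultimately show ?thesis by metis
  qed
  then obtain r where r: "\<And>z. (r z, lam *\<^sub>R r z - z) \<in> A" by metis
  have uniq: "x = r z" if "(x, lam *\<^sub>R x - z) \<in> A" for x z
    by (rule dissipative_inj[OF diss lam that r]) simp
  have "bounded_linear r"
  proof (rule bounded_linear_intro[of _ "1 / lam"])
    show "r (x + y) = r x + r y" for x y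
      using lin(2)[OF r[of x] r[of y]]
      by (intro uniq[symmetric]) (simp add: algebra_simps)
    show "r (s *\<^sub>R x) = s *\<^sub>R r x" for s x
      using lin(4)[OF r[of x], of s]
      by (intro uniq[symmetric]) (simp add: algebra_simps)
    show "norm (r x) \<le> norm x * (1 / lam)" for x
      using dissipativeD[OF diss r[of x] lam] lam by (simp add: field_simps)
  qed
  then have "bl (Blinop (Blinfun r)) = r"
    by (simp add: bl_def Blinop_inverse bounded_linear_Blinfun_apply)
  moreover have "norm (Blinop (Blinfun r)) \<le> 1 / lam"
    using lam dissipativeD[OF diss r lam] \<open>bounded_linear r\<close>
    unfolding norm_blinop.rep_eq Blinop_inverse[OF UNIV_I]
    by (intro norm_blinfun_bound) (auto simp: bounded_linear_Blinfun_apply field_simps)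
  ultimately show ?thesis using r by (intro exI[of _ "Blinop (Blinfun r)"]) simp
qed

text \<open>The resolvent at n + 1; the shift keeps the spectral parameter positive for n =
  0.\<close>

definition resolv :: "nat \<Rightarrow> 'a blinop" where
  "resolv n = (SOME R. norm R \<le> 1 / real (Suc n) \<and> (\<forall>z. (bl R z, real (Suc n) *\<^sub>R bl R z - z) \<in> A))"

lemma resolv: "norm (resolv n) \<le> 1 / real (Suc n)" "(bl (resolv n) z, real (Suc n) *\<^sub>R bl (resolv n) z - z) \<in> A"
proof -
  have "norm (resolv n) \<le> 1 / real (Suc n) \<and> (\<forall>z. (bl (resolv n) z, real (Suc n) *\<^sub>R bl (resolv n) z - z) \<in> A)"
    unfolding resolv_def by (rule someI_ex, rule resolvent_ex) simp
  then show "norm (resolv n) \<le> 1 / real (Suc n)" "(bl (resolv n) z, real (Suc n) *\<^sub>R bl (resolv n) z - z) \<in> A"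
    by auto
qed

lemma resolv_eq:
  assumes "(x, y) \<in> A"
  shows "bl (resolv n) (real (Suc n) *\<^sub>R x - y) = x"
  by (rule dissipative_inj[OF diss _ resolv(2) assms, of "real (Suc n)"]) auto

text \<open>The argument stays on the graph: with x = R_m R_n z and y = R_n z, the vector (n - m) x
  + y solves the equation that characterizes R_m z, and R_n maps it back to x by
  \<open>resolv_eq\<close>.\<close>

lemma resolv_commute: "resolv m * resolv n = resolv n * resolv m"
proof (rule blinop_eqI)
  fix z
  define x where "x = bl (resolv m) (bl (resolv n) z)"
  define y where "y = bl (resolv n) z"
  have 1: "(x, real (Suc m) *\<^sub>R x - y) \<in> A" unfolding x_def y_def by (rule resolv)
  have 2: "(y, real (Suc n) *\<^sub>R y - z) \<in> A" unfolding y_def by (rule resolv)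
  have "(real (Suc n) *\<^sub>R x - (real (Suc m) *\<^sub>R x - y),
      real (Suc m) *\<^sub>R (real (Suc n) *\<^sub>R x - (real (Suc m) *\<^sub>R x - y)) - z) \<in> A"
  proof -
    have "((real (Suc n) - real (Suc m)) *\<^sub>R x + y,
        (real (Suc n) - real (Suc m)) *\<^sub>R (real (Suc m) *\<^sub>R x - y) + (real (Suc n) *\<^sub>R y - z)) \<in> A"
      by (intro lin(2) lin(4) 1 2)
    then show ?thesis by (simp add: algebra_simps)
  qed
  then have "bl (resolv m) z = real (Suc n) *\<^sub>R x - (real (Suc m) *\<^sub>R x - y)"
    using resolv_eq[of _ _ m] by fastforce
  then have "bl (resolv n) (bl (resolv m) z) = x"
    using resolv_eq[OF 1, of n] by simp
  then show "bl (resolv m * resolv n) z = bl (resolv n * resolv m) z" by (simp add: x_def)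
qed

text \<open>This is lam A R with lam = n + 1 and R = \<open>resolv n\<close>, rewritten by A R = lam
  R - 1 so that it is visibly bounded.\<close>

definition yosida :: "nat \<Rightarrow> 'a blinop" where
  "yosida n = (real (Suc n))\<^sup>2 *\<^sub>R resolv n - real (Suc n) *\<^sub>R 1"

abbreviation expY :: "real \<Rightarrow> nat \<Rightarrow> 'a \<Rightarrow> 'a" where "expY t n \<equiv> bl (exp (t *\<^sub>R yosida n))"

lemma yosida_commute: "yosida m * yosida n = yosida n * yosida m"
proof -
  have "(a *\<^sub>R resolv m - b *\<^sub>R 1) * (a' *\<^sub>R resolv n - b' *\<^sub>R 1) = (a' *\<^sub>R resolv n - b' *\<^sub>R 1) * (a *\<^sub>R resolv m - b *\<^sub>R 1)" for a b a' b'
    by (simp add: left_diff_distrib right_diff_distrib scaleR_diff_right resolv_commute[of m n] mult.commute)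
  then show ?thesis unfolding yosida_def .
qed

lemma yosida_graph: "(x, y) \<in> A \<Longrightarrow> bl (yosida n) x = real (Suc n) *\<^sub>R bl (resolv n) y"
proof -
  assume xy: "(x, y) \<in> A"
  define a where "a = real (Suc n)"
  have "bl (resolv n) y = a *\<^sub>R bl (resolv n) x - x"
    using resolv_eq[OF xy, of n] unfolding a_def[symmetric] by (simp add: bl.diff_right bl.scaleR_right algebra_simps)
  then show ?thesis
    unfolding yosida_def a_def[symmetric] by (simp add: power2_eq_square scaleR_diff_right)
qed

lemma norm_scaled_resolv: "norm (real (Suc n) *\<^sub>R bl (resolv n) z) \<le> norm z"
proof -
  have "norm (bl (resolv n) z) \<le> 1 / real (Suc n) * norm z"
    by (rule order_trans[OF norm_bl]) (intro mult_right_mono resolv norm_ge_zero)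
  then show ?thesis by (simp add: field_simps del: of_nat_Suc)
qed

text \<open>On the domain, lam R x - x = R y has norm at most norm y / lam. The uniform bound
  \<open>norm_scaled_resolv\<close> carries the convergence over to the whole space by
  density.\<close>

lemma scaled_resolv_tendsto: "(\<lambda>n. real (Suc n) *\<^sub>R bl (resolv n) z) \<longlonglongrightarrow> z"
proof (rule LIMSEQ_I)
  fix e :: real assume e: "e > 0"
  obtain x y where xy: "(x, y) \<in> A" "dist x z < e / 3"
    using dense_obtain[of "e / 3" z] e by auto
  obtain N where N: "norm y / (e / 3) < real N" using reals_Archimedean2 by blast
  have "norm (real (Suc n) *\<^sub>R bl (resolv n) z - z) < e" if n: "n \<ge> N" for n
  proof -
    have "norm (real (Suc n) *\<^sub>R bl (resolv n) z - z) =
        norm (real (Suc n) *\<^sub>R bl (resolv n) (z - x) + bl (resolv n) y + (x - z))"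
    proof -
      have "bl (resolv n) y = real (Suc n) *\<^sub>R bl (resolv n) x - x"
        using resolv_eq[OF xy(1), of n] by (simp add: bl.diff_right bl.scaleR_right algebra_simps del: of_nat_Suc)
      then show ?thesis
        by (simp add: bl.diff_right scaleR_diff_right del: of_nat_Suc)
    qed
    also have "\<dots> \<le> norm (z - x) + norm (bl (resolv n) y) + norm (x - z)"
      using norm_scaled_resolv[of n "z - x"]
      by (intro order_trans[OF norm_triangle_ineq] add_mono order_trans[OF norm_triangle_ineq]) auto
    also have "norm (bl (resolv n) y) \<le> norm y / real (Suc n)"
      using norm_scaled_resolv[of n y] unfolding norm_scaleR by (simp add: field_simps del: of_nat_Suc)
    also have "norm y / real (Suc n) < e / 3"
      using N n e by (simp add: field_simps) (smt (verit) mult_left_mono of_nat_mono)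
    finally show ?thesis using xy(2) by (simp add: dist_norm norm_minus_commute)
  qed
  then show "\<exists>no. \<forall>n\<ge>no. norm (real (Suc n) *\<^sub>R bl (resolv n) z - z) < e" by blast
qed

lemma yosida_tendsto: "(x, y) \<in> A \<Longrightarrow> (\<lambda>n. bl (yosida n) x) \<longlonglongrightarrow> y"
  using scaled_resolv_tendsto by (simp add: yosida_graph)

lemma norm_yosida_le: "(x, y) \<in> A \<Longrightarrow> norm (bl (yosida n) x) \<le> norm y"
  by (metis yosida_graph norm_scaled_resolv)

text \<open>The scalar part of the approximation splits off as a factor exp (- t lam), which exactly
  compensates the bound exp (t lam^2 norm R) \<le> exp (t lam) for the rest.\<close>

lemma norm_exp_yosida:
  assumes "t \<ge> 0"
  shows "norm (exp (t *\<^sub>R yosida n)) \<le> 1"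
proof -
  define a where "a = real (Suc n)"
  have a: "a > 0" by (simp add: a_def)
  have "exp (t *\<^sub>R yosida n) = exp ((t * a\<^sup>2) *\<^sub>R resolv n + (- (t * a)) *\<^sub>R 1)"
    by (simp add: yosida_def a_def scaleR_diff_right)
  also have "\<dots> = exp ((t * a\<^sup>2) *\<^sub>R resolv n) * exp ((- (t * a)) *\<^sub>R 1)"
    by (rule exp_add_commuting) simp
  also have "exp ((- (t * a)) *\<^sub>R (1 :: 'a blinop)) = exp (- (t * a)) *\<^sub>R 1"
    using exp_of_real[of "- (t * a)", where ?'a = "'a blinop"] by (simp add: of_real_def)
  finally have "norm (exp (t *\<^sub>R yosida n)) = norm (exp ((t * a\<^sup>2) *\<^sub>R resolv n)) * exp (- (t * a))"
    by simp
  also have "norm (exp ((t * a\<^sup>2) *\<^sub>R resolv n)) \<le> exp (t * a)"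
  proof (rule order_trans[OF norm_exp])
    have "(t * a\<^sup>2) * norm (resolv n) \<le> (t * a\<^sup>2) * (1 / a)"
      using resolv(1)[of n] assms by (intro mult_left_mono) (auto simp: a_def)
    then show "exp (norm ((t * a\<^sup>2) *\<^sub>R resolv n)) \<le> exp (t * a)"
      using a assms by (simp add: power2_eq_square)
  qed
  finally show ?thesis
    by (simp add: exp_minus field_simps mult_right_mono)
qed

lemma norm_exp_yosida_apply: "t \<ge> 0 \<Longrightarrow> norm (expY t n x) \<le> norm x"
  using order_trans[OF norm_bl mult_right_mono[OF norm_exp_yosida norm_ge_zero]] by simp

text \<open>The path exp (s Y_m) exp ((t - s) Y_n) x joins the two ends. Because the approximations
  commute it equals exp (s (Y_m - Y_n)) exp (t Y_n) x, whose derivative is a single term: a product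
  of contractions applied to (Y_m - Y_n) x.\<close>

lemma exp_yosida_diff:
  assumes t: "t \<ge> 0"
  shows "norm (expY t m x - expY t n x) \<le> norm (bl (yosida m) x - bl (yosida n) x) * t"
proof -
  define E where "E s = bl (exp (s *\<^sub>R (yosida m - yosida n))) (expY t n x)" for s
  have exps: "exp (s *\<^sub>R (yosida m - yosida n)) * exp (t *\<^sub>R yosida n) = exp (s *\<^sub>R yosida m) * exp ((t - s) *\<^sub>R yosida n)" for s
  proof -
    have "exp (s *\<^sub>R (yosida m - yosida n)) * exp (t *\<^sub>R yosida n) = exp (s *\<^sub>R (yosida m - yosida n) + t *\<^sub>R yosida n)"
      by (rule exp_add_commuting[symmetric]) (simp add: algebra_simps yosida_commute)
    also have "s *\<^sub>R (yosida m - yosida n) + t *\<^sub>R yosida n = s *\<^sub>R yosida m + (t - s) *\<^sub>R yosida n"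
      by (simp add: algebra_simps)
    also have "exp \<dots> = exp (s *\<^sub>R yosida m) * exp ((t - s) *\<^sub>R yosida n)"
      by (rule exp_add_commuting) (simp add: yosida_commute)
    finally show ?thesis .
  qed
  have E: "E s = expY s m (expY (t - s) n x)" for s
    unfolding E_def using exps by (metis bl_simps(1))
  have "norm (E t - E 0) \<le> norm (bl (yosida m) x - bl (yosida n) x) * t"
  proof (rule vector_derivative_bound[OF t])
    fix s assume s: "0 \<le> s" "s \<le> t"
    define D where "D = bl (exp (s *\<^sub>R (yosida m - yosida n))) (bl (yosida m - yosida n) (expY t n x))"
    show "(E has_vector_derivative D) (at s within {0..t})"
      unfolding E_def D_def by (rule has_vector_derivative_exp_bl)
    have c: "exp (t *\<^sub>R yosida n) * (yosida m - yosida n) = (yosida m - yosida n) * exp (t *\<^sub>R yosida n)"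
      by (rule exp_commute_mult) (simp add: algebra_simps yosida_commute)
    have "D = bl (exp (s *\<^sub>R (yosida m - yosida n)) * exp (t *\<^sub>R yosida n)) (bl (yosida m - yosida n) x)"
      unfolding D_def using c by (metis bl_simps(1))
    then have "D = expY s m (expY (t - s) n (bl (yosida m - yosida n) x))"
      unfolding exps by simp
    then have "norm D \<le> norm (bl (yosida m - yosida n) x)"
      using s by (metis norm_exp_yosida_apply diff_ge_0_iff_ge order_trans)
    then show "norm D \<le> norm (bl (yosida m) x - bl (yosida n) x)" by simp
  qed
  then show ?thesis by (simp add: E E_def[of 0])
qed

lemma exp_yosida_convergent:
  assumes t: "t \<ge> 0"
  shows "convergent (\<lambda>n. expY t n z)"
proof -
  have "Cauchy (\<lambda>n. expY t n z)"
    unfolding Cauchy_def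
  proof (intro allI impI)
    fix e :: real assume e: "e > 0"
    obtain x y where xy: "(x, y) \<in> A" "dist x z < e / 4"
      using dense_obtain[of "e / 4" z] e by auto
    have "Cauchy (\<lambda>n. bl (yosida n) x)" using LIMSEQ_imp_Cauchy[OF yosida_tendsto[OF xy(1)]] .
    then obtain M where M: "\<And>m n. m \<ge> M \<Longrightarrow> n \<ge> M \<Longrightarrow> dist (bl (yosida m) x) (bl (yosida n) x) < e / (4 * (t + 1))"
      unfolding Cauchy_def using e t by (metis add_nonneg_pos divide_pos_pos mult_pos_pos zero_less_numeral zero_less_one)
    have "dist (expY t m z) (expY t n z) < e" if mn: "m \<ge> M" "n \<ge> M" for m n
    proof -
      have "expY t m z - expY t n z =
          expY t m (z - x) + (expY t m x - expY t n x)
          + expY t n (x - z)"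
        by (simp add: bl.diff_right)
      also have "norm \<dots> \<le> norm (z - x) + norm (bl (yosida m) x - bl (yosida n) x) * t + norm (x - z)"
        by (intro order_trans[OF norm_triangle_ineq] add_mono norm_exp_yosida_apply t exp_yosida_diff)
      also have "norm (bl (yosida m) x - bl (yosida n) x) * t \<le> e / (4 * (t + 1)) * t"
        using M[OF mn] t by (intro mult_right_mono) (auto simp: dist_norm)
      also have "e / (4 * (t + 1)) * t \<le> e / 4"
        using e t by (simp add: field_simps)
      finally show ?thesis using xy(2) e by (simp add: dist_norm norm_minus_commute)
    qed
    then show "\<exists>M. \<forall>m\<ge>M. \<forall>n\<ge>M. dist (expY t m z) (expY t n z) < e"
      by blast
  qed
  then show ?thesis by (simp add: Cauchy_convergent_iff)
qed

section \<open>The limit semigroup and its generator\<close>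

definition sg :: "real \<Rightarrow> 'a \<Rightarrow> 'a" where
  "sg t z = lim (\<lambda>n. expY t n z)"

lemma sg_tendsto: "t \<ge> 0 \<Longrightarrow> (\<lambda>n. expY t n z) \<longlonglongrightarrow> sg t z"
  unfolding sg_def using exp_yosida_convergent by (simp add: convergent_LIMSEQ_iff)

lemma norm_sg: "t \<ge> 0 \<Longrightarrow> norm (sg t z) \<le> norm z"
  by (rule Lim_norm_ubound[OF _ sg_tendsto]) (auto simp: norm_exp_yosida_apply)

lemma sg_add: "t \<ge> 0 \<Longrightarrow> sg t (x + y) = sg t x + sg t y"
  using tendsto_add[OF sg_tendsto[of t x] sg_tendsto[of t y]]
  by (intro LIMSEQ_unique[OF sg_tendsto]) (auto simp: bl.add_right)

lemma sg_scaleR: "t \<ge> 0 \<Longrightarrow> sg t (r *\<^sub>R x) = r *\<^sub>R sg t x"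
  using tendsto_scaleR[OF tendsto_const sg_tendsto[of t x], of r]
  by (intro LIMSEQ_unique[OF sg_tendsto]) (auto simp: bl.scaleR_right)

lemma bounded_linear_sg: "t \<ge> 0 \<Longrightarrow> bounded_linear (sg t)"
  by (rule bounded_linear_intro[of _ 1]) (auto simp: sg_add sg_scaleR norm_sg)

lemma sg_diff: "t \<ge> 0 \<Longrightarrow> sg t (x - y) = sg t x - sg t y"
  using bounded_linear.linear[OF bounded_linear_sg] linear_diff by blast

lemma sg_0: "sg 0 z = z"
  using sg_tendsto[of 0 z] by (simp add: LIMSEQ_const_iff)

lemma sg_plus:
  assumes "s \<ge> 0" "t \<ge> 0"
  shows "sg (s + t) z = sg s (sg t z)"
proof (rule LIMSEQ_unique[OF sg_tendsto])
  have "(\<lambda>n. expY s n (expY t n z - sg t z)) \<longlonglongrightarrow> 0"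
  proof (rule Lim_null_comparison)
    show "\<forall>\<^sub>F n in sequentially. norm (expY s n (expY t n z - sg t z))
        \<le> norm (expY t n z - sg t z)"
      using assms by (simp add: norm_exp_yosida_apply)
    show "(\<lambda>n. norm (expY t n z - sg t z)) \<longlonglongrightarrow> 0"
      using sg_tendsto[OF assms(2), of z] by (simp add: LIM_zero_iff tendsto_norm_zero_iff)
  qed
  from tendsto_add[OF this sg_tendsto[OF assms(1), of "sg t z"]]
  have "(\<lambda>n. expY s n (expY t n z)) \<longlonglongrightarrow> sg s (sg t z)"
    by (simp add: bl.diff_right)
  moreover have "exp ((s + t) *\<^sub>R yosida n) = exp (s *\<^sub>R yosida n) * exp (t *\<^sub>R yosida n)" for n
    unfolding scaleR_add_left by (rule exp_add_commuting) simp
  ultimately show "(\<lambda>n. expY (s + t) n z) \<longlonglongrightarrow> sg s (sg t z)" by simp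
qed (use assms in simp)

lemma sg_deviation:
  assumes "(x, y) \<in> A" "t \<ge> 0"
  shows "norm (sg t x - x) \<le> norm y * t"
proof (rule Lim_norm_ubound)
  show "(\<lambda>n. expY t n x - x) \<longlonglongrightarrow> sg t x - x"
    by (intro tendsto_intros sg_tendsto assms)
  have "norm (expY t n x - expY 0 n x) \<le> norm y * t" for n
    using assms
    by (intro vector_derivative_bound[OF _ has_vector_derivative_exp_bl])
      (auto intro: order_trans[OF norm_exp_yosida_apply norm_yosida_le])
  then show "\<forall>\<^sub>F n in sequentially. norm (expY t n x - x) \<le> norm y * t" by simp
qed simp

lemma sg_continuous: "continuous_on {0..} (\<lambda>t. sg t z)"
proof -
  have diff: "norm (sg t z - sg s z) \<le> norm (sg (t - s) z - z)" if "0 \<le> s" "s \<le> t" for s t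
  proof -
    have "sg t z - sg s z = sg s (sg (t - s) z - z)"
      using sg_plus[of s "t - s" z] that by (simp add: sg_diff)
    then show ?thesis using norm_sg[of s] that by simp
  qed
  show ?thesis
    unfolding continuous_on_iff
  proof (intro ballI allI impI)
    fix t e :: real assume t: "t \<in> {0..}" and e: "e > 0"
    obtain x y where xy: "(x, y) \<in> A" "dist x z < e / 3"
      using dense_obtain[of "e / 3" z] e by auto
    have small: "norm (sg h z - z) < e" if h: "0 \<le> h" "h < e / (3 * (norm y + 1))" for h
    proof -
      have "norm (sg h z - z) = norm (sg h (z - x) + (sg h x - x) + (x - z))"
        using h by (simp add: sg_diff)
      also have "\<dots> \<le> norm (z - x) + norm y * h + norm (x - z)"
        by (intro order_trans[OF norm_triangle_ineq] add_mono norm_sg sg_deviation xy h order_refl)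
      also have "norm y * h \<le> norm y * (e / (3 * (norm y + 1)))"
        using h by (intro mult_left_mono) auto
      also have "\<dots> \<le> e / 3"
        using e by (simp add: field_simps add_pos_nonneg)
      finally show ?thesis using xy(2) by (simp add: dist_norm norm_minus_commute)
    qed
    have "dist (sg t' z) (sg t z) < e" if "t' \<in> {0..}" "dist t' t < e / (3 * (norm y + 1))" for t'
    proof (cases "t \<le> t'")
      case True
      have "norm (sg t' z - sg t z) \<le> norm (sg (t' - t) z - z)" using True t by (intro diff) auto
      also have "\<dots> < e" using True that by (intro small) (auto simp: dist_real_def)
      finally show ?thesis by (simp add: dist_norm)
    next
      case False
      have "norm (sg t z - sg t' z) \<le> norm (sg (t - t') z - z)" using False that by (intro diff) auto
      also have "\<dots> < e" using False that by (intro small) (auto simp: dist_real_def)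
      finally show ?thesis by (simp add: dist_norm norm_minus_commute)
    qed
    moreover have "e / (3 * (norm y + 1)) > 0" using e by (simp add: add_nonneg_pos)
    ultimately show "\<exists>d>0. \<forall>t'\<in>{0..}. dist t' t < d \<longrightarrow> dist (sg t' z) (sg t z) < e" by blast
  qed
qed

text \<open>The value y need not lie in the domain, so no rate is known at which the semigroup moves
  it. It is replaced by a nearby domain element z, which moves by at most norm w times the elapsed
  time; twice norm (y - z) is the price.\<close>

lemma sg_derivative_bound:
  assumes xy: "(x, y) \<in> A" and zw: "(z, w) \<in> A" and t: "t \<ge> 0"
  shows "norm (sg t x - x - t *\<^sub>R y) \<le> (2 * norm (y - z) + norm w * t) * t"
proof (rule LIMSEQ_le)
  show "(\<lambda>n. norm (expY t n x - x - t *\<^sub>R y)) \<longlonglongrightarrow> norm (sg t x - x - t *\<^sub>R y)"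
    by (intro tendsto_intros sg_tendsto t)
  show "(\<lambda>n. (norm (bl (yosida n) x - y) + (2 * norm (y - z) + norm w * t)) * t)
      \<longlonglongrightarrow> (2 * norm (y - z) + norm w * t) * t"
  proof -
    have "(\<lambda>n. (norm (bl (yosida n) x - y) + (2 * norm (y - z) + norm w * t)) * t)
      \<longlonglongrightarrow> (norm (y - y) + (2 * norm (y - z) + norm w * t)) * t"
      by (intro tendsto_intros yosida_tendsto xy)
    then show ?thesis by simp
  qed
  have "norm (expY t n x - x - t *\<^sub>R y)
      \<le> (norm (bl (yosida n) x - y) + (2 * norm (y - z) + norm w * t)) * t" for n
  proof -
    define F where "F s = expY s n x - s *\<^sub>R y" for s
    have "norm (F t - F 0) \<le> (norm (bl (yosida n) x - y) + (2 * norm (y - z) + norm w * t)) * t"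
    proof (rule vector_derivative_bound[OF t])
      fix s assume s: "0 \<le> s" "s \<le> t"
      show "(F has_vector_derivative (expY s n (bl (yosida n) x) - y)) (at s within {0..t})"
        unfolding F_def
        by (rule derivative_eq_intros has_vector_derivative_exp_bl refl | simp)+
      have "norm (expY s n z - expY 0 n z) \<le> norm w * s"
        using s by (intro vector_derivative_bound[OF _ has_vector_derivative_exp_bl])
          (auto intro: order_trans[OF norm_exp_yosida_apply norm_yosida_le[OF zw]])
      also have "\<dots> \<le> norm w * t" using s by (intro mult_left_mono) auto
      finally have 1: "norm (expY s n z - z) \<le> norm w * t" by simp
      have "expY s n (bl (yosida n) x) - y = expY s n (bl (yosida n) x - y)
          + (expY s n (y - z) + (expY s n z - z) + (z - y))"
        by (simp add: bl.diff_right)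
      also have "norm \<dots> \<le> norm (bl (yosida n) x - y) + (norm (y - z) + norm w * t + norm (z - y))"
        by (intro order_trans[OF norm_triangle_ineq] add_mono norm_exp_yosida_apply 1 order_refl s)
      finally show "norm (expY s n (bl (yosida n) x) - y)
          \<le> norm (bl (yosida n) x - y) + (2 * norm (y - z) + norm w * t)"
        by (simp add: norm_minus_commute)
    qed
    then show ?thesis by (simp add: F_def algebra_simps)
  qed
  then show "\<exists>N. \<forall>n\<ge>N. norm (expY t n x - x - t *\<^sub>R y)
      \<le> (norm (bl (yosida n) x - y) + (2 * norm (y - z) + norm w * t)) * t" by blast
qed

lemma sg_generates:
  assumes xy: "(x, y) \<in> A"
  shows "((\<lambda>t. (sg t x - x) /\<^sub>R t) \<longlongrightarrow> y) (at_right 0)"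
proof (rule tendstoI)
  fix e :: real assume e: "e > 0"
  obtain z w where zw: "(z, w) \<in> A" "dist z y < e / 4"
    using dense_obtain[of "e / 4" y] e by auto
  have "dist ((sg t x - x) /\<^sub>R t) y < e" if t: "0 < t" "t < e / (2 * (norm w + 1))" for t
  proof -
    have "(sg t x - x) /\<^sub>R t - y = (sg t x - x - t *\<^sub>R y) /\<^sub>R t"
      using t by (simp add: algebra_simps)
    then have "norm ((sg t x - x) /\<^sub>R t - y) = norm (sg t x - x - t *\<^sub>R y) / t"
      using t by (simp add: divide_inverse mult.commute)
    also have "\<dots> \<le> (2 * norm (y - z) + norm w * t) * t / t"
      using t sg_derivative_bound[OF xy zw(1), of t] by (intro divide_right_mono) auto
    also have "\<dots> = 2 * norm (y - z) + norm w * t" using t by simp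
    also have "norm w * t \<le> norm w * (e / (2 * (norm w + 1)))"
      using t by (intro mult_left_mono) auto
    also have "\<dots> \<le> e / 2"
      using e by (simp add: field_simps add_pos_nonneg)
    finally show ?thesis using zw(2) by (simp add: dist_norm norm_minus_commute)
  qed
  moreover have "e / (2 * (norm w + 1)) > 0" using e by (simp add: add_nonneg_pos)
  ultimately show "\<forall>\<^sub>F t in at_right 0. dist ((sg t x - x) /\<^sub>R t) y < e"
    unfolding eventually_at_right_field by blast
qed

theorem hille_yosida: "\<exists>V. contraction_C0_semigroup V \<and> generator V = A"
proof -
  define V where "V t = Blinfun (sg t)" for t
  have V: "blinfun_apply (V t) = sg t" if "t \<ge> 0" for t
    unfolding V_def by (rule bounded_linear_Blinfun_apply[OF bounded_linear_sg[OF that]])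
  have "C0_semigroup V"
    unfolding C0_semigroup_def
  proof (intro conjI allI impI)
    show "V 0 = id_blinfun" by (rule blinfun_eqI) (simp add: V sg_0)
    show "V (s + t) = V s o\<^sub>L V t" if "s \<ge> 0" "t \<ge> 0" for s t
      using that by (intro blinfun_eqI) (simp add: V sg_plus)
    show "continuous_on {0..} (\<lambda>t. blinfun_apply (V t) x)" for x
      using sg_continuous[of x] by (rule continuous_on_eq) (simp add: V)
  qed
  moreover have "norm (V t) \<le> 1" if "t \<ge> 0" for t
    using that by (intro norm_blinfun_bound) (auto simp: V norm_sg)
  ultimately have contr: "contraction_C0_semigroup V"
    by (simp add: contraction_C0_semigroup_def)
  have "A \<subseteq> generator V"
  proof clarify
    fix x y assume "(x, y) \<in> A"
    from sg_generates[OF this] show "(x, y) \<in> generator V"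
      unfolding generator_def
      by (auto elim!: Lim_transform_eventually simp: V eventually_at_right_field intro!: exI[of _ 1])
  qed
  then have "A = generator V"
    using range[of 1] by (intro dissipative_extension_eq generator_dissipative contr) auto
  with contr show ?thesis by blast
qed

end

subsection \<open>Mild solutions\<close>

lemma integral_minus_const_bound:
  fixes u :: "real \<Rightarrow> 'a::banach"
  assumes "a \<le> b" "continuous_on {a..b} u" "\<And>s. a \<le> s \<Longrightarrow> s \<le> b \<Longrightarrow> norm (u s - c) \<le> e"
  shows "norm (integral {a..b} u - (b - a) *\<^sub>R c) \<le> e * (b - a)"
proof -
  have "norm (integral {a..b} (\<lambda>s. u s - c)) \<le> e * (b - a)"
    by (rule integral_bound) (use assms in \<open>auto intro!: continuous_intros\<close>)
  also have "integral {a..b} (\<lambda>s. u s - c) = integral {a..b} u - (b - a) *\<^sub>R c"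
    using assms by (subst integral_diff) (auto intro: integrable_continuous_real)
  finally show ?thesis .
qed

lemma right_derivative_integral:
  fixes u :: "real \<Rightarrow> 'a::banach"
  assumes cont: "continuous_on {0..} u" and t: "t \<ge> 0"
  shows "((\<lambda>h. (integral {0..t + h} u - integral {0..t} u) /\<^sub>R h) \<longlongrightarrow> u t) (at_right 0)"
proof (rule tendstoI)
  fix e :: real assume e: "e > 0"
  obtain d where d: "d > 0" "\<And>s. s \<ge> 0 \<Longrightarrow> dist s t < d \<Longrightarrow> dist (u s) (u t) < e / 2"
    using cont[unfolded continuous_on_iff, rule_format, of t "e / 2"] t e by auto
  have "dist ((integral {0..t + h} u - integral {0..t} u) /\<^sub>R h) (u t) < e" if h: "0 < h" "h < d" for h
  proof -
    have sub: "continuous_on {a..b} u" if "a \<ge> 0" for a b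
      using that by (intro continuous_on_subset[OF cont]) auto
    have "integral {0..t} u + integral {t..t + h} u = integral {0..t + h} u"
      using t h by (intro Henstock_Kurzweil_Integration.integral_combine integrable_continuous_real sub) auto
    then have eq: "integral {0..t + h} u - integral {0..t} u = integral {t..t + h} u"
      by (simp add: algebra_simps)
    have "norm (integral {t..t + h} u - (t + h - t) *\<^sub>R u t) \<le> e / 2 * (t + h - t)"
    proof (rule integral_minus_const_bound)
      show "norm (u s - u t) \<le> e / 2" if "t \<le> s" "s \<le> t + h" for s
        using d(2)[of s] that t h by (auto simp: dist_norm)
    qed (use h t sub in auto)
    then have "norm (integral {t..t + h} u - h *\<^sub>R u t) / h \<le> e / 2"
      using h by (simp add: field_simps)
    moreover have "(integral {t..t + h} u) /\<^sub>R h - u t = (integral {t..t + h} u - h *\<^sub>R u t) /\<^sub>R h"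
      using h by (simp add: algebra_simps)
    moreover have "norm ((integral {t..t + h} u - h *\<^sub>R u t) /\<^sub>R h) = norm (integral {t..t + h} u - h *\<^sub>R u t) / h"
      using h by (simp add: divide_inverse mult.commute)
    ultimately have "norm ((integral {t..t + h} u) /\<^sub>R h - u t) \<le> e / 2" by (simp only:)
    then show ?thesis unfolding eq dist_norm using e by simp
  qed
  then show "\<forall>\<^sub>F h in at_right 0. dist ((integral {0..t + h} u - integral {0..t} u) /\<^sub>R h) (u t) < e"
    unfolding eventually_at_right_field using d(1) by blast
qed

text \<open>If F t is the integral of the orbit up to t, then V h (F t) - F t = (F (t + h) - F t) -
  (F h - F 0). Divided by h, the two brackets tend to u t and to x.\<close>

lemma mild_solution_semigroup:
  fixes V :: "real \<Rightarrow> 'a::banach \<Rightarrow>\<^sub>L 'a"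
  assumes V: "C0_semigroup V"
  shows "mild_solution (generator V) x (\<lambda>t. blinfun_apply (V t) x)"
proof -
  define u where "u t = blinfun_apply (V t) x" for t
  have cont: "continuous_on {0..} u" using V by (auto simp: C0_semigroup_def u_def)
  have sub: "continuous_on {a..b} u" if "a \<ge> 0" for a b
    using that by (intro continuous_on_subset[OF cont]) auto
  have u0: "u 0 = x" using V by (simp add: C0_semigroup_def u_def)
  have add: "u (s + t) = blinfun_apply (V s) (u t)" if "s \<ge> 0" "t \<ge> 0" for s t
    using V that by (simp add: C0_semigroup_def u_def)
  have "(integral {0..t} u, u t - x) \<in> generator V" if t: "t \<ge> 0" for t
  proof -
    define F where "F t = integral {0..t} u" for t
    have VF: "blinfun_apply (V h) (F t) = F (t + h) - F h" if h: "h > 0" for h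
    proof -
      have "blinfun_apply (V h) (F t) = integral {0..t} (\<lambda>s. blinfun_apply (V h) (u s))"
        unfolding F_def
        using integral_linear[OF integrable_continuous_real[OF sub[of 0 t]] blinfun.bounded_linear_right[of "V h"]]
        by (simp add: o_def)
      also have "\<dots> = integral {0..t} (\<lambda>s. u (h + s))"
        using h by (intro integral_cong) (simp add: add)
      also have "\<dots> = integral {h..t + h} u"
        using integral_shift_Icc_real[of 0 t u h] by (simp add: o_def)
      also have "\<dots> = F (t + h) - F h"
      proof -
        have "F h + integral {h..t + h} u = F (t + h)"
          unfolding F_def using t h
          by (intro Henstock_Kurzweil_Integration.integral_combine integrable_continuous_real sub) auto
        then show ?thesis by (simp add: algebra_simps)
      qed
      finally show ?thesis .
    qed
    have "((\<lambda>h. (F (t + h) - F t) /\<^sub>R h - (F (0 + h) - F 0) /\<^sub>R h) \<longlongrightarrow> u t - u 0) (at_right 0)"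
      unfolding F_def by (intro tendsto_diff right_derivative_integral cont t order_refl)
    then have "((\<lambda>h. (blinfun_apply (V h) (F t) - F t) /\<^sub>R h) \<longlongrightarrow> u t - x) (at_right 0)"
      unfolding u0
    proof (rule Lim_transform_eventually)
      have F0: "F 0 = 0" by (simp add: F_def)
      have "(F (t + h) - F t) /\<^sub>R h - (F (0 + h) - F 0) /\<^sub>R h = (blinfun_apply (V h) (F t) - F t) /\<^sub>R h"
        if "h > 0" for h
        by (simp add: VF[OF that] F0 scaleR_diff_right)
      then show "\<forall>\<^sub>F h in at_right 0. (F (t + h) - F t) /\<^sub>R h - (F (0 + h) - F 0) /\<^sub>R h =
          (blinfun_apply (V h) (F t) - F t) /\<^sub>R h"
        unfolding eventually_at_right_field by (intro exI[of _ 1]) auto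
    qed
    then show ?thesis by (simp add: generator_def F_def)
  qed
  then have "\<forall>t\<ge>0. \<exists>y. (integral {0..t} u, y) \<in> generator V \<and> u t = x + y"
    by (metis add.commute diff_add_cancel)
  then show ?thesis
    using cont unfolding mild_solution_def u_def by blast
qed

text \<open>The stability of the implicit Euler scheme. For the difference w of two solutions, its
  integral W satisfies A (W t) = w t. Dissipativity with \<open>lam = 1 / h\<close> gives norm (W q)
  \<le> norm (W q - h w q), and W q - h w q differs from W (q - h) only by a quadrature error of at
  most e h once h is below the modulus of continuity. Hence norm (W t) \<le> e t for every e, so W t
  = 0 and w t = A 0 = 0.\<close>

lemma mild_solution_unique:
  fixes A :: "('a::banach \<times> 'a) set"
  assumes A: "dissipative A" and u: "mild_solution A x u" and v: "mild_solution A x v" and t: "t \<ge> 0"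
  shows "u t = v t"
proof -
  note lin = linear_operatorD[OF dissipative_linear[OF A]]
  define w where "w t = u t - v t" for t
  define W where "W t = integral {0..t} w" for t
  have contu: "continuous_on {0..} u" and contv: "continuous_on {0..} v"
    using u v by (auto simp: mild_solution_def)
  have cont: "continuous_on {0..} w"
    unfolding w_def by (intro continuous_intros contu contv)
  have sub: "continuous_on {a..b} w" if "a \<ge> 0" for a b
    using that by (intro continuous_on_subset[OF cont]) auto
  have W: "(W t, w t) \<in> A" if t: "t \<ge> 0" for t
  proof -
    obtain y where y: "(integral {0..t} u, y) \<in> A" "u t = x + y"
      using u t by (auto simp: mild_solution_def)
    obtain z where z: "(integral {0..t} v, z) \<in> A" "v t = x + z"
      using v t by (auto simp: mild_solution_def)
    have "W t = integral {0..t} u - integral {0..t} v"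
      unfolding W_def w_def
      by (intro integral_diff integrable_continuous_real continuous_on_subset[OF contu]
          continuous_on_subset[OF contv]) auto
    then show ?thesis using lin(3)[OF y(1) z(1)] y z by (simp add: w_def)
  qed
  have bound: "norm (W t) \<le> e * t" if e: "e > 0" for e
  proof -
    have "uniformly_continuous_on {0..t} w"
      by (intro compact_uniformly_continuous sub) auto
    then obtain d where d: "d > 0"
      "\<And>r s. r \<in> {0..t} \<Longrightarrow> s \<in> {0..t} \<Longrightarrow> dist r s < d \<Longrightarrow> dist (w r) (w s) < e"
      using e unfolding uniformly_continuous_on_def by metis
    obtain N :: nat where N: "t / d < real N" using reals_Archimedean2 by blast
    define h where "h = t / real (Suc N)"
    have h: "h \<ge> 0" "h < d" "h * real (Suc N) = t"
      using N d(1) t by (auto simp: h_def field_simps)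
    have "i \<le> Suc N \<Longrightarrow> norm (W (real i * h)) \<le> e * (real i * h)" for i
    proof (induction i)
      case 0
      then show ?case by (simp add: W_def)
    next
      case (Suc i)
      define p q where "p = real i * h" and "q = real (Suc i) * h"
      have "real (Suc i) * h \<le> real (Suc N) * h" using Suc.prems h(1) by (intro mult_right_mono) auto
      then have pq: "0 \<le> p" "q - p = h" "p \<le> q" "q \<le> t"
        using h by (auto simp: p_def q_def algebra_simps)
      show ?case
      \<comment> \<open>The step vanishes only for \<open>t = 0\<close>; then 1 / h is no admissible
        parameter in the dissipativity estimate.\<close>
      proof (cases "h = 0")
        case True
        then show ?thesis by (simp add: W_def)
      next
        case False
        with h have hpos: "h > 0" by simp
        have step: "norm (W q) \<le> norm (W q - h *\<^sub>R w q)"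
        proof -
          have "1 / h * norm (W q) \<le> norm ((1 / h) *\<^sub>R W q - w q)"
            using pq hpos by (intro dissipativeD[OF A W]) auto
          then have "h * (1 / h * norm (W q)) \<le> h * norm ((1 / h) *\<^sub>R W q - w q)"
            using hpos by (intro mult_left_mono) auto
          also have "h * norm ((1 / h) *\<^sub>R W q - w q) = norm (h *\<^sub>R ((1 / h) *\<^sub>R W q - w q))"
            using hpos by simp
          finally show ?thesis using hpos by (simp add: scaleR_diff_right)
        qed
        have Wq: "W q = W p + integral {p..q} w"
          unfolding W_def using pq
          by (intro Henstock_Kurzweil_Integration.integral_combine[symmetric] integrable_continuous_real sub) auto
        note step
        also have "norm (W q - h *\<^sub>R w q) \<le> norm (W p) + norm (integral {p..q} w - (q - p) *\<^sub>R w q)"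
          using norm_triangle_ineq[of "W p" "integral {p..q} w - h *\<^sub>R w q"] 
          unfolding Wq pq(2) by (simp add: add_diff_eq)
        also have "norm (integral {p..q} w - (q - p) *\<^sub>R w q) \<le> e * (q - p)"
        proof (rule integral_minus_const_bound)
          fix s assume s: "p \<le> s" "s \<le> q"
          then show "norm (w s - w q) \<le> e"
            using d(2)[of s q] pq h by (simp add: dist_norm less_imp_le)
        qed (use pq sub in auto)
        also have "norm (W p) \<le> e * p" using Suc by (simp add: p_def)
        finally show ?thesis unfolding q_def[symmetric] by (simp add: algebra_simps)
      qed
    qed
    from this[of "Suc N"] h(3) show ?thesis by (simp add: mult.commute)
  qed
  have "norm (W t) \<le> 0"
  proof (rule field_le_epsilon)
    fix e :: real assume e: "e > 0"
    have "norm (W t) \<le> e / (t + 1) * t" using e t by (intro bound) auto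
    also have "\<dots> \<le> e" using e t by (simp add: field_simps)
    finally show "norm (W t) \<le> 0 + e" by simp
  qed
  then have "w t = 0" using W[OF t] lin(1) lin(5)[of 0 "w t" 0] by simp
  then show ?thesis by (simp add: w_def)
qed


text \<open>By uniqueness every mild solution is an orbit of the contraction semigroup from
  \<open>hille_yosida\<close>. The bound thus reaches the orbits of any C0-semigroup generated by
  \<open>A\<close>, without that semigroup being assumed contractive.\<close>

lemma mild_solution_contraction:
  fixes A :: "('a::{banach, perfect_space} \<times> 'a) set"
  assumes "max_dissipative A" "mild_solution A x u" "t \<ge> 0"
  shows "norm (u t) \<le> norm x"
proof -
  interpret max_dissipative A by fact
  obtain V where V: "contraction_C0_semigroup V" "generator V = A" using hille_yosida by blast
  then have "mild_solution A x (\<lambda>t. blinfun_apply (V t) x)"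
    using mild_solution_semigroup[of V x] by (simp add: contraction_C0_semigroup_def)
  then have "u t = blinfun_apply (V t) x" by (rule mild_solution_unique[OF diss assms(2) _ assms(3)])
  moreover have "norm (blinfun_apply (V t) x) \<le> 1 * norm x"
    using V assms(3) by (intro order_trans[OF norm_blinfun] mult_right_mono) (auto simp: contraction_C0_semigroup_def)
  ultimately show ?thesis by simp
qed

subsection \<open>Calculus of smooth bounded functions\<close>

abbreviation ax :: "'d::finite \<Rightarrow> real^'d" where "ax j \<equiv> axis j 1"

abbreviation along :: "'d::finite \<Rightarrow> real^'d \<Rightarrow> real \<Rightarrow> real^'d" where "along j x t \<equiv> x + t *\<^sub>R ax j"

text \<open>Differentiability in direction \<open>j\<close> with derivative \<open>g\<close>, in the
  strong form of a quadratic remainder uniform in \<open>x\<close>. Uniform inequalities of this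
  kind survive pointwise limits and averaging, so that no exchange of limits has to be justified for
  derivatives.\<close>

abbreviation quad_taylor :: "'d::finite \<Rightarrow> (real^'d \<Rightarrow> real) \<Rightarrow> (real^'d \<Rightarrow> real) \<Rightarrow> bool" where
  "quad_taylor j f g \<equiv> \<exists>B. \<forall>x t. \<bar>t\<bar> \<le> 1 \<longrightarrow> \<bar>f (along j x t) - f x - t * g x\<bar> \<le> B * t\<^sup>2"

abbreviation pds :: "'d::finite list \<Rightarrow> (real^'d \<Rightarrow> real) \<Rightarrow> real^'d \<Rightarrow> real"
  where "pds \<equiv> fold partial_deriv"

lemma pds_snoc: "pds (js @ [j]) f = partial_deriv j (pds js f)"
  by simp

lemma pds_Cb_inf: "f \<in> Cb_inf \<Longrightarrow> pds js f \<in> Cb_inf"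
  by (induction js arbitrary: f) (auto intro: Cb_infD)

lemma Cb_inf_bound:
  assumes "f \<in> Cb_inf"
  obtains B where "B \<ge> 0" "\<And>x. \<bar>f x\<bar> \<le> B"
proof -
  obtain B where B: "\<And>x. \<bar>f x\<bar> \<le> B"
    using Cb_infD(2)[OF assms] by (auto simp: bounded_iff)
  then show ?thesis
    using that[of B] order_trans[OF abs_ge_zero B[of undefined]] by blast
qed

lemma Cb_inf_continuous: "f \<in> Cb_inf \<Longrightarrow> continuous_on UNIV f"
  by (rule uniformly_continuous_imp_continuous[OF Cb_inf_uniformly_continuous])

lemma Cb_inf_cmult: "f \<in> Cb_inf \<Longrightarrow> (\<lambda>x. r * f x) \<in> Cb_inf"
  by (intro Cb_inf_mult Cb_inf_const)

lemma Cb_inf_diff: "f \<in> Cb_inf \<Longrightarrow> g \<in> Cb_inf \<Longrightarrow> (\<lambda>x. f x - g x) \<in> Cb_inf"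
  using Cb_inf_add[OF _ Cb_inf_cmult[of g "-1"], of f] by simp

lemma partial_deriv_cmult:
  assumes "f \<in> Cb_inf"
  shows "partial_deriv j (\<lambda>x. r * f x) = (\<lambda>x. r * partial_deriv j f x)"
  using partial_deriv_mult[of "\<lambda>_. r", OF _ Cb_infD(1)[OF assms], of _ j]
  by (auto simp: partial_deriv_const)

lemma partial_deriv_Cb_add:
  assumes "f \<in> Cb_inf" "g \<in> Cb_inf"
  shows "partial_deriv j (\<lambda>x. f x + g x) = (\<lambda>x. partial_deriv j f x + partial_deriv j g x)"
  by (intro ext partial_deriv_add Cb_infD assms)

lemma partial_deriv_Cb_mult:
  assumes "f \<in> Cb_inf" "g \<in> Cb_inf"
  shows "partial_deriv j (\<lambda>x. f x * g x) = (\<lambda>x. f x * partial_deriv j g x + partial_deriv j f x * g x)"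
  by (intro ext partial_deriv_mult Cb_infD assms)

lemma partial_deriv_Cb_diff:
  assumes "f \<in> Cb_inf" "g \<in> Cb_inf"
  shows "partial_deriv j (\<lambda>x. f x - g x) = (\<lambda>x. partial_deriv j f x - partial_deriv j g x)"
  using partial_deriv_Cb_add[OF assms(1) Cb_inf_cmult[OF assms(2)], of j "-1"]
    partial_deriv_cmult[OF assms(2), of j "-1"] by simp

lemma partial_deriv_Cb_sum:
  assumes "\<And>i. i \<in> I \<Longrightarrow> f i \<in> Cb_inf"
  shows "partial_deriv j (\<lambda>x. \<Sum>i\<in>I. f i x) = (\<lambda>x. \<Sum>i\<in>I. partial_deriv j (f i) x)"
  using assms
  by (induction I rule: infinite_finite_induct)
    (auto simp: partial_deriv_const partial_deriv_Cb_add Cb_inf_sum)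

lemma has_partial_derivative:
  assumes "f \<in> Cb_inf"
  shows "((\<lambda>t. f (along j x t)) has_real_derivative partial_deriv j f (along j x t)) (at t)"
proof -
  let ?D = "frechet_derivative f (at (along j x t))"
  have D: "(f has_derivative ?D) (at (along j x t))"
    using Cb_infD(1)[OF assms] by (simp add: frechet_derivative_works[symmetric])
  have "((\<lambda>t. f (along j x t)) has_derivative (\<lambda>h. ?D (h *\<^sub>R ax j))) (at t)"
    by (rule has_derivative_compose[of "\<lambda>t. along j x t" "\<lambda>h. h *\<^sub>R ax j" t UNIV f ?D])
      (use D in \<open>auto intro!: derivative_eq_intros\<close>)
  moreover have "?D (h *\<^sub>R ax j) = partial_deriv j f (along j x t) * h" for h
    using linear_scale[OF has_derivative_linear[OF D], of h "ax j"] partial_deriv_eq[OF D] by simp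
  ultimately show ?thesis by (simp add: has_field_derivative_def)
qed

lemma mvt_increment:
  fixes g :: "real \<Rightarrow> real"
  assumes "\<And>s. (g has_real_derivative g' s) (at s)"
  shows "\<exists>y. \<bar>y\<bar> \<le> \<bar>t\<bar> \<and> g (s + t) - g s = t * g' (s + y)"
proof -
  consider "t = 0" | "t > 0" | "t < 0" by linarith
  then show ?thesis
  proof cases
    case 2
    then obtain z where "s < z" "z < s + t" "g (s + t) - g s = (s + t - s) * g' z"
      using MVT2[of s "s + t" g g'] assms by auto
    then show ?thesis by (intro exI[of _ "z - s"]) auto
  next
    case 3
    then obtain z where "s + t < z" "z < s" "g s - g (s + t) = (s - (s + t)) * g' z"
      using MVT2[of "s + t" s g g'] assms by auto
    then show ?thesis by (intro exI[of _ "z - s"]) auto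
  qed auto
qed

text \<open>Two mean value steps, hence the constant \<open>B\<close> in place of
  \<open>B / 2\<close>.\<close>

lemma real_taylor_bound:
  fixes f :: "real \<Rightarrow> real"
  assumes f: "\<And>s. (f has_real_derivative f' s) (at s)" and f': "\<And>s. (f' has_real_derivative f'' s) (at s)"
    and B: "\<And>y. \<bar>y\<bar> \<le> \<bar>t\<bar> \<Longrightarrow> \<bar>f'' (s + y)\<bar> \<le> B"
  shows "\<bar>f (s + t) - f s - t * f' s\<bar> \<le> B * t\<^sup>2"
proof -
  obtain y where y: "\<bar>y\<bar> \<le> \<bar>t\<bar>" "f (s + t) - f s = t * f' (s + y)" using mvt_increment[OF f] by blast
  obtain y' where y': "\<bar>y'\<bar> \<le> \<bar>y\<bar>" "f' (s + y) - f' s = y * f'' (s + y')" using mvt_increment[OF f'] by blast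
  have "\<bar>f (s + t) - f s - t * f' s\<bar> = \<bar>t\<bar> * (\<bar>y\<bar> * \<bar>f'' (s + y')\<bar>)"
    unfolding y(2) right_diff_distrib[symmetric] y'(2) by (simp add: abs_mult)
  also have "\<dots> \<le> \<bar>t\<bar> * (\<bar>t\<bar> * B)"
    using y(1) y'(1) B[of y'] by (intro mult_left_mono mult_mono) auto
  finally show ?thesis by (simp add: power2_eq_square mult_ac flip: abs_mult)
qed

lemma partial_deriv_taylor:
  assumes "f \<in> Cb_inf" "\<And>x. \<bar>partial_deriv j (partial_deriv j f) x\<bar> \<le> B"
  shows "\<bar>f (along j x t) - f x - t * partial_deriv j f x\<bar> \<le> B * t\<^sup>2"
  using real_taylor_bound[where f = "\<lambda>t. f (along j x t)" and s = 0,
      OF has_partial_derivative[OF assms(1)] has_partial_derivative[OF Cb_infD(3)[OF assms(1)]] assms(2)]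
  by simp

text \<open>A Landau-type inequality, obtained by solving the Taylor formula over a step
  \<open>s\<close> for the derivative. The step stays free: small functions with merely bounded
  second derivatives then have small first derivatives.\<close>

lemma partial_deriv_interpolation:
  assumes f: "f \<in> Cb_inf" and A: "\<And>x. \<bar>f x\<bar> \<le> A"
    and B: "\<And>x. \<bar>partial_deriv j (partial_deriv j f) x\<bar> \<le> B" and s: "s > 0"
  shows "\<bar>partial_deriv j f x\<bar> \<le> 2 * A / s + B * s"
proof -
  have "\<bar>s * partial_deriv j f x\<bar> \<le> 2 * A + B * s\<^sup>2"
    using partial_deriv_taylor[OF f B, of x s] A[of x] A[of "along j x s"] by linarith
  then show ?thesis using s by (simp add: abs_mult field_simps power2_eq_square)
qed

text \<open>The increment is split along the coordinate axes.\<close>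

lemma differentiable_from_partials:
  fixes f :: "real^'d::finite \<Rightarrow> real"
  assumes der: "\<And>x i. ((\<lambda>t. f (along i x t)) has_real_derivative g i x) (at 0)"
    and cont: "\<And>i. continuous_on UNIV (g i)"
  shows "(f has_derivative (\<lambda>h. \<Sum>i\<in>UNIV. h $ i * g i x)) (at x)"
proof -
  have der': "((\<lambda>t. f (along i y t)) has_real_derivative g i (along i y t)) (at t)" for y i t
    using DERIV_shift[of "\<lambda>s. f (along i y s)" "g i (along i y t)" 0 t] der[of "along i y t" i]
    by (simp add: algebra_simps)
  have mvt: "\<exists>s. \<bar>s\<bar> \<le> \<bar>t\<bar> \<and> f (along i y t) - f y = t * g i (along i y s)" for y i t
    using mvt_increment[where g = "\<lambda>t. f (along i y t)" and s = 0, OF der'] by simp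
  have main: "\<exists>d>0. \<forall>h. norm h < d \<longrightarrow>
      \<bar>f (x + (\<Sum>i\<in>I. h $ i *\<^sub>R ax i)) - f x - (\<Sum>i\<in>I. h $ i * g i x)\<bar> \<le> e * (\<Sum>i\<in>I. \<bar>h $ i\<bar>)"
    if e: "e > 0" for e and I :: "'d set"
  proof (induction I rule: infinite_finite_induct)
    case (insert i I)
    then obtain d where d: "d > 0" "\<And>h. norm h < d \<Longrightarrow>
      \<bar>f (x + (\<Sum>i\<in>I. h $ i *\<^sub>R ax i)) - f x - (\<Sum>i\<in>I. h $ i * g i x)\<bar> \<le> e * (\<Sum>i\<in>I. \<bar>h $ i\<bar>)"
      by blast
    obtain d' where d': "d' > 0" "\<And>y. dist y x < d' \<Longrightarrow> \<bar>g i y - g i x\<bar> < e"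
      using cont[of i] e unfolding continuous_on_iff dist_real_def by (metis UNIV_I)
    define n where "n = real CARD('d)"
    have n: "n > 0" by (simp add: n_def)
    show ?case
    \<comment> \<open>The intermediate point of the mean value step is within (n + 1) norm h of
      \<open>x\<close>: at most n norm h for the axes in \<open>I\<close>, and at most norm h along
      the axis \<open>i\<close>.\<close>
    proof (intro exI[of _ "min d (d' / (n + 1))"] conjI allI impI)
      show "min d (d' / (n + 1)) > 0" using d d' n by simp
      fix h :: "real^'d" assume h: "norm h < min d (d' / (n + 1))"
      define y where "y = x + (\<Sum>i\<in>I. h $ i *\<^sub>R ax i)"
      obtain s where s: "\<bar>s\<bar> \<le> \<bar>h $ i\<bar>" "f (y + h $ i *\<^sub>R ax i) - f y = h $ i * g i (along i y s)"
        using mvt by blast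
      have "norm (y - x) \<le> (\<Sum>i\<in>I. norm h)"
        unfolding y_def add_diff_cancel_left' by (rule sum_norm_le) (simp add: component_le_norm_cart)
      also have "\<dots> \<le> n * norm h"
        by (simp add: n_def card_mono mult_right_mono)
      finally have "norm (along i y s - x) \<le> n * norm h + \<bar>s\<bar>"
        using norm_triangle_ineq[of "y - x" "s *\<^sub>R ax i"] by (simp add: algebra_simps)
      also have "\<dots> \<le> (n + 1) * norm h"
        using s(1) component_le_norm_cart[of h i] by (simp add: algebra_simps)
      also have "\<dots> < d'" using h n by (simp add: field_simps)
      finally have "\<bar>g i (along i y s) - g i x\<bar> \<le> e"
        using d'(2)[of "along i y s"] by (simp add: dist_norm)
      then have "\<bar>h $ i\<bar> * \<bar>g i (along i y s) - g i x\<bar> \<le> \<bar>h $ i\<bar> * e" by (intro mult_left_mono) auto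
      then have 1: "\<bar>f (y + h $ i *\<^sub>R ax i) - f y - h $ i * g i x\<bar> \<le> e * \<bar>h $ i\<bar>"
        unfolding s(2) right_diff_distrib[symmetric] abs_mult by (simp add: mult.commute)
      have 2: "\<bar>f y - f x - (\<Sum>i\<in>I. h $ i * g i x)\<bar> \<le> e * (\<Sum>i\<in>I. \<bar>h $ i\<bar>)"
        unfolding y_def using d(2) h by simp
      have 3: "x + (\<Sum>i\<in>insert i I. h $ i *\<^sub>R ax i) = y + h $ i *\<^sub>R ax i"
        using insert by (simp add: y_def)
      show "\<bar>f (x + (\<Sum>i\<in>insert i I. h $ i *\<^sub>R ax i)) - f x - (\<Sum>i\<in>insert i I. h $ i * g i x)\<bar>
          \<le> e * (\<Sum>i\<in>insert i I. \<bar>h $ i\<bar>)"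
        unfolding 3 using 1 2 insert by (simp add: distrib_left)
    qed
  qed (use e in \<open>auto intro!: exI[of _ 1]\<close>)
  show ?thesis
    unfolding has_derivative_at_alt
  proof (intro conjI allI impI)
    show "bounded_linear (\<lambda>h. \<Sum>i\<in>UNIV. h $ i * g i x)"
      by (intro bounded_linear_sum bounded_linear_mult_const bounded_linear_vec_nth)
    fix e :: real assume e: "e > 0"
    define n where "n = real CARD('d)"
    have n: "n > 0" by (simp add: n_def)
    obtain d where d: "d > 0" "\<And>h. norm h < d \<Longrightarrow>
      \<bar>f (x + (\<Sum>i\<in>UNIV. h $ i *\<^sub>R ax i)) - f x - (\<Sum>i\<in>UNIV. h $ i * g i x)\<bar> \<le> e / n * (\<Sum>i\<in>UNIV. \<bar>h $ i\<bar>)"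
      using main[of "e / n" UNIV] e n by auto
    have "norm (f y - f x - (\<Sum>i\<in>UNIV. (y - x) $ i * g i x)) \<le> e * norm (y - x)" if y: "norm (y - x) < d" for y
    proof -
      have "(\<Sum>i\<in>UNIV. (y - x) $ i *\<^sub>R ax i) = y - x"
        using basis_expansion[of "y - x"] by (simp add: scalar_mult_eq_scaleR)
      then have 1: "norm (f y - f x - (\<Sum>i\<in>UNIV. (y - x) $ i * g i x)) \<le> e / n * (\<Sum>i\<in>UNIV. \<bar>(y - x) $ i\<bar>)"
        using d(2)[OF y] by simp
      have "(\<Sum>i\<in>UNIV. \<bar>(y - x) $ i\<bar>) \<le> (\<Sum>i\<in>(UNIV :: 'd set). norm (y - x))"
        by (intro sum_mono component_le_norm_cart)
      then have "e / n * (\<Sum>i\<in>UNIV. \<bar>(y - x) $ i\<bar>) \<le> e / n * (n * norm (y - x))"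
        using e n by (intro mult_left_mono) (auto simp: n_def)
      with 1 show ?thesis using n by simp
    qed
    then show "\<exists>d>0. \<forall>y. norm (y - x) < d \<longrightarrow>
        norm (f y - f x - (\<Sum>i\<in>UNIV. (y - x) $ i * g i x)) \<le> e * norm (y - x)"
      using d(1) by blast
  qed
qed

lemma quadratic_remainder_derivative:
  fixes f :: "real \<Rightarrow> real"
  assumes "\<And>t. \<bar>t\<bar> \<le> 1 \<Longrightarrow> \<bar>f t - f 0 - t * D\<bar> \<le> B * t\<^sup>2"
  shows "(f has_real_derivative D) (at 0)"
  unfolding DERIV_def
proof (rule LIM_zero_cancel, rule Lim_null_comparison)
  have "norm ((f (0 + h) - f 0) / h - D) \<le> B * \<bar>h\<bar>" if "h \<noteq> 0" "\<bar>h\<bar> \<le> 1" for h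
  proof -
    have "(f (0 + h) - f 0) / h - D = (f h - f 0 - h * D) / h" using that by (simp add: field_simps)
    then have "norm ((f (0 + h) - f 0) / h - D) = \<bar>f h - f 0 - h * D\<bar> / \<bar>h\<bar>" by simp
    also have "\<dots> \<le> B * h\<^sup>2 / \<bar>h\<bar>" using assms that by (intro divide_right_mono) auto
    also have "\<dots> = B * \<bar>h\<bar>"
      using that by (simp add: power2_eq_square abs_if)
    finally show ?thesis .
  qed
  then show "\<forall>\<^sub>F h in at 0. norm ((f (0 + h) - f 0) / h - D) \<le> B * \<bar>h\<bar>"
    unfolding eventually_at by (intro exI[of _ 1]) auto
  show "((\<lambda>h. B * \<bar>h\<bar>) \<longlongrightarrow> 0) (at 0)" by (rule tendsto_eq_intros refl | simp)+
qed

lemma partial_deriv_eqI: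
  assumes "\<And>x t. \<bar>t\<bar> \<le> 1 \<Longrightarrow> \<bar>f (along j x t) - f x - t * g x\<bar> \<le> B * t\<^sup>2"
  shows "partial_deriv j f = g"
proof
  fix x
  have "((\<lambda>t. f (along j x t)) has_real_derivative g x) (at 0)"
    by (rule quadratic_remainder_derivative[where B = B]) (use assms in simp)
  then show "partial_deriv j f x = g x"
    unfolding partial_deriv_def by (rule DERIV_imp_deriv)
qed

text \<open>A coinductive criterion: the functions \<open>g\<close>, which turn out to be the
  partial derivatives, have to stay in \<open>S\<close>. Continuity of all members of
  \<open>S\<close> upgrades partial to total differentiability.\<close>

lemma Cb_inf_criterion:
  assumes "f \<in> S"
    and bdd: "\<And>f. f \<in> S \<Longrightarrow> bounded (range f)"
    and cont: "\<And>f. f \<in> S \<Longrightarrow> continuous_on UNIV f"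
    and quad: "\<And>f j. f \<in> S \<Longrightarrow>
      \<exists>g\<in>S. quad_taylor j f g"
  shows "f \<in> Cb_inf"
proof (rule Cb_inf_coinduct[of f S])
  fix f x assume f: "f \<in> S"
  then obtain g B where g: "\<And>j. g j \<in> S"
    and B: "\<And>j x t. \<bar>t\<bar> \<le> 1 \<Longrightarrow> \<bar>f (along j x t) - f x - t * g j x\<bar> \<le> B j * t\<^sup>2"
    using quad by metis
  have "((\<lambda>t. f (along j x t)) has_real_derivative g j x) (at 0)" for x j
    by (rule quadratic_remainder_derivative[where B = "B j"]) (use B in simp)
  from differentiable_from_partials[OF this cont[OF g]]
  show "f differentiable (at x)" by (auto simp: differentiable_def)
next
  fix f j assume "f \<in> S"
  then obtain g B where "g \<in> S"
    "\<And>x t. \<bar>t\<bar> \<le> 1 \<Longrightarrow> \<bar>f (along j x t) - f x - t * g x\<bar> \<le> B * t\<^sup>2"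
    using quad[of f j] by blast
  then show "partial_deriv j f \<in> S" using partial_deriv_eqI[of f j g B] by simp
qed (use assms in auto)

text \<open>By interpolation, uniform bounds on all derivatives turn uniform convergence into uniform
  convergence of all derivatives.\<close>

lemma Cb_inf_uniform_limit:
  fixes u :: "nat \<Rightarrow> real^'d::finite \<Rightarrow> real"
  assumes u: "\<And>n. u n \<in> Cb_inf"
    and bnd: "\<And>js. \<exists>B. \<forall>\<^sub>F n in sequentially. \<forall>x. \<bar>pds js (u n) x\<bar> \<le> B"
    and cauchy: "uniformly_Cauchy_on UNIV u"
  shows "\<exists>w\<in>Cb_inf. \<forall>js. uniform_limit UNIV (\<lambda>n. pds js (u n)) (pds js w) sequentially"
proof -
  have "uniformly_Cauchy_on UNIV (\<lambda>n. pds js (u n))" for js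
  proof (induction js rule: rev_induct)
    case Nil
    then show ?case using cauchy by simp
  next
    case (snoc j js)
    obtain B0 where B0: "\<forall>\<^sub>F n in sequentially. \<forall>x. \<bar>pds (js @ [j, j]) (u n) x\<bar> \<le> B0"
      using bnd by blast
    define B where "B = \<bar>B0\<bar> + 1"
    obtain N where N: "\<And>n x. n \<ge> N \<Longrightarrow> \<bar>partial_deriv j (partial_deriv j (pds js (u n))) x\<bar> \<le> B0"
      using B0 unfolding eventually_sequentially by auto
    have B: "B > 0" by (simp add: B_def)
    have BN: "\<bar>partial_deriv j (partial_deriv j (pds js (u n))) x\<bar> \<le> B" if "n \<ge> N" for n x
      using N[OF that, of x] by (simp add: B_def)
    show ?case
      unfolding uniformly_Cauchy_on_def
    proof (intro allI impI)
      fix e :: real assume e: "e > 0"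
      \<comment> \<open>With this step, the bound e s / 8 for the differences and the bound 2 B for
        their second derivatives contribute e / 4 each in the interpolation inequality.\<close>
      define s where "s = e / (8 * B)"
      have s: "s > 0" "2 * B * s = e / 4" using e B by (auto simp: s_def)
      obtain M where M: "\<And>m n x. m \<ge> M \<Longrightarrow> n \<ge> M \<Longrightarrow> dist (pds js (u m) x) (pds js (u n) x) < e * s / 8"
        using snoc[unfolded uniformly_Cauchy_on_def, rule_format, of "e * s / 8"] e s by auto
      have "dist (pds (js @ [j]) (u m) x) (pds (js @ [j]) (u n) x) < e"
        if mn: "m \<ge> max M N" "n \<ge> max M N" for m n x
      proof -
        define f where "f x = pds js (u m) x - pds js (u n) x" for x
        have C: "pds js (u m) \<in> Cb_inf" "pds js (u n) \<in> Cb_inf" using u by (auto intro: pds_Cb_inf)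
        have "\<bar>partial_deriv j f x\<bar> \<le> 2 * (e * s / 8) / s + (2 * B) * s"
        proof (rule partial_deriv_interpolation[OF _ _ _ s(1)])
          show "f \<in> Cb_inf" unfolding f_def by (intro Cb_inf_diff C)
          show "\<bar>f x\<bar> \<le> e * s / 8" for x
            using M[of m n x] mn by (simp add: f_def dist_real_def)
          have "partial_deriv j (partial_deriv j f) x =
              partial_deriv j (partial_deriv j (pds js (u m))) x - partial_deriv j (partial_deriv j (pds js (u n))) x" for x
            unfolding f_def by (simp add: partial_deriv_Cb_diff C Cb_infD(3))
          then show "\<bar>partial_deriv j (partial_deriv j f) x\<bar> \<le> 2 * B" for x
            using BN[of m x] BN[of n x] mn by simp
        qed
        also have "\<dots> < e" using s e by simp
        finally show ?thesis
          unfolding f_def by (simp add: partial_deriv_Cb_diff C dist_real_def)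
      qed
      then show "\<exists>M. \<forall>x\<in>UNIV. \<forall>m\<ge>M. \<forall>n\<ge>M. dist (pds (js @ [j]) (u m) x) (pds (js @ [j]) (u n) x) < e"
        by blast
    qed
  qed
  then have "\<forall>js. \<exists>l. uniform_limit UNIV (\<lambda>n. pds js (u n)) l sequentially"
    using Cauchy_uniformly_convergent unfolding uniformly_convergent_on_def by blast
  then obtain l where l: "\<And>js. uniform_limit UNIV (\<lambda>n. pds js (u n)) (l js) sequentially"
    by metis
  have ptw: "(\<lambda>n. pds js (u n) x) \<longlonglongrightarrow> l js x" for js x
    using tendsto_uniform_limitI[OF l] by simp
  \<comment> \<open>The Taylor inequality passes to the limits and identifies
    \<open>l (js @ [j])\<close> as a derivative before anything is known about the smoothness of
    \<open>l js\<close>.\<close>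
  have quad: "quad_taylor j (l js) (l (js @ [j]))" for js j
  proof -
    obtain B where B: "\<forall>\<^sub>F n in sequentially. \<forall>x. \<bar>pds (js @ [j, j]) (u n) x\<bar> \<le> B"
      using bnd by blast
    have "\<bar>l js (along j x t) - l js x - t * l (js @ [j]) x\<bar> \<le> B * t\<^sup>2" for x t
    proof (rule tendsto_upperbound)
      show "(\<lambda>n. \<bar>pds js (u n) (along j x t) - pds js (u n) x - t * pds (js @ [j]) (u n) x\<bar>)
          \<longlonglongrightarrow> \<bar>l js (along j x t) - l js x - t * l (js @ [j]) x\<bar>"
        by (intro tendsto_intros ptw)
      show "\<forall>\<^sub>F n in sequentially.
          \<bar>pds js (u n) (along j x t) - pds js (u n) x - t * pds (js @ [j]) (u n) x\<bar> \<le> B * t\<^sup>2"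
        using B by eventually_elim
          (use partial_deriv_taylor[OF pds_Cb_inf[OF u]] in simp)
    qed simp
    then show ?thesis by blast
  qed
  have "l js \<in> Cb_inf" for js
  proof (rule Cb_inf_criterion[of _ "range l"])
    fix f assume "f \<in> range l"
    then obtain js where f: "f = l js" by blast
    show "continuous_on UNIV f"
      unfolding f by (rule uniform_limit_theorem[OF _ l]) (auto intro!: always_eventually Cb_inf_continuous pds_Cb_inf u)
    obtain B where B: "\<forall>\<^sub>F n in sequentially. \<forall>x. \<bar>pds js (u n) x\<bar> \<le> B"
      using bnd by blast
    have "\<bar>l js x\<bar> \<le> B" for x
      by (rule tendsto_upperbound[OF tendsto_rabs[OF ptw]])
        (use B in \<open>auto elim: eventually_mono\<close>)
    then show "bounded (range f)" unfolding f by (auto simp: bounded_iff)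
    show "\<exists>g\<in>range l. quad_taylor j f g" for j
      unfolding f using quad[of js j] by blast
  qed simp
  moreover have "pds js (l []) = l js" for js
  proof (induction js rule: rev_induct)
    case (snoc j js)
    obtain B where "\<And>x t. \<bar>t\<bar> \<le> 1 \<Longrightarrow> \<bar>l js (along j x t) - l js x - t * l (js @ [j]) x\<bar> \<le> B * t\<^sup>2"
      using quad by blast
    then have "partial_deriv j (l js) = l (js @ [j])" by (rule partial_deriv_eqI)
    then show ?case using snoc by simp
  qed simp
  ultimately show ?thesis using l by (intro bexI[of _ "l []"]) auto
qed

subsection \<open>Exponential averages\<close>

definition expd :: "real measure" where "expd = density lborel (exponential_density 1)"

interpretation expd: prob_space expd
  unfolding expd_def by (rule prob_space_exponential_density) simp

lemma sets_expd [measurable_cong, simp]: "sets expd = sets borel"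
  by (simp add: expd_def)

lemma integrable_expd:
  fixes g :: "real \<Rightarrow> real"
  assumes "continuous_on UNIV g" "\<And>y. \<bar>g y\<bar> \<le> B"
  shows "integrable expd g"
proof (rule expd.integrable_const_bound)
  show "AE y in expd. norm (g y) \<le> B" using assms(2) by simp
  have "g \<in> borel_measurable borel" by (rule borel_measurable_continuous_onI[OF assms(1)])
  then show "g \<in> borel_measurable expd" by simp
qed

text \<open>A bridge from the probability measure to an improper interval integral, the form in
  which the fundamental theorem of calculus is applied. The two integrands differ at most at the
  endpoint 0.\<close>

lemma expd_eq_interval_integral:
  fixes g :: "real \<Rightarrow> real"
  assumes g: "continuous_on UNIV g"
  shows "(\<integral>y. g y \<partial>expd) = (LBINT y=0..\<infinity>. exp (- y) * g y)"
    and "(\<And>y. \<bar>g y\<bar> \<le> B) \<Longrightarrow> set_integrable lborel (einterval 0 \<infinity>) (\<lambda>y. exp (- y) * g y)"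
proof -
  have m [measurable]: "g \<in> borel_measurable borel" by (rule borel_measurable_continuous_onI[OF g])
  have m' [measurable]: "exponential_density 1 \<in> borel_measurable borel" by measurable
  have e: "einterval 0 \<infinity> = {0::real<..}" by (auto simp: einterval_def zero_ereal_def)
  have ae: "AE y in lborel. exponential_density 1 y *\<^sub>R g y = indicator {0<..} y *\<^sub>R (exp (- y) * g y)"
    using AE_lborel_singleton[of 0]
    by eventually_elim (auto simp: exponential_density_def indicator_def)
  have "(\<integral>y. g y \<partial>expd) = (\<integral>y. exponential_density 1 y *\<^sub>R g y \<partial>lborel)"
    unfolding expd_def by (rule integral_density) (auto simp: exponential_density_nonneg)
  also have "\<dots> = (\<integral>y. indicator {0<..} y *\<^sub>R (exp (- y) * g y) \<partial>lborel)"
    by (rule integral_cong_AE[OF _ _ ae]) measurable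
  finally show "(\<integral>y. g y \<partial>expd) = (LBINT y=0..\<infinity>. exp (- y) * g y)"
    by (simp add: interval_lebesgue_integral_def set_lebesgue_integral_def e)
  assume "\<And>y. \<bar>g y\<bar> \<le> B"
  with g have "integrable expd g" by (rule integrable_expd)
  then have "integrable lborel (\<lambda>y. exponential_density 1 y *\<^sub>R g y)"
    unfolding expd_def by (subst (asm) integrable_density) (auto simp: exponential_density_nonneg)
  then show "set_integrable lborel (einterval 0 \<infinity>) (\<lambda>y. exp (- y) * g y)"
    unfolding set_integrable_def e by (subst (asm) integrable_cong_AE[OF _ _ ae]) measurable
qed

text \<open>An antiderivative of exp (- y) (g y - g' y) is - exp (- y) g y; it tends to 0 at
  infinity because \<open>g\<close> is bounded, and the endpoint 0 contributes g 0.\<close>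

lemma expd_integral_by_parts:
  fixes g :: "real \<Rightarrow> real"
  assumes der: "\<And>y. (g has_real_derivative g' y) (at y)" and cont: "continuous_on UNIV g'"
    and B: "\<And>y. \<bar>g y\<bar> \<le> B" and B': "\<And>y. \<bar>g' y\<bar> \<le> B'"
  shows "(\<integral>y. g' y \<partial>expd) = (\<integral>y. g y \<partial>expd) - g 0"
proof -
  have contg: "continuous_on UNIV g"
    by (rule DERIV_continuous_on[of _ _ g']) (use der has_field_derivative_at_within in blast)
  define F where "F y = - (exp (- y) * g y)" for y
  have diff: "(\<integral>y. g y - g' y \<partial>expd) = (\<integral>y. g y \<partial>expd) - (\<integral>y. g' y \<partial>expd)"
    by (intro Bochner_Integration.integral_diff integrable_expd[OF contg B] integrable_expd[OF cont B'])
  have cd: "continuous_on UNIV (\<lambda>y. g y - g' y)"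
    by (intro continuous_intros contg cont)
  have "(LBINT y=0..\<infinity>. exp (- y) * (g y - g' y)) = 0 - (- g 0)"
  proof (rule interval_integral_FTC_integrable[where F = F])
    show "(F has_vector_derivative exp (- y) * (g y - g' y)) (at y)" for y
      unfolding F_def has_real_derivative_iff_has_vector_derivative[symmetric]
      by (auto intro!: derivative_eq_intros der simp: algebra_simps)
    have "isCont g y" "isCont g' y" for y
      using contg cont by (simp_all add: continuous_on_eq_continuous_at)
    then show "isCont (\<lambda>y. exp (- y) * (g y - g' y)) y" for y
      by (intro continuous_intros) auto
    show "set_integrable lborel (einterval 0 \<infinity>) (\<lambda>y. exp (- y) * (g y - g' y))"
      by (rule expd_eq_interval_integral(2)[OF cd, of "B + B'"])
        (rule order_trans[OF abs_triangle_ineq4 add_mono[OF B B']])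
    have "isCont F 0"
      unfolding F_def using \<open>\<And>y. isCont g y\<close> by (intro continuous_intros) auto
    then have "(F \<longlongrightarrow> - g 0) (at_right 0)"
      unfolding isCont_def F_def by (auto intro: tendsto_within_subset)
    then show "((F \<circ> real_of_ereal) \<longlongrightarrow> - g 0) (at_right 0)"
      by (simp add: zero_ereal_def ereal_tendsto_simps)
    have "(F \<longlongrightarrow> 0) at_top"
    proof (rule Lim_null_comparison)
      show "\<forall>\<^sub>F y in at_top. norm (F y) \<le> exp (- y) * B"
        unfolding F_def using B by (auto simp: abs_mult intro!: always_eventually mult_left_mono)
      show "((\<lambda>y. exp (- y) * B) \<longlongrightarrow> 0) at_top"
        by (rule tendsto_mult_left_zero) (rule filterlim_compose[OF exp_at_bot filterlim_uminus_at_bot_at_top])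
    qed
    then show "((F \<circ> real_of_ereal) \<longlongrightarrow> 0) (at_left \<infinity>)"
      by (simp add: ereal_tendsto_simps)
  qed simp
  then have "(\<integral>y. g y - g' y \<partial>expd) = g 0"
    using expd_eq_interval_integral(1)[OF cd] by simp
  with diff show ?thesis by simp
qed

text \<open>The resolvent of the generator of translations: \<open>expavg s j = (1 - s \<partial>\<^sub>j)\<inverse>\<close>.\<close>

definition expavg :: "real \<Rightarrow> 'd::finite \<Rightarrow> (real^'d \<Rightarrow> real) \<Rightarrow> real^'d \<Rightarrow> real" where
  "expavg s j f x = (\<integral>y. f (along j x (s * y)) \<partial>expd)"

lemma expavg_integrable:
  assumes f: "f \<in> Cb_inf"
  shows "integrable expd (\<lambda>y. f (along j x (s * y)))"
proof -
  obtain B where "\<And>x. \<bar>f x\<bar> \<le> B" using Cb_inf_bound[OF f] by blast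
  then show ?thesis
    by (intro integrable_expd[of _ B])
      (auto intro!: continuous_on_compose2[OF Cb_inf_continuous[OF f]] continuous_intros)
qed

lemma expavg_cmult: "expavg s j (\<lambda>x. r * f x) x = r * expavg s j f x"
  unfolding expavg_def by simp

lemma expavg_diff: "f \<in> Cb_inf \<Longrightarrow> g \<in> Cb_inf \<Longrightarrow> expavg s j (\<lambda>x. f x - g x) x = expavg s j f x - expavg s j g x"
  unfolding expavg_def by (intro Bochner_Integration.integral_diff expavg_integrable)

lemma expavg_const: "expavg s j (\<lambda>x. r) x = r"
  unfolding expavg_def using expd.prob_space by simp

lemma expavg_mono:
  assumes "f \<in> Cb_inf" "g \<in> Cb_inf" "\<And>x. f x \<le> g x"
  shows "expavg s j f x \<le> expavg s j g x"
  unfolding expavg_def by (intro integral_mono expavg_integrable assms)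

lemma expavg_le:
  assumes "f \<in> Cb_inf" "\<And>x. f x \<le> B"
  shows "expavg s j f x \<le> B"
  using expavg_mono[OF assms(1) Cb_inf_const, of B s j x] assms(2) by (simp add: expavg_const)

lemma expavg_abs_le:
  assumes "f \<in> Cb_inf" "\<And>x. \<bar>f x\<bar> \<le> B"
  shows "\<bar>expavg s j f x\<bar> \<le> B"
proof -
  have "f x \<le> B" "- 1 * f x \<le> B" for x using assms(2)[of x] by auto
  then have "expavg s j f x \<le> B" "- 1 * expavg s j f x \<le> B"
    using expavg_le[OF assms(1)] expavg_le[OF Cb_inf_cmult[OF assms(1), of "-1"]]
    unfolding expavg_cmult by blast+
  then show ?thesis by simp
qed

text \<open>Nonnegativity of the variance: average (f - m)^2 \<ge> 0 with \<open>m\<close> the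
  mean.\<close>

lemma expavg_jensen:
  assumes f: "f \<in> Cb_inf"
  shows "(expavg s j f x)\<^sup>2 \<le> expavg s j (\<lambda>x. (f x)\<^sup>2) x"
proof -
  define m where "m = expavg s j f x"
  have f2: "(\<lambda>x. (f x)\<^sup>2) \<in> Cb_inf" using Cb_inf_mult[OF f f] by (simp add: power2_eq_square)
  have c: "(\<lambda>x. (f x)\<^sup>2 - 2 * m * f x) \<in> Cb_inf"
    by (intro Cb_inf_diff f2 Cb_inf_cmult f)
  have "- m\<^sup>2 \<le> (f x)\<^sup>2 - 2 * m * f x" for x
    using zero_le_power2[of "f x - m"] by (simp add: power2_eq_square algebra_simps)
  then have "expavg s j (\<lambda>x. - m\<^sup>2) x \<le> expavg s j (\<lambda>x. (f x)\<^sup>2 - 2 * m * f x) x"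
    by (intro expavg_mono c Cb_inf_const)
  also have "\<dots> = expavg s j (\<lambda>x. (f x)\<^sup>2) x - 2 * m * m"
    unfolding m_def expavg_cmult[symmetric] by (intro expavg_diff f2 Cb_inf_cmult f)
  finally show ?thesis by (simp add: expavg_const m_def power2_eq_square)
qed

text \<open>Integration by parts along the line through \<open>x\<close>. The sign of
  \<open>s\<close> is arbitrary, so one identity serves the averages in both directions
  \<open>r\<close> and \<open>- r\<close>.\<close>

lemma expavg_resolvent:
  assumes f: "f \<in> Cb_inf"
  shows "s * expavg s j (partial_deriv j f) x = expavg s j f x - f x"
proof -
  obtain B where B: "\<And>x. \<bar>f x\<bar> \<le> B" using Cb_inf_bound[OF f] by blast
  have f': "partial_deriv j f \<in> Cb_inf" by (rule Cb_infD[OF f])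
  obtain B' where B': "\<And>x. \<bar>partial_deriv j f x\<bar> \<le> B'" using Cb_inf_bound[OF f'] by blast
  have "(\<integral>y. s * partial_deriv j f (along j x (s * y)) \<partial>expd) =
      (\<integral>y. f (along j x (s * y)) \<partial>expd) - f (along j x (s * 0))"
  proof (rule expd_integral_by_parts)
    show "((\<lambda>y. f (along j x (s * y))) has_real_derivative s * partial_deriv j f (along j x (s * y))) (at y)" for y
      using DERIV_chain2[where g = "(*) s" and f = "\<lambda>t. f (along j x t)" and x = y and s = UNIV
          and Db = s, OF has_partial_derivative[OF f, of x j "s * y"]]
      by (auto intro!: derivative_eq_intros simp: mult.commute)
    show "continuous_on UNIV (\<lambda>y. s * partial_deriv j f (along j x (s * y)))"
      by (auto intro!: continuous_on_compose2[OF Cb_inf_continuous[OF f']] continuous_intros)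
    show "\<bar>s * partial_deriv j f (along j x (s * y))\<bar> \<le> \<bar>s\<bar> * B'" for y
      by (simp add: abs_mult mult_left_mono B')
  qed (rule B)
  then show ?thesis by (simp add: expavg_def)
qed

text \<open>Averaging against a probability measure preserves sup bounds, moduli of continuity and
  uniform Taylor remainders, which is all that \<open>Cb_inf_criterion\<close> asks for.\<close>

lemma expavg_Cb_inf:
  assumes "f \<in> Cb_inf"
  shows "expavg s j f \<in> Cb_inf" "partial_deriv i (expavg s j f) = expavg s j (partial_deriv i f)"
proof -
  have quad: "\<exists>B. \<forall>x t. \<bar>expavg s j f (along i x t) - expavg s j f x - t * expavg s j (partial_deriv i f) x\<bar> \<le> B * t\<^sup>2"
    if f: "f \<in> Cb_inf" for f i
  proof -
    obtain B where B: "\<And>x. \<bar>partial_deriv i (partial_deriv i f) x\<bar> \<le> B"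
      using Cb_inf_bound[OF Cb_infD(3)[OF Cb_infD(3)[OF f]]] by blast
    have "\<bar>expavg s j f (along i x t) - expavg s j f x - t * expavg s j (partial_deriv i f) x\<bar> \<le> B * t\<^sup>2" for x t
    proof -
      let ?g = "\<lambda>y. f (along i x t + (s * y) *\<^sub>R ax j) - f (along j x (s * y))
          - t * partial_deriv i f (along j x (s * y))"
      note int = expavg_integrable[OF f] expavg_integrable[OF Cb_infD(3)[OF f]]
      have "\<bar>?g y\<bar> \<le> B * t\<^sup>2" for y
        using partial_deriv_taylor[OF f B, of "along j x (s * y)" t] by (simp add: algebra_simps)
      then have "norm (\<integral>y. ?g y \<partial>expd) \<le> (\<integral>y. B * t\<^sup>2 \<partial>expd)"
        by (intro Bochner_Integration.integral_norm_bound_integral) (auto intro!: int)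
      also have "(\<integral>y. B * t\<^sup>2 \<partial>expd) = B * t\<^sup>2" using expd.prob_space by simp
      finally show ?thesis unfolding expavg_def by (simp add: int)
    qed
    then show ?thesis by blast
  qed
  show "expavg s j f \<in> Cb_inf"
  proof (rule Cb_inf_criterion[of _ "expavg s j ` Cb_inf"])
    fix h assume "h \<in> expavg s j ` Cb_inf"
    then obtain f where f: "f \<in> Cb_inf" and h: "h = expavg s j f" by blast
    obtain B where B: "\<And>x. \<bar>f x\<bar> \<le> B" using Cb_inf_bound[OF f] by blast
    show "bounded (range h)"
      using expavg_abs_le[OF f B] unfolding h by (auto simp: bounded_iff)
    show "continuous_on UNIV h"
      unfolding continuous_on_iff
    proof (intro ballI allI impI)
      fix x and e :: real assume e: "e > 0"
      obtain d where d: "d > 0" "\<And>x y. dist y x < d \<Longrightarrow> dist (f y) (f x) < e / 2"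
        using Cb_inf_uniformly_continuous[OF f] e unfolding uniformly_continuous_on_def
        by (metis UNIV_I half_gt_zero)
      have "dist (h x') (h x) < e" if "dist x' x < d" for x'
      proof -
        have "norm (\<integral>y. f (along j x' (s * y)) - f (along j x (s * y)) \<partial>expd) \<le> (\<integral>y. e / 2 \<partial>expd)"
          using d(2)[of "x' + _" "x + _"] that
          by (intro Bochner_Integration.integral_norm_bound_integral)
            (auto intro!: expavg_integrable[OF f] less_imp_le simp: dist_norm)
        then show ?thesis
          using e expavg_integrable[OF f] expd.prob_space
          unfolding h expavg_def dist_norm by simp
      qed
      then show "\<exists>d>0. \<forall>x'\<in>UNIV. dist x' x < d \<longrightarrow> dist (h x') (h x) < e" using d(1) by blast
    qed
    show "\<exists>g\<in>expavg s j ` Cb_inf. quad_taylor i h g" for i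
      unfolding h using quad[OF f, of i] Cb_infD(3)[OF f] by blast
  qed (use assms in simp)
  show "partial_deriv i (expavg s j f) = expavg s j (partial_deriv i f)"
    using quad[OF assms, of i] by (auto intro: partial_deriv_eqI)
qed

lemma expavg_near:
  assumes "f \<in> Cb_inf" "\<And>x. \<bar>partial_deriv j f x\<bar> \<le> B"
  shows "\<bar>expavg s j f x - f x\<bar> \<le> \<bar>s\<bar> * B"
  using mult_left_mono[OF expavg_abs_le[OF Cb_infD(3)[OF assms(1)] assms(2)], of "\<bar>s\<bar>" s j x]
  by (simp add: expavg_resolvent[OF assms(1), symmetric] abs_mult)

subsection \<open>The approximating operators\<close>

definition D1 :: "real \<Rightarrow> 'd::finite \<Rightarrow> (real^'d \<Rightarrow> real) \<Rightarrow> real^'d \<Rightarrow> real" where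
  "D1 r j f x = (expavg r j f x - expavg (- r) j f x) / (2 * r)"

definition D2 :: "real \<Rightarrow> 'd::finite \<Rightarrow> (real^'d \<Rightarrow> real) \<Rightarrow> real^'d \<Rightarrow> real" where
  "D2 r j f x = (expavg r j f x + expavg (- r) j f x - 2 * f x) / (2 * r\<^sup>2)"

text \<open>The carre du champ of \<open>D2\<close> averages squared jumps; here the averaged jumps
  are squared instead. By Jensen's inequality this is a lower bound for it, and it still dominates
  the squares of the first order quotients.\<close>

definition Dsq :: "real \<Rightarrow> 'd::finite \<Rightarrow> (real^'d \<Rightarrow> real) \<Rightarrow> real^'d \<Rightarrow> real" where
  "Dsq r j f x = ((expavg r j f x - f x)\<^sup>2 + (expavg (- r) j f x - f x)\<^sup>2) / (2 * r\<^sup>2)"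

lemma Dsq_nonneg: "Dsq r j f x \<ge> 0"
  unfolding Dsq_def by simp

lemma D1_eq:
  assumes "f \<in> Cb_inf" "r \<noteq> 0"
  shows "D1 r j f x = (expavg r j (partial_deriv j f) x + expavg (- r) j (partial_deriv j f) x) / 2"
  using expavg_resolvent[OF assms(1), of r j x] expavg_resolvent[OF assms(1), of "- r" j x] assms(2)
  by (simp add: D1_def field_simps)

lemma D2_eq:
  assumes "f \<in> Cb_inf" "r \<noteq> 0"
  shows "D2 r j f x = D1 r j (partial_deriv j f) x"
proof -
  have "expavg r j f x + expavg (- r) j f x - 2 * f x =
      r * (expavg r j (partial_deriv j f) x - expavg (- r) j (partial_deriv j f) x)"
    using expavg_resolvent[OF assms(1), of r j x] expavg_resolvent[OF assms(1), of "- r" j x]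
    by (simp add: algebra_simps)
  then show ?thesis
    using assms(2) by (simp add: D1_def D2_def power2_eq_square)
qed

lemma D1_sq:
  assumes "r \<noteq> 0"
  shows "(D1 r j f x)\<^sup>2 \<le> Dsq r j f x"
proof -
  define p q where "p = expavg r j f x - f x" and "q = expavg (- r) j f x - f x"
  have "(p - q)\<^sup>2 \<le> 2 * (p\<^sup>2 + q\<^sup>2)"
    using zero_le_power2[of "p + q"] by (simp add: power2_eq_square algebra_simps)
  then have "(p - q)\<^sup>2 / (4 * r\<^sup>2) \<le> 2 * (p\<^sup>2 + q\<^sup>2) / (4 * r\<^sup>2)"
    by (intro divide_right_mono) auto
  also have "\<dots> = Dsq r j f x"
    using assms by (simp add: Dsq_def p_def q_def field_simps)
  also have "(p - q)\<^sup>2 / (4 * r\<^sup>2) = (D1 r j f x)\<^sup>2"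
    by (simp add: D1_def p_def q_def power_divide power_mult_distrib)
  finally show ?thesis .
qed

lemma D2_sq: "f \<in> Cb_inf \<Longrightarrow> r \<noteq> 0 \<Longrightarrow> (D2 r j f x)\<^sup>2 \<le> Dsq r j (partial_deriv j f) x"
  by (simp add: D2_eq D1_sq)

text \<open>The mean jumps of \<open>f\<close> are r p and - r q, where p and q are averages of its
  derivative v, so \<open>Dsq\<close> of \<open>f\<close> is the mean of p^2 and q^2. Passing from
  the averages back to v costs (p - v)^2 and (q - v)^2, whose mean is r^2 times \<open>Dsq\<close>
  of the derivative.\<close>

lemma partial_deriv_sq:
  assumes "f \<in> Cb_inf" "r \<noteq> 0"
  shows "(partial_deriv j f x)\<^sup>2 \<le> 2 * Dsq r j f x + 2 * r\<^sup>2 * Dsq r j (partial_deriv j f) x"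
proof -
  define v where "v = partial_deriv j f x"
  define p where "p = expavg r j (partial_deriv j f) x"
  define q where "q = expavg (- r) j (partial_deriv j f) x"
  have 1: "v\<^sup>2 \<le> 2 * p\<^sup>2 + 2 * (p - v)\<^sup>2" "v\<^sup>2 \<le> 2 * q\<^sup>2 + 2 * (q - v)\<^sup>2"
    using zero_le_power2[of "2 * p - v"] zero_le_power2[of "2 * q - v"]
    by (simp_all add: power2_eq_square algebra_simps)
  have eq: "expavg r j f x - f x = r * p" "expavg (- r) j f x - f x = - r * q"
    using expavg_resolvent[OF assms(1)] unfolding p_def q_def by simp_all
  have 2: "Dsq r j f x = (p\<^sup>2 + q\<^sup>2) / 2"
    unfolding Dsq_def eq using assms(2) by (simp add: power_mult_distrib field_simps)
  have 3: "r\<^sup>2 * Dsq r j (partial_deriv j f) x = ((p - v)\<^sup>2 + (q - v)\<^sup>2) / 2"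
    using assms(2) by (simp add: Dsq_def p_def q_def v_def)
  show ?thesis
    unfolding v_def[symmetric] using 1 2 3 by (simp add: field_simps)
qed

lemma D1_Cb_inf:
  assumes "f \<in> Cb_inf"
  shows "D1 r j f \<in> Cb_inf" "partial_deriv i (D1 r j f) = D1 r j (partial_deriv i f)"
proof -
  have eq: "D1 r j f = (\<lambda>x. (1 / (2 * r)) * (expavg r j f x - expavg (- r) j f x))" for f :: "real^'a \<Rightarrow> real"
    by (simp add: D1_def fun_eq_iff)
  show "D1 r j f \<in> Cb_inf"
    unfolding eq by (intro Cb_inf_cmult Cb_inf_diff expavg_Cb_inf assms)
  show "partial_deriv i (D1 r j f) = D1 r j (partial_deriv i f)"
    unfolding eq
    by (simp only: partial_deriv_cmult partial_deriv_Cb_diff Cb_inf_diff expavg_Cb_inf assms)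
qed

lemma D2_Cb_inf:
  assumes "f \<in> Cb_inf"
  shows "D2 r j f \<in> Cb_inf" "partial_deriv i (D2 r j f) = D2 r j (partial_deriv i f)"
proof -
  have eq: "D2 r j f = (\<lambda>x. (1 / (2 * r\<^sup>2)) * (expavg r j f x + expavg (- r) j f x - 2 * f x))" for f :: "real^'a \<Rightarrow> real"
    by (simp add: D2_def fun_eq_iff)
  show "D2 r j f \<in> Cb_inf"
    unfolding eq by (intro Cb_inf_cmult Cb_inf_diff Cb_inf_add expavg_Cb_inf assms)
  show "partial_deriv i (D2 r j f) = D2 r j (partial_deriv i f)"
    unfolding eq
    by (simp only: partial_deriv_cmult partial_deriv_Cb_diff partial_deriv_Cb_add Cb_inf_diff Cb_inf_add
        Cb_inf_cmult expavg_Cb_inf assms)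
qed

lemma D1_approx:
  assumes f: "f \<in> Cb_inf" and B: "\<And>x. \<bar>partial_deriv j (partial_deriv j f) x\<bar> \<le> B" and r: "r > 0"
  shows "\<bar>D1 r j f x - partial_deriv j f x\<bar> \<le> r * B"
  using expavg_near[OF Cb_infD(3)[OF f] B, of r x] expavg_near[OF Cb_infD(3)[OF f] B, of "- r" x] r
  unfolding D1_eq[OF f less_imp_neq[OF r, symmetric]] abs_le_iff by (simp add: field_simps)

lemma D2_approx:
  assumes f: "f \<in> Cb_inf" and B: "\<And>x. \<bar>partial_deriv j (partial_deriv j (partial_deriv j f)) x\<bar> \<le> B" and r: "r > 0"
  shows "\<bar>D2 r j f x - partial_deriv j (partial_deriv j f) x\<bar> \<le> r * B"
  using D1_approx[OF Cb_infD(3)[OF f] B r] r by (simp add: D2_eq f)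

text \<open>The summands of the operator are indexed by \<open>'d + 'd option\<close>: \<open>Inl j\<close> for the second
  order term in direction \<open>j\<close>, \<open>Inr (Some j)\<close> for the first order term, \<open>Inr None\<close> for the
  potential.\<close>

fun Dop :: "'d::finite + 'd option \<Rightarrow> real \<Rightarrow> (real^'d \<Rightarrow> real) \<Rightarrow> real^'d \<Rightarrow> real" where
  "Dop (Inl j) r f = D2 r j f"
| "Dop (Inr (Some j)) r f = D1 r j f"
| "Dop (Inr None) r f = f"

fun Dlim :: "'d::finite + 'd option \<Rightarrow> (real^'d \<Rightarrow> real) \<Rightarrow> real^'d \<Rightarrow> real" where
  "Dlim (Inl j) f = partial_deriv j (partial_deriv j f)"
| "Dlim (Inr (Some j)) f = partial_deriv j f"
| "Dlim (Inr None) f = f"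

lemma Cb_inf_bound_ex: "f \<in> Cb_inf \<Longrightarrow> \<exists>B\<ge>0. \<forall>x. \<bar>f x\<bar> \<le> B"
  using Cb_inf_bound by metis

lemma Dop_cases:
  obtains j where "m = Inl j" | j where "m = Inr (Some j)" | "m = Inr None"
  by (metis sum.exhaust option.exhaust)

lemma sum_Dop_index:
  fixes g :: "'d::finite + 'd option \<Rightarrow> real"
  shows "(\<Sum>m\<in>UNIV. g m) = (\<Sum>j\<in>UNIV. g (Inl j)) + (\<Sum>j\<in>UNIV. g (Inr (Some j))) + g (Inr None)"
proof -
  have "(\<Sum>m\<in>UNIV. g m) = (\<Sum>j\<in>UNIV. g (Inl j)) + (\<Sum>o'\<in>UNIV. g (Inr o'))"
    unfolding UNIV_sum by (subst sum.union_disjoint) (auto simp: sum.reindex)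
  also have "(\<Sum>o'\<in>UNIV. g (Inr o')) = g (Inr None) + (\<Sum>j\<in>UNIV. g (Inr (Some j)))"
    unfolding UNIV_option_conv by (subst sum.insert) (auto simp: sum.reindex)
  finally show ?thesis by simp
qed

lemma Dop_Cb_inf:
  assumes "f \<in> Cb_inf"
  shows "Dop m r f \<in> Cb_inf" "partial_deriv i (Dop m r f) = Dop m r (partial_deriv i f)"
  by (cases m rule: Dop_cases; simp add: D1_Cb_inf D2_Cb_inf assms)+

lemma Dop_diff:
  assumes "f \<in> Cb_inf" "g \<in> Cb_inf"
  shows "Dop m r (\<lambda>x. f x - g x) x = Dop m r f x - Dop m r g x"
proof (cases m rule: Dop_cases)
  case (1 j)
  show ?thesis
    unfolding 1 Dop.simps D2_def expavg_diff[OF assms] diff_divide_distrib[symmetric] by (simp add: algebra_simps)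
next
  case (2 j)
  show ?thesis
    unfolding 2 Dop.simps D1_def expavg_diff[OF assms] diff_divide_distrib[symmetric] by (simp add: algebra_simps)
qed simp

lemma Dop_cmult: "Dop m r (\<lambda>x. k * f x) x = k * Dop m r f x"
  by (cases m rule: Dop_cases; simp add: D1_def D2_def expavg_cmult add_divide_distrib diff_divide_distrib algebra_simps)

lemma Dop_add:
  assumes "f \<in> Cb_inf" "g \<in> Cb_inf"
  shows "Dop m r (\<lambda>x. f x + g x) x = Dop m r f x + Dop m r g x"
  using Dop_diff[OF assms(1) Cb_inf_cmult[OF assms(2), of "-1"], of m r x] Dop_cmult[of m r "-1" g x]
  by simp

text \<open>The constant degenerates as \<open>r\<close> tends to 0. The bound serves only at a
  fixed step, for the iterates of the approximate equation.\<close>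

lemma Dop_bound:
  assumes r: "r > 0"
  shows "\<exists>K\<ge>0. \<forall>m f B x. f \<in> Cb_inf \<longrightarrow> (\<forall>x. \<bar>f x\<bar> \<le> B) \<longrightarrow> \<bar>Dop m r f x\<bar> \<le> K * B"
proof -
  have "\<bar>Dop m r f x\<bar> \<le> (1 / r + 2 / r\<^sup>2 + 1) * B" if f: "f \<in> Cb_inf" and B: "\<And>x. \<bar>f x\<bar> \<le> B" for m f B x
  proof -
    have B0: "B \<ge> 0" using order_trans[OF abs_ge_zero B] .
    have nn: "B / r \<ge> 0" "2 * B / r\<^sup>2 \<ge> 0" using B0 r by auto
    note e = expavg_abs_le[OF f B, of r _ x] expavg_abs_le[OF f B, of "- r" _ x] B[of x]
    have "\<bar>Dop m r f x\<bar> \<le> B / r + 2 * B / r\<^sup>2 + B"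
    proof (cases m rule: Dop_cases)
      case (1 j)
      have "\<bar>expavg r j f x + expavg (- r) j f x - 2 * f x\<bar> \<le> 4 * B" using e(1,2)[of j] e(3) by linarith
      then have "\<bar>D2 r j f x\<bar> \<le> 4 * B / (2 * r\<^sup>2)"
        using divide_right_mono[of _ "4 * B" "2 * r\<^sup>2"] by (simp add: D2_def abs_divide)
      then show ?thesis unfolding 1 Dop.simps using nn B0 by linarith
    next
      case (2 j)
      have "\<bar>expavg r j f x - expavg (- r) j f x\<bar> \<le> 2 * B" using e(1,2)[of j] by linarith
      then have "\<bar>D1 r j f x\<bar> \<le> 2 * B / (2 * r)"
        using divide_right_mono[of _ "2 * B" "2 * r"] r by (simp add: D1_def abs_divide)
      then show ?thesis unfolding 2 Dop.simps using nn B0 by linarith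
    next
      case 3
      show ?thesis unfolding 3 Dop.simps using e(3) nn by linarith
    qed
    then show ?thesis by (simp add: algebra_simps)
  qed
  then show ?thesis using r by (intro exI[of _ "1 / r + 2 / r\<^sup>2 + 1"]) auto
qed

lemma Dop_approx:
  assumes f: "f \<in> Cb_inf" and r: "r > 0"
    and B: "\<And>j x. \<bar>pds [j, j] f x\<bar> \<le> B" "\<And>j x. \<bar>pds [j, j, j] f x\<bar> \<le> B"
  shows "\<bar>Dop m r f x - Dlim m f x\<bar> \<le> r * B"
proof (cases m rule: Dop_cases)
  case (1 j)
  then show ?thesis using D2_approx[OF f _ r, of j B] B(2) by simp
next
  case (2 j)
  then show ?thesis using D1_approx[OF f _ r, of j B] B(1) by simp
next
  case 3
  then show ?thesis using r order_trans[OF abs_ge_zero B(1)] by simp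
qed

text \<open>\<open>ell\<close> is the ellipticity hypothesis tested on the axis vectors, equivalent
  to it because the quadratic form is diagonal.\<close>

locale elliptic =
  fixes a b :: "'d::finite \<Rightarrow> real^'d \<Rightarrow> real" and c :: "real^'d \<Rightarrow> real" and kappa :: real
  assumes a: "\<And>j. a j \<in> Cb_inf" and b: "\<And>j. b j \<in> Cb_inf" and c: "c \<in> Cb_inf"
    and c_nonpos: "\<And>x. c x \<le> 0" and kappa: "kappa > 0"
    and ell: "\<And>j x. kappa \<le> (a j x)\<^sup>2"
begin

fun coef :: "'d + 'd option \<Rightarrow> real^'d \<Rightarrow> real" where
  "coef (Inl j) = (\<lambda>x. (a j x)\<^sup>2)"
| "coef (Inr (Some j)) = b j"
| "coef (Inr None) = c"

lemma coef_Cb_inf: "coef m \<in> Cb_inf"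
  by (cases m rule: Dop_cases; simp add: b c power2_eq_square Cb_inf_mult a)

definition L :: "real \<Rightarrow> (real^'d \<Rightarrow> real) \<Rightarrow> real^'d \<Rightarrow> real" where
  "L r f x = (\<Sum>m\<in>UNIV. coef m x * Dop m r f x)"

lemma elliptic_expr_eq: "elliptic_expr a b c f x = (\<Sum>m\<in>UNIV. coef m x * Dlim m f x)"
  unfolding elliptic_expr_def sum_Dop_index by (simp add: gradient_def inner_vec_def)

lemma L_Cb_inf:
  assumes "f \<in> Cb_inf"
  shows "L r f \<in> Cb_inf"
    and "partial_deriv i (L r f) x = L r (partial_deriv i f) x + (\<Sum>m\<in>UNIV. partial_deriv i (coef m) x * Dop m r f x)"
proof -
  have eq: "L r f = (\<lambda>x. \<Sum>m\<in>UNIV. coef m x * Dop m r f x)" for f by (simp add: L_def fun_eq_iff)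
  show "L r f \<in> Cb_inf"
    unfolding eq by (intro Cb_inf_sum Cb_inf_mult coef_Cb_inf Dop_Cb_inf assms)
  show "partial_deriv i (L r f) x = L r (partial_deriv i f) x + (\<Sum>m\<in>UNIV. partial_deriv i (coef m) x * Dop m r f x)"
    unfolding eq
    by (subst partial_deriv_Cb_sum)
      (auto simp: partial_deriv_Cb_mult coef_Cb_inf Dop_Cb_inf assms Cb_inf_mult sum.distrib)
qed

lemma L_diff: "f \<in> Cb_inf \<Longrightarrow> g \<in> Cb_inf \<Longrightarrow> L r (\<lambda>x. f x - g x) x = L r f x - L r g x"
  unfolding L_def by (simp add: Dop_diff right_diff_distrib sum_subtractf)

lemma L_add: "f \<in> Cb_inf \<Longrightarrow> g \<in> Cb_inf \<Longrightarrow> L r (\<lambda>x. f x + g x) x = L r f x + L r g x"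
  unfolding L_def by (simp add: Dop_add distrib_left sum.distrib)

lemma L_cmult: "L r (\<lambda>x. k * f x) x = k * L r f x"
  unfolding L_def Dop_cmult by (simp add: sum_distrib_left algebra_simps)

lemma L_zero: "L r (\<lambda>x. 0) x = 0"
  using L_cmult[of r 0 "\<lambda>x. 0" x] by simp

lemma L_sum: "(\<And>i. i \<in> I \<Longrightarrow> f i \<in> Cb_inf) \<Longrightarrow> L r (\<lambda>x. \<Sum>i\<in>I. f i x) x = (\<Sum>i\<in>I. L r (f i) x)"
  by (induction I rule: infinite_finite_induct) (auto simp: L_zero L_add Cb_inf_sum)

text \<open>\<open>K\<close> depends on the coefficients alone. Third derivatives enter because the
  error of a quotient is \<open>r\<close> times a bound on one derivative more than the quotient
  replaces.\<close>

lemma L_approx: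
  "\<exists>K\<ge>0. \<forall>f B r x. f \<in> Cb_inf \<longrightarrow> r > 0 \<longrightarrow> (\<forall>j x. \<bar>pds [j, j] f x\<bar> \<le> B) \<longrightarrow> (\<forall>j x. \<bar>pds [j, j, j] f x\<bar> \<le> B) \<longrightarrow>
     \<bar>L r f x - elliptic_expr a b c f x\<bar> \<le> K * B * r"
proof -
  obtain C where C: "\<And>m x. \<bar>coef m x\<bar> \<le> C m"
    using Cb_inf_bound_ex[OF coef_Cb_inf] by metis
  have "\<bar>L r f x - elliptic_expr a b c f x\<bar> \<le> sum C UNIV * B * r"
    if f: "f \<in> Cb_inf" and r: "r > 0" and B: "\<And>j x. \<bar>pds [j, j] f x\<bar> \<le> B" "\<And>j x. \<bar>pds [j, j, j] f x\<bar> \<le> B" for f B r x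
  proof -
    have "L r f x - elliptic_expr a b c f x = (\<Sum>m\<in>UNIV. coef m x * (Dop m r f x - Dlim m f x))"
      by (simp add: L_def elliptic_expr_eq right_diff_distrib sum_subtractf)
    also have "\<bar>\<dots>\<bar> \<le> (\<Sum>m\<in>UNIV. C m * (r * B))"
      unfolding real_norm_def[symmetric]
      by (rule sum_norm_le) (auto simp: abs_mult intro!: mult_mono' C Dop_approx[OF f r B])
    also have "\<dots> = sum C UNIV * B * r"
      unfolding sum_distrib_right[symmetric] by simp
    finally show ?thesis .
  qed
  moreover have "sum C UNIV \<ge> 0" by (intro sum_nonneg) (rule order_trans[OF abs_ge_zero C])
  ultimately show ?thesis by blast
qed

text \<open>For admissible step sizes the jump rates \<open>pos\<close> and \<open>neg\<close> are positive, so that \<open>L r\<close>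
  satisfies the maximum principle.\<close>

definition adm :: "real \<Rightarrow> bool" where
  "adm r \<longleftrightarrow> r > 0 \<and> (\<forall>j x. 2 * r * \<bar>b j x\<bar> \<le> kappa)"

lemma eventually_adm: "\<forall>\<^sub>F r in at_right 0. adm r"
proof -
  obtain B where B: "\<And>j. B j \<ge> 0" "\<And>j x. \<bar>b j x\<bar> \<le> B j"
    using Cb_inf_bound_ex[OF b] by metis
  define S where "S = 2 * sum B UNIV + 1"
  have S: "S > 0" unfolding S_def using B(1) by (intro add_nonneg_pos mult_nonneg_nonneg sum_nonneg) auto
  have "adm r" if r: "0 < r" "r < kappa / S" for r
    unfolding adm_def
  proof (intro conjI allI r)
    fix j x
    have "B j \<le> sum B UNIV" using B(1) by (intro member_le_sum) auto
    then have "2 * \<bar>b j x\<bar> \<le> S" using B(2)[of j x] unfolding S_def by linarith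
    then have "r * (2 * \<bar>b j x\<bar>) \<le> r * S" using r by (intro mult_left_mono) auto
    also have "\<dots> \<le> kappa" using r S by (simp add: field_simps)
    finally show "2 * r * \<bar>b j x\<bar> \<le> kappa" by (simp add: mult_ac)
  qed
  then show ?thesis
    unfolding eventually_at_right_field using S kappa by (intro exI[of _ "kappa / S"]) auto
qed

section \<open>Jump form of the approximating operator, maximum principle and carre du champ\<close>

definition pos :: "real \<Rightarrow> 'd \<Rightarrow> real^'d \<Rightarrow> real" where
  "pos r j x = (a j x)\<^sup>2 / (2 * r\<^sup>2) + b j x / (2 * r)"

definition neg :: "real \<Rightarrow> 'd \<Rightarrow> real^'d \<Rightarrow> real" where
  "neg r j x = (a j x)\<^sup>2 / (2 * r\<^sup>2) - b j x / (2 * r)"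

text \<open>Ellipticity gives the rate kappa / (2 r^2), and admissibility lets the drift consume at
  most half of it.\<close>

lemma pos_neg_lower:
  assumes "adm r"
  shows "kappa / (4 * r\<^sup>2) \<le> pos r j x" "kappa / (4 * r\<^sup>2) \<le> neg r j x"
proof -
  have r: "r > 0" and bb: "2 * r * \<bar>b j x\<bar> \<le> kappa" using assms by (auto simp: adm_def)
  have "\<bar>b j x\<bar> / (2 * r) = 2 * r * \<bar>b j x\<bar> / (4 * r\<^sup>2)"
    using r by (simp add: power2_eq_square)
  also have "\<dots> \<le> kappa / (4 * r\<^sup>2)" using bb by (intro divide_right_mono) auto
  finally have 1: "\<bar>b j x / (2 * r)\<bar> \<le> kappa / (4 * r\<^sup>2)" using r by (simp add: abs_divide)
  have "kappa / (2 * r\<^sup>2) \<le> (a j x)\<^sup>2 / (2 * r\<^sup>2)" using ell by (intro divide_right_mono) auto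
  moreover have "kappa / (2 * r\<^sup>2) = 2 * (kappa / (4 * r\<^sup>2))" by simp
  ultimately show "kappa / (4 * r\<^sup>2) \<le> pos r j x" "kappa / (4 * r\<^sup>2) \<le> neg r j x"
    using 1 unfolding pos_def neg_def abs_le_iff by linarith+
qed

lemma pos_neg_nonneg:
  assumes "adm r"
  shows "0 \<le> pos r j x" "0 \<le> neg r j x"
  using order_trans[OF _ pos_neg_lower(1)[OF assms]] order_trans[OF _ pos_neg_lower(2)[OF assms]] kappa
  by (simp_all add: less_imp_le)

text \<open>The generator of a jump process: jumps along the axes with exponentially distributed
  length of mean \<open>r\<close>, at the rates \<open>pos\<close> and \<open>neg\<close> in the two
  directions, and killing at the rate - c.\<close>

lemma L_jump:
  assumes "r > 0"
  shows "L r f x = (\<Sum>j\<in>UNIV. pos r j x * (expavg r j f x - f x) + neg r j x * (expavg (- r) j f x - f x)) + c x * f x"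
proof -
  have "(a j x)\<^sup>2 * D2 r j f x + b j x * D1 r j f x =
      pos r j x * (expavg r j f x - f x) + neg r j x * (expavg (- r) j f x - f x)" for j
    using assms by (simp add: D1_def D2_def pos_def neg_def field_simps power2_eq_square)
  then show ?thesis
    unfolding L_def sum_Dop_index by (simp add: sum.distrib[symmetric])
qed

text \<open>At a point where \<open>w\<close> is within d of its supremum, every mean jump gains at
  most d, and the total jump rate is at most \<open>P\<close> everywhere. Hence L r w \<le> P d
  there, and d can be taken arbitrarily small.\<close>

lemma maximum_principle:
  assumes r: "adm r" and w: "w \<in> Cb_inf" and mu: "mu > 0" and G: "G \<ge> 0"
    and le: "\<And>x. mu * w x - L r w x \<le> G"
  shows "w x \<le> G / mu"
proof -
  have r0: "r > 0" using r by (simp add: adm_def)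
  obtain B where B: "\<And>x. \<bar>w x\<bar> \<le> B" using Cb_inf_bound[OF w] by blast
  have bdd: "bdd_above (range w)"
    using B by (intro bdd_aboveI[of _ B]) (auto simp: abs_le_iff)
  define W where "W = Sup (range w)"
  have W: "w x \<le> W" for x unfolding W_def by (rule cSup_upper) (use bdd in auto)
  have "\<exists>A\<ge>0. \<forall>x. \<bar>a j x * a j x\<bar> \<le> A" for j
    by (intro Cb_inf_bound_ex Cb_inf_mult a)
  then obtain A where A: "\<And>j. A j \<ge> 0" "\<And>j x. \<bar>a j x * a j x\<bar> \<le> A j"
    by metis
  define P where "P = (\<Sum>j\<in>UNIV. A j / r\<^sup>2)"
  have "W \<le> G / mu"
  proof (cases "W \<le> 0")
    case True
    also have "0 \<le> G / mu" using G mu by simp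
    finally show ?thesis .
  next
    case False
    have "mu * W \<le> G"
    proof (rule field_le_epsilon)
      fix e :: real assume e: "e > 0"
      \<comment> \<open>The bound by \<open>W\<close> keeps \<open>w\<close> positive at the
        near-maximum, so that the potential has the right sign; the other bound makes the total
        error (P + mu) d at most \<open>e\<close>.\<close>
      define d where "d = min W (e / (P + mu))"
      have P: "P \<ge> 0" unfolding P_def using A by (intro sum_nonneg) auto
      have Pmu: "P + mu > 0" using P mu by simp
      have "(P + mu) * d \<le> (P + mu) * (e / (P + mu))"
        unfolding d_def using Pmu by (intro mult_left_mono min.cobounded2) simp
      then have d3: "(P + mu) * d \<le> e" using Pmu by simp
      have d: "0 < d" "d \<le> W" using False e Pmu by (simp_all add: d_def)
      have "W - d < Sup (range w)" using d by (simp add: W_def)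
      then obtain x where x: "W - d < w x"
        using less_cSupD[of "range w" "W - d"] by blast
      have wx: "w x > 0" using x d by linarith
      have "L r w x \<le> (\<Sum>j\<in>UNIV. pos r j x * d + neg r j x * d)"
      proof -
        have "c x * w x \<le> 0" using c_nonpos wx by (simp add: mult_nonpos_nonneg)
        moreover have "expavg s j w x - w x \<le> d" for s j
          using expavg_le[OF w W, of s j x] x by linarith
        ultimately have "(\<Sum>j\<in>UNIV. pos r j x * (expavg r j w x - w x) + neg r j x * (expavg (- r) j w x - w x))
            + c x * w x \<le> (\<Sum>j\<in>UNIV. pos r j x * d + neg r j x * d) + 0"
          by (intro add_mono sum_mono mult_left_mono pos_neg_nonneg r)
        then show ?thesis unfolding L_jump[OF r0] by simp
      qed
      also have "\<dots> = (\<Sum>j\<in>UNIV. (a j x)\<^sup>2 / r\<^sup>2) * d"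
        unfolding sum_distrib_right distrib_right[symmetric] by (simp add: pos_def neg_def)
      also have "(\<Sum>j\<in>UNIV. (a j x)\<^sup>2 / r\<^sup>2) \<le> P"
        unfolding P_def using A(2)
        by (intro sum_mono divide_right_mono) (auto simp: power2_eq_square abs_le_iff)
      finally have "L r w x \<le> P * d" using d by (simp add: mult_right_mono)
      then have "mu * w x \<le> G + P * d" using le[of x] by linarith
      moreover have "mu * (W - d) \<le> mu * w x" using x mu by (intro mult_left_mono) auto
      ultimately show "mu * W \<le> G + e" using d3 by (simp add: algebra_simps)
    qed
    then show ?thesis using mu by (simp add: field_simps)
  qed
  then show ?thesis using W order_trans by blast
qed

lemma resolvent_estimate:
  assumes r: "adm r" and w: "w \<in> Cb_inf" and mu: "mu > 0"
    and le: "\<And>x. \<bar>mu * w x - L r w x\<bar> \<le> G"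
  shows "\<bar>w x\<bar> \<le> G / mu"
proof -
  have G: "G \<ge> 0" using order_trans[OF abs_ge_zero le] .
  have "w x \<le> G / mu"
    by (rule maximum_principle[OF r w mu G]) (use le abs_ge_self order_trans in blast)
  moreover have "- 1 * w x \<le> G / mu"
    by (rule maximum_principle[OF r Cb_inf_cmult[OF w] mu G, of "- 1"])
      (use le L_cmult[of r "- 1" w] in \<open>auto simp: abs_le_iff algebra_simps\<close>)
  ultimately show ?thesis by simp
qed

text \<open>By Jensen's inequality each jump term of v^2 dominates its linearization 2 v (E v - v)
  plus the squared mean jump (E v - v)^2, and the rates are at least kappa / (4 r^2). The potential
  helps, since 2 c v^2 \<le> c v^2.\<close>

lemma L_square:
  assumes r: "adm r" and v: "v \<in> Cb_inf"
  shows "2 * v x * L r v x + kappa / 2 * (\<Sum>j\<in>UNIV. Dsq r j v x) \<le> L r (\<lambda>x. (v x)\<^sup>2) x"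
proof -
  have r0: "r > 0" using r by (simp add: adm_def)
  define k where "k = kappa / (4 * r\<^sup>2)"
  have jump: "2 * v x * (p * (expavg s j v x - v x)) + k * (expavg s j v x - v x)\<^sup>2
      \<le> p * (expavg s j (\<lambda>x. (v x)\<^sup>2) x - (v x)\<^sup>2)" if p: "k \<le> p" "0 \<le> p" for p s j
  proof -
    define m where "m = expavg s j v x"
    have "k * (m - v x)\<^sup>2 \<le> p * (m - v x)\<^sup>2" using p by (intro mult_right_mono) auto
    moreover have "p * m\<^sup>2 \<le> p * expavg s j (\<lambda>x. (v x)\<^sup>2) x"
      unfolding m_def using p by (intro mult_left_mono expavg_jensen v)
    ultimately show ?thesis
      unfolding m_def[symmetric] by (simp add: power2_eq_square algebra_simps)
  qed
  have "2 * v x * L r v x + kappa / 2 * (\<Sum>j\<in>UNIV. Dsq r j v x) =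
    (\<Sum>j\<in>UNIV. (2 * v x * (pos r j x * (expavg r j v x - v x)) + k * (expavg r j v x - v x)\<^sup>2)
       + (2 * v x * (neg r j x * (expavg (- r) j v x - v x)) + k * (expavg (- r) j v x - v x)\<^sup>2))
    + 2 * c x * (v x)\<^sup>2"
  proof -
    have "kappa / 2 * Dsq r j v x = k * (expavg r j v x - v x)\<^sup>2 + k * (expavg (- r) j v x - v x)\<^sup>2" for j
      by (simp add: Dsq_def k_def distrib_left add_divide_distrib)
    then have 1: "kappa / 2 * (\<Sum>j\<in>UNIV. Dsq r j v x) =
        (\<Sum>j\<in>UNIV. k * (expavg r j v x - v x)\<^sup>2 + k * (expavg (- r) j v x - v x)\<^sup>2)"
      by (simp only: sum_distrib_left)
    have 2: "2 * v x * L r v x = (\<Sum>j\<in>UNIV. 2 * v x * (pos r j x * (expavg r j v x - v x))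
        + 2 * v x * (neg r j x * (expavg (- r) j v x - v x))) + 2 * c x * (v x)\<^sup>2"
      unfolding L_jump[OF r0] by (simp add: distrib_left sum_distrib_left power2_eq_square)
    show ?thesis unfolding 1 2 by (simp only: sum.distrib)
  qed
  also have "\<dots> \<le> (\<Sum>j\<in>UNIV. pos r j x * (expavg r j (\<lambda>x. (v x)\<^sup>2) x - (v x)\<^sup>2)
       + neg r j x * (expavg (- r) j (\<lambda>x. (v x)\<^sup>2) x - (v x)\<^sup>2)) + c x * (v x)\<^sup>2"
  proof (intro add_mono sum_mono jump pos_neg_nonneg r)
    show "k \<le> pos r j x" "k \<le> neg r j x" for j unfolding k_def by (intro pos_neg_lower r)+
    show "2 * c x * (v x)\<^sup>2 \<le> c x * (v x)\<^sup>2"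
      using mult_nonpos_nonneg[OF c_nonpos[of x] zero_le_power2[of "v x"]] by simp
  qed
  also have "\<dots> = L r (\<lambda>x. (v x)\<^sup>2) x" by (simp add: L_jump[OF r0])
  finally show ?thesis .
qed

end

subsection \<open>Commutators and the approximate resolvent equation\<close>

lemma pds_add: "f \<in> Cb_inf \<Longrightarrow> g \<in> Cb_inf \<Longrightarrow> pds js (\<lambda>x. f x + g x) = (\<lambda>x. pds js f x + pds js g x)"
  by (induction js arbitrary: f g) (auto simp: partial_deriv_Cb_add Cb_infD(3))

lemma pds_cmult: "f \<in> Cb_inf \<Longrightarrow> pds js (\<lambda>x. r * f x) = (\<lambda>x. r * pds js f x)"
  by (induction js arbitrary: f) (auto simp: partial_deriv_cmult Cb_infD(3))

text \<open>The operators that occur in the commutator of \<open>L r\<close> with a derivative of order \<open>k\<close>. The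
  coefficients \<open>e\<close> do not depend on the step size \<open>r\<close>.\<close>

inductive comm_op :: "nat \<Rightarrow> (real \<Rightarrow> (real^'d::finite \<Rightarrow> real) \<Rightarrow> real^'d \<Rightarrow> real) \<Rightarrow> bool" where
  zero: "comm_op k (\<lambda>r f x. 0)"
| single: "e \<in> Cb_inf \<Longrightarrow> length js < k \<Longrightarrow> comm_op k (\<lambda>r f x. e x * Dop m r (pds js f) x)"
| add: "comm_op k G \<Longrightarrow> comm_op k G' \<Longrightarrow> comm_op k (\<lambda>r f x. G r f x + G' r f x)"

lemma comm_op_sum:
  "(\<And>i. i \<in> I \<Longrightarrow> comm_op k (G i)) \<Longrightarrow> comm_op k (\<lambda>r f x. \<Sum>i\<in>I. G i r f x)"
  by (induction I rule: infinite_finite_induct) (auto intro: comm_op.intros)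

lemma comm_op_Cb_inf: "comm_op k G \<Longrightarrow> f \<in> Cb_inf \<Longrightarrow> G r f \<in> Cb_inf"
  by (induction rule: comm_op.induct)
    (auto intro!: Cb_inf_const Cb_inf_mult Cb_inf_add Dop_Cb_inf pds_Cb_inf)

text \<open>By Leibniz' rule the derivative falls on the coefficient or, since \<open>Dop\<close>
  commutes with it, on the function, whose order of differentiation grows together with
  \<open>k\<close>.\<close>

lemma comm_op_deriv:
  "comm_op k G \<Longrightarrow> \<exists>G'. comm_op (Suc k) G' \<and> (\<forall>r f x. f \<in> Cb_inf \<longrightarrow> partial_deriv i (G r f) x = G' r f x)"
proof (induction rule: comm_op.induct)
  case (zero k)
  show ?case by (intro exI[of _ "\<lambda>r f x. 0"]) (auto intro: comm_op.zero simp: partial_deriv_const)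
next
  case (single e js k m)
  let ?G = "\<lambda>r f x. e x * Dop m r (pds (js @ [i]) f) x + partial_deriv i e x * Dop m r (pds js f) x"
  have "comm_op (Suc k) ?G"
    using single by (intro comm_op.add comm_op.single Cb_infD) auto
  moreover have "partial_deriv i (\<lambda>x. e x * Dop m r (pds js f) x) x = ?G r f x" if "f \<in> Cb_inf" for r f x
    using single that by (simp add: partial_deriv_Cb_mult Dop_Cb_inf pds_Cb_inf)
  ultimately show ?case by blast
next
  case (add k G1 G2)
  then obtain G1' G2' where
    "comm_op (Suc k) G1'" "\<forall>r f x. f \<in> Cb_inf \<longrightarrow> partial_deriv i (G1 r f) x = G1' r f x"
    "comm_op (Suc k) G2'" "\<forall>r f x. f \<in> Cb_inf \<longrightarrow> partial_deriv i (G2 r f) x = G2' r f x" by blast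
  then show ?case
    using add by (intro exI[of _ "\<lambda>r f x. G1' r f x + G2' r f x"])
      (auto intro: comm_op.add simp: partial_deriv_Cb_add comm_op_Cb_inf)
qed

lemma finite_lists_length [simp]:
  "finite {js :: 'd::finite list. length js = k}" "finite {js :: 'd list. length js < k}"
proof -
  show "finite {js :: 'd list. length js = k}"
    using finite_lists_length_eq[of "UNIV :: 'd set" k] by simp
  show "finite {js :: 'd list. length js < k}"
    by (rule finite_subset[OF _ finite_lists_length_le[of "UNIV :: 'd set" k]]) auto
qed

text \<open>The constant comes from the coefficients alone. Its independence of \<open>r\<close> is
  what makes the Bernstein bounds uniform.\<close>

lemma comm_op_bound:
  "comm_op k G \<Longrightarrow> \<exists>C\<ge>0. \<forall>r f x. \<bar>G r f x\<bar> \<le> C * (\<Sum>js | length js < k. \<Sum>m\<in>UNIV. \<bar>Dop m r (pds js f) x\<bar>)"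
proof (induction rule: comm_op.induct)
  case (zero k)
  show ?case by (intro exI[of _ 0]) simp
next
  case (single e js k m)
  obtain C where C: "C \<ge> 0" "\<And>x. \<bar>e x\<bar> \<le> C" using Cb_inf_bound single by blast
  have "\<bar>e x * Dop m r (pds js f) x\<bar> \<le> C * (\<Sum>js | length js < k. \<Sum>m\<in>UNIV. \<bar>Dop m r (pds js f) x\<bar>)" for r f x
  proof -
    have "\<bar>Dop m r (pds js f) x\<bar> \<le> (\<Sum>m\<in>UNIV. \<bar>Dop m r (pds js f) x\<bar>)"
      by (rule member_le_sum) auto
    also have "\<dots> \<le> (\<Sum>js | length js < k. \<Sum>m\<in>UNIV. \<bar>Dop m r (pds js f) x\<bar>)"
      using single by (intro member_le_sum sum_nonneg) auto
    finally show ?thesis unfolding abs_mult using C by (intro mult_mono) auto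
  qed
  then show ?case using C(1) by blast
next
  case (add k G G')
  then obtain C C' where C: "C \<ge> 0" "C' \<ge> 0"
    "\<And>r f x. \<bar>G r f x\<bar> \<le> C * (\<Sum>js | length js < k. \<Sum>m\<in>UNIV. \<bar>Dop m r (pds js f) x\<bar>)"
    "\<And>r f x. \<bar>G' r f x\<bar> \<le> C' * (\<Sum>js | length js < k. \<Sum>m\<in>UNIV. \<bar>Dop m r (pds js f) x\<bar>)"
    by blast
  have "\<bar>G r f x + G' r f x\<bar> \<le> (C + C') * (\<Sum>js | length js < k. \<Sum>m\<in>UNIV. \<bar>Dop m r (pds js f) x\<bar>)" for r f x
    unfolding distrib_right by (intro order_trans[OF abs_triangle_ineq add_mono] C)
  then show ?case using C(1,2) by (intro exI[of _ "C + C'"]) auto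
qed

section \<open>Solution of the approximate resolvent equation\<close>

context elliptic
begin

text \<open>\<open>G\<close> is fixed before \<open>r\<close> and \<open>f\<close>. One more
  derivative adds the terms in which it hits a coefficient of \<open>L r\<close>, and differentiates
  the previous \<open>G\<close>; a derivative of \<open>f\<close> of full order never occurs under
  \<open>Dop\<close> in \<open>G\<close>.\<close>

lemma commutator:
  "\<exists>G. comm_op (length js) G \<and>
    (\<forall>r f x. f \<in> Cb_inf \<longrightarrow> pds js (L r f) x = L r (pds js f) x + G r f x)"
proof (induction js rule: rev_induct)
  case Nil
  show ?case by (intro exI[of _ "\<lambda>r f x. 0"]) (auto intro: comm_op.zero)
next
  case (snoc j js)
  then obtain G where G: "comm_op (length js) G"
    "\<And>r f x. f \<in> Cb_inf \<Longrightarrow> pds js (L r f) x = L r (pds js f) x + G r f x" by blast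
  obtain G' where G': "comm_op (Suc (length js)) G'"
    "\<And>r f x. f \<in> Cb_inf \<Longrightarrow> partial_deriv j (G r f) x = G' r f x"
    using comm_op_deriv[OF G(1), of j] by blast
  let ?G = "\<lambda>r f x. (\<Sum>m\<in>UNIV. partial_deriv j (coef m) x * Dop m r (pds js f) x) + G' r f x"
  have "comm_op (length (js @ [j])) ?G"
    using G'(1) by (auto intro!: comm_op.add comm_op_sum comm_op.single Cb_infD coef_Cb_inf)
  moreover have "pds (js @ [j]) (L r f) x = L r (pds (js @ [j]) f) x + ?G r f x" if f: "f \<in> Cb_inf" for r f x
  proof -
    have "pds js (L r f) = (\<lambda>x. L r (pds js f) x + G r f x)" using G(2)[OF f] by (simp add: fun_eq_iff)
    then have "pds (js @ [j]) (L r f) x = partial_deriv j (\<lambda>x. L r (pds js f) x + G r f x) x" by simp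
    also have "\<dots> = partial_deriv j (L r (pds js f)) x + G' r f x"
      using f by (simp add: partial_deriv_Cb_add L_Cb_inf(1) pds_Cb_inf comm_op_Cb_inf[OF G(1)] G'(2))
    finally show ?thesis by (simp add: L_Cb_inf(2) pds_Cb_inf f)
  qed
  ultimately show ?case by blast
qed

text \<open>This makes \<open>u \<mapsto> (f + (L r + N) u) / (\<lambda> + N)\<close> a contraction.\<close>

lemma shifted_L_bound:
  assumes r: "adm r"
  shows "\<exists>N>0. \<forall>v B x. v \<in> Cb_inf \<longrightarrow> (\<forall>x. \<bar>v x\<bar> \<le> B) \<longrightarrow> \<bar>L r v x + N * v x\<bar> \<le> N * B"
proof -
  have r0: "r > 0" using r by (simp add: adm_def)
  have "\<exists>A\<ge>0. \<forall>x. \<bar>a j x * a j x\<bar> \<le> A" for j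
    by (intro Cb_inf_bound_ex Cb_inf_mult a)
  then obtain A where A: "\<And>j. A j \<ge> 0" "\<And>j x. \<bar>a j x * a j x\<bar> \<le> A j"
    by metis
  obtain C where C: "C \<ge> 0" "\<And>x. \<bar>c x\<bar> \<le> C" using Cb_inf_bound[OF c] by blast
  \<comment> \<open>\<open>N\<close> exceeds the total jump rate plus the killing rate. So L r + N
    is a combination of averages and the identity with nonnegative weights, whose sum N + c is at
    most \<open>N\<close>.\<close>
  define N where "N = (\<Sum>j\<in>UNIV. A j / r\<^sup>2) + C + 1"
  have N: "N > 0" unfolding N_def using A(1) C(1) by (intro add_nonneg_pos add_nonneg_nonneg sum_nonneg) auto
  have "\<bar>L r v x + N * v x\<bar> \<le> N * B" if v: "v \<in> Cb_inf" and B: "\<And>x. \<bar>v x\<bar> \<le> B" for v B x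
  proof -
    have B0: "B \<ge> 0" using order_trans[OF abs_ge_zero B] .
    define P where "P = (\<Sum>j\<in>UNIV. pos r j x + neg r j x)"
    have "P = (\<Sum>j\<in>UNIV. (a j x)\<^sup>2 / r\<^sup>2)" unfolding P_def by (simp add: pos_def neg_def)
    also have "\<dots> \<le> (\<Sum>j\<in>UNIV. A j / r\<^sup>2)"
      using A(2) by (intro sum_mono divide_right_mono) (auto simp: power2_eq_square abs_le_iff)
    finally have P: "N - P + c x \<ge> 0" using C(2)[of x] unfolding N_def by linarith
    have "L r v x + N * v x =
        (\<Sum>j\<in>UNIV. pos r j x * expavg r j v x + neg r j x * expavg (- r) j v x) + (N - P + c x) * v x"
    proof -
      have eq: "(\<Sum>j\<in>UNIV. pos r j x * (expavg r j v x - v x) + neg r j x * (expavg (- r) j v x - v x)) =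
          (\<Sum>j\<in>UNIV. pos r j x * expavg r j v x + neg r j x * expavg (- r) j v x) - P * v x"
        unfolding P_def sum_distrib_right sum_subtractf[symmetric]
        by (intro sum.cong) (auto simp: algebra_simps)
      show ?thesis unfolding L_jump[OF r0] eq by (simp only: distrib_right left_diff_distrib)
    qed
    also have "\<bar>\<dots>\<bar> \<le> (\<Sum>j\<in>UNIV. pos r j x * B + neg r j x * B) + (N - P + c x) * B"
    proof (rule order_trans[OF abs_triangle_ineq add_mono])
      have "\<bar>pos r j x * expavg r j v x + neg r j x * expavg (- r) j v x\<bar> \<le> pos r j x * B + neg r j x * B" for j
      proof (rule order_trans[OF abs_triangle_ineq add_mono])
        show "\<bar>pos r j x * expavg r j v x\<bar> \<le> pos r j x * B"
          unfolding abs_mult abs_of_nonneg[OF pos_neg_nonneg(1)[OF r]]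
          by (rule mult_left_mono[OF expavg_abs_le[OF v B] pos_neg_nonneg(1)[OF r]])
        show "\<bar>neg r j x * expavg (- r) j v x\<bar> \<le> neg r j x * B"
          unfolding abs_mult abs_of_nonneg[OF pos_neg_nonneg(2)[OF r]]
          by (rule mult_left_mono[OF expavg_abs_le[OF v B] pos_neg_nonneg(2)[OF r]])
      qed
      then show "\<bar>\<Sum>j\<in>UNIV. pos r j x * expavg r j v x + neg r j x * expavg (- r) j v x\<bar>
          \<le> (\<Sum>j\<in>UNIV. pos r j x * B + neg r j x * B)"
        by (rule order_trans[OF sum_abs sum_mono])
      show "\<bar>(N - P + c x) * v x\<bar> \<le> (N - P + c x) * B"
        unfolding abs_mult using P B by (simp add: mult_left_mono)
    qed
    also have "\<dots> = (N + c x) * B"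
    proof -
      have "(\<Sum>j\<in>UNIV. pos r j x * B + neg r j x * B) = P * B"
        unfolding P_def sum_distrib_right by (simp only: distrib_right)
      then show ?thesis by (simp only: distrib_right left_diff_distrib)
    qed
    also have "\<dots> \<le> N * B" using mult_right_mono[of "N + c x" N B] c_nonpos[of x] B0 by simp
    finally show ?thesis .
  qed
  note bound = this
  show ?thesis
  proof (intro exI[of _ N] conjI N allI impI)
    fix v :: "real^'d \<Rightarrow> real" and B x assume "v \<in> Cb_inf" "\<forall>x. \<bar>v x\<bar> \<le> B"
    then show "\<bar>L r v x + N * v x\<bar> \<le> N * B" using bound[of v B x] by simp
  qed
qed

text \<open>The iteration contracts in the sup norm only. Smoothness of the limit comes from bounds
  on all derivatives of the iterates, by induction on the order: the leading part acts on a
  derivative as the same contraction, and the commutator involves lower orders, already bounded by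
  constants that may depend on \<open>r\<close>.\<close>

lemma discrete_resolvent:
  assumes r: "adm r" and lam: "lam > 0" and f: "f \<in> Cb_inf"
  shows "\<exists>u\<in>Cb_inf. \<forall>x. lam * u x - L r u x = f x"
proof -
  have r0: "r > 0" using r by (simp add: adm_def)
  obtain N where N: "N > 0" and
    contr: "\<And>v B x. v \<in> Cb_inf \<Longrightarrow> (\<And>x. \<bar>v x\<bar> \<le> B) \<Longrightarrow> \<bar>L r v x + N * v x\<bar> \<le> N * B"
    using shifted_L_bound[OF r] by blast
  define T where "T v x = (1 / (lam + N)) * (f x + (L r v x + N * v x))" for v x
  define u where "u n = (T ^^ n) (\<lambda>x. 0)" for n
  have T_Cb: "T v \<in> Cb_inf" if "v \<in> Cb_inf" for v
    unfolding T_def using that f by (intro Cb_inf_cmult Cb_inf_add L_Cb_inf)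
  have u_Suc: "u (Suc n) = T (u n)" for n by (simp add: u_def)
  have u_Cb: "u n \<in> Cb_inf" for n
    by (induction n) (simp_all add: u_Suc T_Cb, simp add: u_def Cb_inf_const)
  define th where "th = N / (lam + N)"
  have th: "0 \<le> th" "th < 1" using N lam by (auto simp: th_def)
  have T_diff: "\<bar>T v x - T w x\<bar> \<le> th * B"
    if v: "v \<in> Cb_inf" and w: "w \<in> Cb_inf" and B: "\<And>x. \<bar>v x - w x\<bar> \<le> B" for v w B x
  proof -
    have "T v x - T w x = (L r (\<lambda>x. v x - w x) x + N * (v x - w x)) / (lam + N)"
    proof -
      have "(1 / k) * (f0 + (a0 + N * b0)) - (1 / k) * (f0 + (a1 + N * b1)) = ((a0 - a1) + N * (b0 - b1)) / k"
        for k f0 a0 b0 a1 b1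
        by (simp add: divide_inverse algebra_simps)
      then show ?thesis unfolding T_def L_diff[OF v w] .
    qed
    then have "\<bar>T v x - T w x\<bar> = \<bar>L r (\<lambda>x. v x - w x) x + N * (v x - w x)\<bar> / (lam + N)"
      using N lam by simp
    also have "\<dots> \<le> (N * B) / (lam + N)"
      using N lam by (intro divide_right_mono contr Cb_inf_diff v w B) auto
    finally show ?thesis by (simp add: th_def)
  qed
  obtain F where F: "\<And>x. \<bar>u 1 x - u 0 x\<bar> \<le> F" using Cb_inf_bound[OF Cb_inf_diff[OF u_Cb u_Cb]] by blast
  have step: "\<bar>u (Suc n) x - u n x\<bar> \<le> F * th ^ n" for n x
  proof (induction n arbitrary: x)
    case 0
    then show ?case using F by simp
  next
    case (Suc n)
    have "\<bar>u (Suc (Suc n)) x - u (Suc n) x\<bar> \<le> th * (F * th ^ n)"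
      unfolding u_Suc[of "Suc n"] u_Suc[of n] using Suc
      by (intro T_diff u_Cb T_Cb) (simp add: u_Suc)
    then show ?case by (simp add: mult_ac)
  qed
  have "uniformly_convergent_on UNIV (\<lambda>n x. \<Sum>i<n. u (Suc i) x - u i x)"
    by (rule Weierstrass_m_test'[where M = "\<lambda>n. F * th ^ n"])
      (use step th in \<open>auto intro!: summable_mult summable_geometric\<close>)
  moreover have "(\<lambda>n x. \<Sum>i<n. u (Suc i) x - u i x) = u"
  proof (intro ext)
    have "u 0 x = 0" for x by (simp add: u_def)
    then show "(\<Sum>i<n. u (Suc i) x - u i x) = u n x" for n x
      using sum_lessThan_telescope[of "\<lambda>i. u i x" n] by simp
  qed
  ultimately have cauchy: "uniformly_Cauchy_on UNIV u"
    using uniformly_convergent_Cauchy by metis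
  have bounds: "\<exists>B. \<forall>n x. \<bar>pds js (u n) x\<bar> \<le> B" for js
  proof (induction js rule: length_induct)
    case (1 js)
    then have "\<forall>is. \<exists>B. length is < length js \<longrightarrow> (\<forall>n x. \<bar>pds is (u n) x\<bar> \<le> B)" by blast
    then obtain B where B: "\<And>is n x. length is < length js \<Longrightarrow> \<bar>pds is (u n) x\<bar> \<le> B is" by metis
    obtain G where G: "comm_op (length js) G"
      "\<And>r f x. f \<in> Cb_inf \<Longrightarrow> pds js (L r f) x = L r (pds js f) x + G r f x"
      using commutator by blast
    obtain C where C: "C \<ge> 0"
      "\<And>r f x. \<bar>G r f x\<bar> \<le> C * (\<Sum>is | length is < length js. \<Sum>m\<in>UNIV. \<bar>Dop m r (pds is f) x\<bar>)"
      using comm_op_bound[OF G(1)] by blast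
    obtain K where "\<forall>m f B x. f \<in> (Cb_inf :: (real^'d \<Rightarrow> real) set) \<longrightarrow> (\<forall>x. \<bar>f x\<bar> \<le> B) \<longrightarrow> \<bar>Dop m r f x\<bar> \<le> K * B"
      using Dop_bound[OF r0, where ?'a = 'd] by blast
    then have K: "\<And>m f B x. f \<in> Cb_inf \<Longrightarrow> (\<And>x. \<bar>f x\<bar> \<le> B) \<Longrightarrow> \<bar>Dop m (r::real) (f :: real^'d \<Rightarrow> real) x\<bar> \<le> K * B"
      by simp
    obtain F where F: "F \<ge> 0" "\<And>x. \<bar>pds js f x\<bar> \<le> F" using Cb_inf_bound[OF pds_Cb_inf[OF f]] by blast
    define C' where "C' = C * (\<Sum>is | length is < length js. \<Sum>m\<in>(UNIV :: ('d + 'd option) set). K * B is)"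
    have C': "\<bar>G r (u n) x\<bar> \<le> C'" for n x
      unfolding C'_def
      by (rule order_trans[OF C(2)]) (rule mult_left_mono[OF _ C(1)], intro sum_mono K pds_Cb_inf u_Cb B, simp)
    \<comment> \<open>The fixed point of M \<mapsto> (F + C' + N M) / (lam + N), hence a bound that
      each iteration preserves.\<close>
    define M where "M = (F + C') / lam"
    have M0: "M \<ge> 0" unfolding M_def using F(1) order_trans[OF abs_ge_zero C'] lam by simp
    have "\<bar>pds js (u n) x\<bar> \<le> M" for n x
    proof (induction n arbitrary: x)
      case 0
      \<comment> \<open>The starting function is zero; written as 0 times itself, it has vanishing
        derivatives by \<open>pds_cmult\<close>.\<close>
      have "pds js (\<lambda>x. 0 * u 0 x) = (\<lambda>x. 0 * pds js (u 0) x)" by (rule pds_cmult[OF u_Cb])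
      then show ?case using M0 by (simp add: u_def)
    next
      case (Suc n)
      have "pds js (u (Suc n)) =
          (\<lambda>x. (1 / (lam + N)) * (pds js f x + (pds js (L r (u n)) x + N * pds js (u n) x)))"
        unfolding u_Suc T_def by (simp only: pds_cmult pds_add Cb_inf_add Cb_inf_cmult f L_Cb_inf(1) u_Cb)
      then have "pds js (u (Suc n)) x =
          (pds js f x + G r (u n) x + (L r (pds js (u n)) x + N * pds js (u n) x)) / (lam + N)"
        by (simp only: G(2) u_Cb times_divide_eq_left mult_1 add_ac)
      then have "\<bar>pds js (u (Suc n)) x\<bar> =
          \<bar>pds js f x + G r (u n) x + (L r (pds js (u n)) x + N * pds js (u n) x)\<bar> / (lam + N)"
        using lam N by (simp only: abs_divide)
      also have "\<dots> \<le> (F + C' + N * M) / (lam + N)"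
      proof (rule divide_right_mono)
        have "\<bar>L r (pds js (u n)) x + N * pds js (u n) x\<bar> \<le> N * M"
          by (rule contr[OF pds_Cb_inf[OF u_Cb] Suc])
        then show "\<bar>pds js f x + G r (u n) x + (L r (pds js (u n)) x + N * pds js (u n) x)\<bar> \<le> F + C' + N * M"
          using F(2)[of x] C'[of n x] by linarith
      qed (use lam N in simp)
      also have "\<dots> = M"
      proof -
        have "F + C' = M * lam" using lam by (simp add: M_def)
        then have "F + C' + N * M = M * (lam + N)" by (simp add: algebra_simps)
        then show ?thesis using lam N by simp
      qed
      finally show ?case .
    qed
    then show ?case by blast
  qed
  have "\<exists>w\<in>Cb_inf. \<forall>js. uniform_limit UNIV (\<lambda>n. pds js (u n)) (pds js w) sequentially"
  proof (rule Cb_inf_uniform_limit[OF u_Cb _ cauchy])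
    show "\<exists>B. \<forall>\<^sub>F n in sequentially. \<forall>x. \<bar>pds js (u n) x\<bar> \<le> B" for js
      using bounds[of js] by (auto intro: always_eventually)
  qed
  then obtain w where w: "w \<in> Cb_inf" "\<And>js. uniform_limit UNIV (\<lambda>n. pds js (u n)) (pds js w) sequentially"
    by blast
  have lim: "uniform_limit UNIV u w sequentially" using w(2)[of "[]"] by simp
  have "T w x = w x" for x
  proof (rule LIMSEQ_unique)
    show "(\<lambda>n. u (Suc n) x) \<longlonglongrightarrow> w x"
      by (rule LIMSEQ_Suc[OF tendsto_uniform_limitI[OF lim UNIV_I]])
    show "(\<lambda>n. u (Suc n) x) \<longlonglongrightarrow> T w x"
    proof (rule LIMSEQ_I)
      fix e :: real assume e: "e > 0"
      obtain M where M: "\<And>n x. n \<ge> M \<Longrightarrow> \<bar>u n x - w x\<bar> \<le> e / 2"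
        using uniform_limitD[OF lim, of "e / 2"] e
        unfolding eventually_sequentially dist_real_def by (auto intro: less_imp_le)
      have "norm (u (Suc n) x - T w x) < e" if "n \<ge> M" for n
      proof -
        have "\<bar>T (u n) x - T w x\<bar> \<le> th * (e / 2)" using M[OF that] by (intro T_diff u_Cb w)
        also have "\<dots> < e" using th e mult_left_le_one_le[of "e / 2" th] by linarith
        finally show ?thesis by (simp add: u_Suc)
      qed
      then show "\<exists>M. \<forall>n\<ge>M. norm (u (Suc n) x - T w x) < e" by blast
    qed
  qed
  then have "(lam + N) * w x = f x + (L r w x + N * w x)" for x
    unfolding T_def using lam N by (simp add: field_simps)
  then have "lam * w x - L r w x = f x" for x by (simp add: algebra_simps)
  then show ?thesis using w(1) by blast
qed

end

subsection \<open>Bernstein's method\<close>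

lemma young_inequality:
  fixes x y eta :: real
  assumes "eta > 0"
  shows "2 * (x * y) \<le> eta * y\<^sup>2 + x\<^sup>2 / eta"
proof -
  have "0 \<le> (eta * y - x)\<^sup>2 / eta" using assms by simp
  also have "\<dots> = eta * y\<^sup>2 + x\<^sup>2 / eta - 2 * (x * y)"
    using assms by (simp add: power2_eq_square field_simps)
  finally show ?thesis by simp
qed

lemma abs_le_if_square_le: "(x :: real)\<^sup>2 \<le> y\<^sup>2 \<Longrightarrow> 0 \<le> y \<Longrightarrow> \<bar>x\<bar> \<le> y"
  by (metis abs_le_square_iff abs_of_nonneg)

text \<open>Here \<open>q\<^sup>2\<close> and \<open>p\<^sup>2\<close> stand for the sums of the \<^const>\<open>Dsq\<close> terms of top and of lower order.\<close>

lemma bernstein_arithmetic: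
  fixes kappa C B :: real
  assumes kappa: "kappa > 0" and C: "C \<ge> 0" and B: "B \<ge> 0" and S: "finite S" and T: "finite T"
  shows "\<exists>c0 K M. c0 \<ge> 0 \<and> K \<ge> 0 \<and> (\<forall>v g z h p q r.
    p \<ge> 0 \<longrightarrow> q \<ge> 0 \<longrightarrow> (\<forall>s\<in>S. \<bar>g s\<bar> \<le> C * (1 + q + p)) \<longrightarrow>
    (\<forall>t\<in>T. \<bar>h t\<bar> \<le> C * (1 + p) \<and> \<bar>z t\<bar> \<le> B) \<longrightarrow>
    (\<Sum>s\<in>S. (v s)\<^sup>2) \<le> 2 * p\<^sup>2 + 2 * r\<^sup>2 * q\<^sup>2 \<longrightarrow> c0 * r\<^sup>2 \<le> kappa \<longrightarrow>
    (\<Sum>s\<in>S. 2 * v s * g s) + K * (\<Sum>t\<in>T. 2 * z t * h t) - kappa / 2 * q\<^sup>2 - K * (kappa / 2) * p\<^sup>2 \<le> M)"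
proof -
  define n where "n = real (card S)"
  define m where "m = real (card T)"
  have nm: "n \<ge> 0" "m \<ge> 0" by (simp_all add: n_def m_def)
  \<comment> \<open>Over the \<open>n\<close> top order terms the Young parameters add up to at most
    kappa / 4, half of the available gain in q^2; the other half is reserved for
    \<open>r\<close>-dependent terms.\<close>
  define eta where "eta = kappa / (4 * (n + 1))"
  have eta: "eta > 0" using kappa nm by (simp add: eta_def)
  have neta: "n * eta \<le> kappa / 4" using kappa nm by (simp add: eta_def field_simps)
  define c5 where "c5 = C\<^sup>2 / eta + 2 * C\<^sup>2"
  have c5: "c5 \<ge> 0" using eta by (simp add: c5_def)
  define c11 where "c11 = 2 * (m * B * C) + (m * B * C)\<^sup>2 / (kappa / 4)"
  \<comment> \<open>The gain K (kappa / 2) p^2 is used in two halves: K (kappa / 4) equals the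
    coefficient of p^2 coming from the top order, and the rest absorbs the cross terms of lower
    order.\<close>
  define K where "K = 4 * (n + 2 * c5) / kappa"
  have K: "K \<ge> 0" using nm c5 kappa by (simp add: K_def)
  have main: "(\<Sum>s\<in>S. 2 * v s * g s) + K * (\<Sum>t\<in>T. 2 * z t * h t) - kappa / 2 * q\<^sup>2 - K * (kappa / 2) * p\<^sup>2
      \<le> n + K * c11"
    if p: "p \<ge> 0" and q: "q \<ge> 0" and g: "\<And>s. s \<in> S \<Longrightarrow> \<bar>g s\<bar> \<le> C * (1 + q + p)"
      and h: "\<And>t. t \<in> T \<Longrightarrow> \<bar>h t\<bar> \<le> C * (1 + p)" and z: "\<And>t. t \<in> T \<Longrightarrow> \<bar>z t\<bar> \<le> B"
      and V: "(\<Sum>s\<in>S. (v s)\<^sup>2) \<le> 2 * p\<^sup>2 + 2 * r\<^sup>2 * q\<^sup>2" and r: "8 * c5 * r\<^sup>2 \<le> kappa" for v g z h p q r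
  proof -
    have "(\<Sum>s\<in>S. 2 * v s * g s) \<le> (\<Sum>s\<in>S. eta * q\<^sup>2 + p\<^sup>2 + 1 + c5 * (v s)\<^sup>2)"
    proof (rule sum_mono)
      fix s assume s: "s \<in> S"
      define y where "y = \<bar>v s\<bar> * C"
      have y2: "y\<^sup>2 = C\<^sup>2 * (v s)\<^sup>2" by (simp add: y_def power_mult_distrib)
      have "v s * g s \<le> \<bar>v s\<bar> * \<bar>g s\<bar>" by (metis abs_ge_self abs_mult)
      also have "\<dots> \<le> \<bar>v s\<bar> * (C * (1 + q + p))" using g[OF s] by (intro mult_left_mono) auto
      finally have "2 * v s * g s \<le> 2 * (y * 1) + 2 * (y * q) + 2 * (y * p)"
        by (simp add: y_def algebra_simps)
      also have "\<dots> \<le> (1 * 1\<^sup>2 + y\<^sup>2 / 1) + (eta * q\<^sup>2 + y\<^sup>2 / eta) + (1 * p\<^sup>2 + y\<^sup>2 / 1)"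
        by (intro add_mono young_inequality eta) auto
      also have "\<dots> = eta * q\<^sup>2 + p\<^sup>2 + 1 + c5 * (v s)\<^sup>2"
        by (simp add: y2 c5_def algebra_simps)
      finally show "2 * v s * g s \<le> eta * q\<^sup>2 + p\<^sup>2 + 1 + c5 * (v s)\<^sup>2" .
    qed
    also have "\<dots> = n * eta * q\<^sup>2 + n * p\<^sup>2 + n + c5 * (\<Sum>s\<in>S. (v s)\<^sup>2)"
      by (simp add: sum.distrib n_def sum_distrib_left distrib_left)
    also have "\<dots> \<le> kappa / 4 * q\<^sup>2 + n * p\<^sup>2 + n + c5 * (2 * p\<^sup>2 + 2 * r\<^sup>2 * q\<^sup>2)"
      using c5 neta V by (intro add_mono mult_left_mono mult_right_mono) auto
    also have "\<dots> = kappa / 4 * q\<^sup>2 + (2 * c5 * r\<^sup>2) * q\<^sup>2 + (n + 2 * c5) * p\<^sup>2 + n"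
      by (simp add: algebra_simps)
    \<comment> \<open>This is the requirement on \<open>c0\<close>: for 8 c5 r^2 \<le> kappa the
      remainder takes the second quarter of kappa.\<close>
    also have "(2 * c5 * r\<^sup>2) * q\<^sup>2 \<le> (kappa / 4) * q\<^sup>2"
      using r by (intro mult_right_mono) auto
    finally have 1: "(\<Sum>s\<in>S. 2 * v s * g s) \<le> kappa / 2 * q\<^sup>2 + (n + 2 * c5) * p\<^sup>2 + n" by simp
    have "(\<Sum>t\<in>T. 2 * z t * h t) \<le> (\<Sum>t\<in>T. 2 * (B * (C * (1 + p))))"
    proof (rule sum_mono)
      fix t assume t: "t \<in> T"
      have "z t * h t \<le> \<bar>z t\<bar> * \<bar>h t\<bar>" by (metis abs_ge_self abs_mult)
      also have "\<dots> \<le> B * (C * (1 + p))" using h[OF t] z[OF t] by (intro mult_mono') auto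
      finally show "2 * z t * h t \<le> 2 * (B * (C * (1 + p)))" by simp
    qed
    also have "\<dots> = 2 * (m * B * C) + 2 * ((m * B * C) * p)" by (simp add: m_def algebra_simps)
    also have "2 * ((m * B * C) * p) \<le> kappa / 4 * p\<^sup>2 + (m * B * C)\<^sup>2 / (kappa / 4)"
      using kappa by (intro young_inequality) simp
    finally have "(\<Sum>t\<in>T. 2 * z t * h t) \<le> c11 + kappa / 4 * p\<^sup>2" by (simp add: c11_def)
    from mult_left_mono[OF this K]
    have 2: "K * (\<Sum>t\<in>T. 2 * z t * h t) \<le> K * c11 + K * (kappa / 4) * p\<^sup>2" by (simp add: algebra_simps)
    have "K * (kappa / 4) * p\<^sup>2 = (n + 2 * c5) * p\<^sup>2" using kappa by (simp add: K_def)
    moreover have "K * (kappa / 2) * p\<^sup>2 = 2 * (K * (kappa / 4) * p\<^sup>2)" by simp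
    ultimately show ?thesis using 1 2 by linarith
  qed
  show ?thesis
    by (rule exI[of _ "8 * c5"], rule exI[of _ K], rule exI[of _ "n + K * c11"])
      (use c5 K main in auto)
qed

context elliptic
begin

text \<open>A top order derivative v solves lam v - L v = g with g bounded by a multiple of 1 + q +
  p. In 2 v g all factors are measured by the gain of \<open>L_square\<close>, v itself through
  \<open>partial_deriv_sq\<close>. This produces p^2 terms without a matching gain at top order; the
  weighted lower order block supplies one.\<close>

lemma bernstein_step:
  assumes lam: "lam > 0" and f: "f \<in> Cb_inf"
    and u: "\<And>r. adm r \<Longrightarrow> u r \<in> Cb_inf" "\<And>r x. adm r \<Longrightarrow> lam * u r x - L r (u r) x = f x"
    and k: "k > 0" and B: "B \<ge> 0"
    and lower: "\<forall>\<^sub>F r in at_right 0. \<forall>js. length js < k \<longrightarrow> (\<forall>x. \<bar>pds js (u r) x\<bar> \<le> B)"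
  shows "\<exists>B. \<forall>\<^sub>F r in at_right 0. \<forall>js. length js = k \<longrightarrow> (\<forall>x. \<bar>pds js (u r) x\<bar> \<le> B)"
proof -
  define S where "S = {js :: 'd list. length js = k}"
  define T where "T = {js :: 'd list. length js < k}"
  have fin: "finite S" "finite T" unfolding S_def T_def by simp_all
  define q2 where "q2 r x = (\<Sum>s\<in>S. \<Sum>j\<in>UNIV. Dsq r j (pds s (u r)) x)" for r x
  define p2 where "p2 r x = (\<Sum>t\<in>T. \<Sum>j\<in>UNIV. Dsq r j (pds t (u r)) x)" for r x
  define q where "q r x = sqrt (q2 r x)" for r x
  define p where "p r x = sqrt (p2 r x)" for r x
  have nn: "q2 r x \<ge> 0" "p2 r x \<ge> 0" for r x
    unfolding q2_def p2_def by (intro sum_nonneg Dsq_nonneg)+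
  then have pq: "q r x \<ge> 0" "p r x \<ge> 0" "(q r x)\<^sup>2 = q2 r x" "(p r x)\<^sup>2 = p2 r x" for r x
    by (simp_all add: q_def p_def)
  have Dsq_le: "Dsq r j (pds s (u r)) x \<le> (\<Sum>s\<in>A. \<Sum>j\<in>UNIV. Dsq r j (pds s (u r)) x)"
    if "s \<in> A" "finite A" for A r x s j
    using member_le_sum[of j UNIV "\<lambda>j. Dsq r j (pds s (u r)) x"]
      member_le_sum[of s A "\<lambda>s. \<Sum>j\<in>UNIV. Dsq r j (pds s (u r)) x"] that
    by (force simp: Dsq_nonneg sum_nonneg)
  have Dsq_q: "Dsq r j (pds s (u r)) x \<le> (q r x)\<^sup>2" if "s \<in> S" for r x s j
    unfolding pq q2_def by (rule Dsq_le[OF that fin(1)])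
  have Dsq_p: "Dsq r j (pds s (u r)) x \<le> (p r x)\<^sup>2" if "s \<in> T" for r x s j
    unfolding pq p2_def by (rule Dsq_le[OF that fin(2)])
  define good where "good r \<longleftrightarrow> adm r \<and> (\<forall>js. length js < k \<longrightarrow> (\<forall>x. \<bar>pds js (u r) x\<bar> \<le> B))" for r
  \<comment> \<open>By \<open>D2_eq\<close> a second order quotient of a derivative of order k - 1
    is a first order quotient at order k and is measured by \<open>q\<close>; the remaining
    quotients are measured by \<open>p\<close>, and the term without a quotient by
    \<open>B\<close>.\<close>
  have Dop_q: "\<bar>Dop m r (pds js (u r)) x\<bar> \<le> B + p r x + (if Suc (length js) = k then q r x else 0)"
    if g: "good r" and js: "length js < k" for r x m js
  proof -
    have r: "r \<noteq> 0" "adm r" using g by (auto simp: good_def adm_def)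
    have jsT: "js \<in> T" using js by (simp add: T_def)
    have C: "pds js (u r) \<in> Cb_inf" using u(1) r by (intro pds_Cb_inf)
    show ?thesis
    proof (cases m rule: Dop_cases)
      case (1 j)
      have sq: "(D2 r j (pds js (u r)) x)\<^sup>2 \<le> Dsq r j (pds (js @ [j]) (u r)) x"
        using D2_sq[OF C r(1)] by simp
      have "\<bar>D2 r j (pds js (u r)) x\<bar> \<le> (if Suc (length js) = k then q r x else p r x)"
      proof (cases "Suc (length js) = k")
        case True
        then have "(D2 r j (pds js (u r)) x)\<^sup>2 \<le> (q r x)\<^sup>2"
          using order_trans[OF sq Dsq_q] by (simp add: S_def)
        then show ?thesis using True abs_le_if_square_le pq(1) by simp
      next
        case False
        then have "(D2 r j (pds js (u r)) x)\<^sup>2 \<le> (p r x)\<^sup>2"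
          using order_trans[OF sq Dsq_p] js by (simp add: T_def)
        then show ?thesis using False abs_le_if_square_le pq(2) by simp
      qed
      then show ?thesis using 1 B pq(1,2)[of r x] by (auto split: if_splits)
    next
      case (2 j)
      have "(D1 r j (pds js (u r)) x)\<^sup>2 \<le> (p r x)\<^sup>2"
        by (rule order_trans[OF D1_sq[OF r(1)] Dsq_p[OF jsT]])
      then have "\<bar>D1 r j (pds js (u r)) x\<bar> \<le> p r x"
        using abs_le_if_square_le pq(2) by blast
      then show ?thesis using 2 B pq(1,2)[of r x] by auto
    next
      case 3
      have "\<bar>pds js (u r) x\<bar> \<le> B" using g js by (simp add: good_def)
      then show ?thesis using 3 pq(1,2)[of r x] by auto
    qed
  qed
  \<comment> \<open>The right-hand side in the equation for the derivative \<open>js\<close>: the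
    derivative of \<open>f\<close> plus the commutator.\<close>
  define g where "g js r x = lam * pds js (u r) x - L r (pds js (u r)) x" for js r x
  have "\<exists>C\<ge>0. \<forall>r x. good r \<longrightarrow> length js \<le> k \<longrightarrow> \<bar>g js r x\<bar> \<le> C * (1 + (if length js = k then q r x else 0) + p r x)" for js
  proof -
    obtain G where G: "comm_op (length js) G"
      "\<And>r f x. f \<in> Cb_inf \<Longrightarrow> pds js (L r f) x = L r (pds js f) x + G r f x"
      using commutator by blast
    obtain C where C: "C \<ge> 0"
      "\<And>r f x. \<bar>G r f x\<bar> \<le> C * (\<Sum>is | length is < length js. \<Sum>m\<in>UNIV. \<bar>Dop m r (pds is f) x\<bar>)"
      using comm_op_bound[OF G(1)] by blast
    obtain F where F: "F \<ge> 0" "\<And>x. \<bar>pds js f x\<bar> \<le> F" using Cb_inf_bound[OF pds_Cb_inf[OF f]] by blast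
    define n where "n = real (card {is :: 'd list. length is < length js}) * real (card (UNIV :: ('d + 'd option) set))"
    have n: "n \<ge> 0" by (simp add: n_def)
    have "\<bar>g js r x\<bar> \<le> (F + C * n * (B + 1)) * (1 + (if length js = k then q r x else 0) + p r x)"
      if gd: "good r" and le: "length js \<le> k" for r x
    proof -
      define Q where "Q = (if length js = k then q r x else 0)"
      have Q: "Q \<ge> 0" using pq by (simp add: Q_def)
      have ad: "adm r" using gd by (simp add: good_def)
      have "pds js f x = lam * pds js (u r) x - pds js (L r (u r)) x"
      proof -
        have "f = (\<lambda>x. lam * u r x + (- 1) * L r (u r) x)" using u(2)[OF ad] by (simp add: fun_eq_iff)
        then have "pds js f = pds js (\<lambda>x. lam * u r x + (- 1) * L r (u r) x)" by simp
        also have "\<dots> = (\<lambda>x. lam * pds js (u r) x + (- 1) * pds js (L r (u r)) x)"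
          using u(1)[OF ad] by (simp only: pds_add pds_cmult Cb_inf_cmult L_Cb_inf(1))
        finally show ?thesis by (simp add: fun_eq_iff)
      qed
      then have "g js r x = pds js f x + G r (u r) x"
        by (simp add: g_def G(2) u(1)[OF ad])
      also have "\<bar>\<dots>\<bar> \<le> F + C * (\<Sum>is | length (is :: 'd list) < length js. \<Sum>m\<in>(UNIV :: ('d + 'd option) set). B + p r x + Q)"
      proof -
        have "(\<Sum>is | length is < length js. \<Sum>m\<in>UNIV. \<bar>Dop m r (pds is (u r)) x\<bar>)
            \<le> (\<Sum>is | length (is :: 'd list) < length js. \<Sum>m\<in>(UNIV :: ('d + 'd option) set). B + p r x + Q)"
        proof (intro sum_mono)
          fix "is" :: "'d list" and m :: "'d + 'd option" assume "is \<in> {is. length is < length js}"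
          then have l: "length is < length js" by simp
          show "\<bar>Dop m r (pds is (u r)) x\<bar> \<le> B + p r x + Q"
            using Dop_q[OF gd less_le_trans[OF l le], of m x] l le pq(1)[of r x]
            unfolding Q_def by (auto split: if_splits)
        qed
        then have "\<bar>G r (u r) x\<bar> \<le> C * (\<Sum>is | length (is :: 'd list) < length js. \<Sum>m\<in>(UNIV :: ('d + 'd option) set). B + p r x + Q)"
          by (rule order_trans[OF C(2) mult_left_mono[OF _ C(1)]])
        then show ?thesis using F(2)[of x] by linarith
      qed
      also have "\<dots> = F + C * n * (B + p r x + Q)" by (simp add: n_def mult.assoc)
      also have "\<dots> \<le> F * (1 + Q + p r x) + C * n * ((B + 1) * (1 + Q + p r x))"
      proof (intro add_mono mult_left_mono)
        show "F \<le> F * (1 + Q + p r x)" using F(1) Q pq(2)[of r x] by (simp add: mult_le_cancel_left1)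
        show "B + p r x + Q \<le> (B + 1) * (1 + Q + p r x)"
          using B Q pq(2)[of r x] by (simp add: algebra_simps)
        show "0 \<le> C * n" using C(1) n by simp
      qed
      finally show ?thesis unfolding Q_def[symmetric] by (simp add: algebra_simps)
    qed
    then show ?thesis using F(1) C(1) n B by (intro exI[of _ "F + C * n * (B + 1)"]) auto
  qed
  then obtain C where C: "\<And>js. C js \<ge> 0"
    "\<And>js r x. good r \<Longrightarrow> length js \<le> k \<Longrightarrow> \<bar>g js r x\<bar> \<le> C js * (1 + (if length js = k then q r x else 0) + p r x)"
    by metis
  define C' where "C' = sum C (S \<union> T)"
  have C': "C' \<ge> 0" unfolding C'_def using C(1) by (simp add: sum_nonneg)
  have CC: "C js \<le> C'" if "js \<in> S \<union> T" for js
    unfolding C'_def using that fin C(1) by (intro member_le_sum) auto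
  have gS: "\<bar>g s r x\<bar> \<le> C' * (1 + q r x + p r x)" if "s \<in> S" "good r" for s r x
    using C(2)[OF that(2), of s x] that(1) pq(1,2)[of r x]
    by (intro order_trans[OF _ mult_right_mono[OF CC[of s]]]) (auto simp: S_def)
  have gT: "\<bar>g t r x\<bar> \<le> C' * (1 + p r x)" if "t \<in> T" "good r" for t r x
    using C(2)[OF that(2), of t x] that(1) pq(1,2)[of r x]
    by (intro order_trans[OF _ mult_right_mono[OF CC[of t]]]) (auto simp: T_def)
  \<comment> \<open>Splitting off the last direction is injective on lists of length
    \<open>k\<close>, nonempty as \<open>k > 0\<close>. The lower order terms from
    \<open>partial_deriv_sq\<close> are therefore distinct summands of \<open>p2\<close>.\<close>
  have V: "(\<Sum>s\<in>S. (pds s (u r) x)\<^sup>2) \<le> 2 * (p r x)\<^sup>2 + 2 * r\<^sup>2 * (q r x)\<^sup>2" if "good r" for r x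
  proof -
    have r: "r \<noteq> 0" "adm r" using that by (auto simp: good_def adm_def)
    have "(\<Sum>s\<in>S. (pds s (u r) x)\<^sup>2) \<le>
        (\<Sum>s\<in>S. 2 * Dsq r (last s) (pds (butlast s) (u r)) x + 2 * r\<^sup>2 * Dsq r (last s) (pds s (u r)) x)"
    proof (rule sum_mono)
      fix s assume "s \<in> S"
      then have "s \<noteq> []" using k by (auto simp: S_def)
      then have s: "pds s (u r) = partial_deriv (last s) (pds (butlast s) (u r))"
        by (metis append_butlast_last_id pds_snoc)
      show "(pds s (u r) x)\<^sup>2 \<le> 2 * Dsq r (last s) (pds (butlast s) (u r)) x + 2 * r\<^sup>2 * Dsq r (last s) (pds s (u r)) x"
        unfolding s by (rule partial_deriv_sq[OF pds_Cb_inf[OF u(1)[OF r(2)]] r(1)])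
    qed
    also have "\<dots> = 2 * (\<Sum>s\<in>S. Dsq r (last s) (pds (butlast s) (u r)) x)
        + 2 * r\<^sup>2 * (\<Sum>s\<in>S. Dsq r (last s) (pds s (u r)) x)"
      by (simp add: sum.distrib sum_distrib_left)
    also have "\<dots> \<le> 2 * (p r x)\<^sup>2 + 2 * r\<^sup>2 * (q r x)\<^sup>2"
    proof (intro add_mono mult_left_mono)
      define ph where "ph s = (butlast s, last s)" for s :: "'d list"
      have inj: "inj_on ph S"
      proof (rule inj_onI)
        fix s t assume "s \<in> S" "t \<in> S" and eq: "ph s = ph t"
        then have "s \<noteq> []" "t \<noteq> []" using k by (auto simp: S_def)
        then show "s = t" using eq unfolding ph_def by (metis append_butlast_last_id prod.inject)
      qed
      have sub: "ph ` S \<subseteq> T \<times> UNIV" using k by (auto simp: ph_def S_def T_def)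
      have "(\<Sum>s\<in>S. Dsq r (last s) (pds (butlast s) (u r)) x) = (\<Sum>(t, j)\<in>ph ` S. Dsq r j (pds t (u r)) x)"
        unfolding sum.reindex[OF inj] by (simp add: ph_def)
      also have "\<dots> \<le> (\<Sum>(t, j)\<in>T \<times> UNIV. Dsq r j (pds t (u r)) x)"
        using fin sub by (intro sum_mono2) (auto simp: Dsq_nonneg)
      also have "\<dots> = p2 r x" unfolding p2_def by (rule sum.cartesian_product[symmetric])
      finally show "(\<Sum>s\<in>S. Dsq r (last s) (pds (butlast s) (u r)) x) \<le> (p r x)\<^sup>2" by (simp add: pq)
      have "(\<Sum>s\<in>S. Dsq r (last s) (pds s (u r)) x) \<le> q2 r x"
        unfolding q2_def by (intro sum_mono member_le_sum) (auto simp: Dsq_nonneg)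
      then show "(\<Sum>s\<in>S. Dsq r (last s) (pds s (u r)) x) \<le> (q r x)\<^sup>2" by (simp add: pq)
    qed auto
    finally show ?thesis .
  qed
  obtain c0 K M where c0: "c0 \<ge> 0" and K: "K \<ge> 0" and arith: "\<forall>v g z h p q r.
    p \<ge> 0 \<longrightarrow> q \<ge> 0 \<longrightarrow> (\<forall>s\<in>S. \<bar>g s\<bar> \<le> C' * (1 + q + p)) \<longrightarrow>
    (\<forall>t\<in>T. \<bar>h t\<bar> \<le> C' * (1 + p) \<and> \<bar>z t\<bar> \<le> B) \<longrightarrow>
    (\<Sum>s\<in>S. (v s)\<^sup>2) \<le> 2 * p\<^sup>2 + 2 * r\<^sup>2 * q\<^sup>2 \<longrightarrow> c0 * r\<^sup>2 \<le> kappa \<longrightarrow>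
    (\<Sum>s\<in>S. 2 * v s * g s) + K * (\<Sum>t\<in>T. 2 * z t * h t) - kappa / 2 * q\<^sup>2 - K * (kappa / 2) * p\<^sup>2 \<le> M"
    using bernstein_arithmetic[OF kappa C' B fin] by (elim exE conjE) rule
  have final: "\<bar>pds s (u r) x\<bar> \<le> sqrt (\<bar>M\<bar> / (2 * lam))"
    if gd: "good r" and small: "c0 * r\<^sup>2 \<le> kappa" and s: "s \<in> S" for r s x
  proof -
    have ad: "adm r" using gd by (simp add: good_def)
    have P: "pds js (u r) \<in> Cb_inf" for js using u(1)[OF ad] by (rule pds_Cb_inf)
    have P2: "(\<lambda>x. (pds js (u r) x)\<^sup>2) \<in> Cb_inf" for js
      using Cb_inf_mult[OF P P] by (simp add: power2_eq_square)
    \<comment> \<open>For each derivative v, \<open>L_square\<close> gives 2 lam v^2 - L (v^2) \<le>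
      2 v g minus kappa / 2 times its \<open>Dsq\<close> terms. Summed with the weight
      \<open>K\<close>, the right-hand sides form the expression in
      \<open>bernstein_arithmetic\<close>; the doubled parameter comes from squaring.\<close>
    define w where "w x = (\<Sum>s\<in>S. (pds s (u r) x)\<^sup>2) + K * (\<Sum>t\<in>T. (pds t (u r) x)\<^sup>2)" for x
    have w: "w \<in> Cb_inf" unfolding w_def by (intro Cb_inf_add Cb_inf_cmult Cb_inf_sum P2)
    have "2 * lam * w x - L r w x \<le> \<bar>M\<bar>" for x
    proof -
      have sq: "2 * lam * (pds js (u r) x)\<^sup>2 - L r (\<lambda>x. (pds js (u r) x)\<^sup>2) x
          \<le> 2 * pds js (u r) x * g js r x - kappa / 2 * (\<Sum>j\<in>UNIV. Dsq r j (pds js (u r)) x)" for js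
        using L_square[OF ad P[of js], of x] by (simp add: g_def power2_eq_square algebra_simps)
      have "L r w x = (\<Sum>s\<in>S. L r (\<lambda>x. (pds s (u r) x)\<^sup>2) x) + K * (\<Sum>t\<in>T. L r (\<lambda>x. (pds t (u r) x)\<^sup>2) x)"
        unfolding w_def by (simp add: L_add L_cmult L_sum Cb_inf_cmult Cb_inf_sum P2)
      then have "2 * lam * w x - L r w x =
          (\<Sum>s\<in>S. 2 * lam * (pds s (u r) x)\<^sup>2 - L r (\<lambda>x. (pds s (u r) x)\<^sup>2) x)
          + K * (\<Sum>t\<in>T. 2 * lam * (pds t (u r) x)\<^sup>2 - L r (\<lambda>x. (pds t (u r) x)\<^sup>2) x)"
        unfolding w_def by (simp add: sum_subtractf sum_distrib_left[symmetric] algebra_simps)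
      also have "\<dots> \<le> (\<Sum>s\<in>S. 2 * pds s (u r) x * g s r x - kappa / 2 * (\<Sum>j\<in>UNIV. Dsq r j (pds s (u r)) x))
          + K * (\<Sum>t\<in>T. 2 * pds t (u r) x * g t r x - kappa / 2 * (\<Sum>j\<in>UNIV. Dsq r j (pds t (u r)) x))"
        by (intro add_mono mult_left_mono sum_mono sq K)
      also have "\<dots> = (\<Sum>s\<in>S. 2 * pds s (u r) x * g s r x) + K * (\<Sum>t\<in>T. 2 * pds t (u r) x * g t r x)
          - kappa / 2 * (q r x)\<^sup>2 - K * (kappa / 2) * (p r x)\<^sup>2"
        unfolding pq q2_def p2_def sum_subtractf sum_distrib_left[symmetric] by (simp add: algebra_simps)
      also have "\<dots> \<le> M"
      proof (rule arith[rule_format, where r = r])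
        show "\<bar>g t r x\<bar> \<le> C' * (1 + p r x) \<and> \<bar>pds t (u r) x\<bar> \<le> B" if "t \<in> T" for t
          using gT gd that by (auto simp: good_def T_def)
      qed (use pq gS gd V small in auto)
      finally show ?thesis by simp
    qed
    then have "w x \<le> \<bar>M\<bar> / (2 * lam)"
      using lam by (intro maximum_principle[OF ad w]) auto
    moreover have "(pds s (u r) x)\<^sup>2 \<le> w x"
    proof -
      have "(pds s (u r) x)\<^sup>2 \<le> (\<Sum>s\<in>S. (pds s (u r) x)\<^sup>2)" using fin s by (intro member_le_sum) auto
      moreover have "0 \<le> K * (\<Sum>t\<in>T. (pds t (u r) x)\<^sup>2)" using K by (intro mult_nonneg_nonneg sum_nonneg) auto
      ultimately show ?thesis unfolding w_def by linarith
    qed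
    ultimately have "(pds s (u r) x)\<^sup>2 \<le> \<bar>M\<bar> / (2 * lam)" by linarith
    from real_sqrt_le_mono[OF this] show ?thesis by simp
  qed
  have "((\<lambda>r. c0 * r\<^sup>2) \<longlongrightarrow> c0 * 0\<^sup>2) (at_right 0)" by (intro tendsto_intros)
  then have "\<forall>\<^sub>F r in at_right 0. c0 * r\<^sup>2 < kappa"
    using kappa by (intro order_tendstoD) auto
  then have "\<forall>\<^sub>F r in at_right 0. \<forall>js. length js = k \<longrightarrow> (\<forall>x. \<bar>pds js (u r) x\<bar> \<le> sqrt (\<bar>M\<bar> / (2 * lam)))"
    using eventually_adm lower
    by eventually_elim (use final in \<open>auto simp: good_def S_def\<close>)
  then show ?thesis by blast
qed

text \<open>Order zero is \<open>resolvent_estimate\<close>. The range of step sizes may shrink with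
  every order, hence the filter in place of a fixed threshold.\<close>

lemma bernstein_bounds:
  assumes lam: "lam > 0" and f: "f \<in> Cb_inf"
    and u: "\<And>r. adm r \<Longrightarrow> u r \<in> Cb_inf" "\<And>r x. adm r \<Longrightarrow> lam * u r x - L r (u r) x = f x"
  shows "\<exists>B\<ge>0. \<forall>\<^sub>F r in at_right 0. \<forall>js. length js < k \<longrightarrow> (\<forall>x. \<bar>pds js (u r) x\<bar> \<le> B)"
proof (induction k)
  case 0
  show ?case by (intro exI[of _ 0]) simp
next
  case (Suc k)
  then obtain B where B: "B \<ge> 0"
    "\<forall>\<^sub>F r in at_right 0. \<forall>js. length js < k \<longrightarrow> (\<forall>x. \<bar>pds js (u r) x\<bar> \<le> B)" by blast
  have "\<exists>B. \<forall>\<^sub>F r in at_right 0. \<forall>js. length js = k \<longrightarrow> (\<forall>x. \<bar>pds js (u r) x\<bar> \<le> B)"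
  proof (cases "k = 0")
    case True
    obtain F where F: "\<And>x. \<bar>f x\<bar> \<le> F" using Cb_inf_bound[OF f] by blast
    have "\<bar>u r x\<bar> \<le> F / lam" if "adm r" for r x
      by (rule resolvent_estimate[OF that u(1)[OF that] lam]) (simp add: u(2)[OF that] F)
    then show ?thesis
      using True eventually_adm by (auto intro!: exI[of _ "F / lam"] elim: eventually_mono)
  next
    case False
    then show ?thesis by (intro bernstein_step[OF lam f u _ B]) auto
  qed
  then obtain B' where B': "\<forall>\<^sub>F r in at_right 0. \<forall>js. length js = k \<longrightarrow> (\<forall>x. \<bar>pds js (u r) x\<bar> \<le> B')" by blast
  have "\<forall>\<^sub>F r in at_right 0. \<forall>js. length js < Suc k \<longrightarrow> (\<forall>x. \<bar>pds js (u r) x\<bar> \<le> max B B')"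
    using B(2) B' by eventually_elim (auto simp: less_Suc_eq le_max_iff_disj)
  then show ?case using B(1) by (intro exI[of _ "max B B'"]) auto
qed

section \<open>Passage to the limit of vanishing step size\<close>

theorem smooth_solvability:
  assumes lam: "lam > 0" and f: "f \<in> Cb_inf"
  shows "\<exists>w\<in>Cb_inf. \<forall>x. lam * w x - elliptic_expr a b c w x = f x"
proof -
  have "\<forall>r. \<exists>v. adm r \<longrightarrow> v \<in> Cb_inf \<and> (\<forall>x. lam * v x - L r v x = f x)"
    using discrete_resolvent[OF _ lam f] by blast
  then obtain u where u: "\<And>r. adm r \<Longrightarrow> u r \<in> Cb_inf" "\<And>r x. adm r \<Longrightarrow> lam * u r x - L r (u r) x = f x"
    by metis
  \<comment> \<open>Orders below 4 are enough for \<open>L_approx\<close>, which asks for second and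
    third derivatives.\<close>
  obtain B where B: "B \<ge> 0"
    "\<forall>\<^sub>F r in at_right 0. \<forall>js. length js < 4 \<longrightarrow> (\<forall>x. \<bar>pds js (u r) x\<bar> \<le> B)"
    using bernstein_bounds[OF lam f u, of 4] by blast
  have "\<forall>\<^sub>F r in at_right 0. adm r \<and> (\<forall>js. length js < 4 \<longrightarrow> (\<forall>x. \<bar>pds js (u r) x\<bar> \<le> B))"
    using B(2) eventually_adm by eventually_elim auto
  then obtain r0 where r0: "r0 > 0"
    "\<And>r. 0 < r \<Longrightarrow> r < r0 \<Longrightarrow> adm r \<and> (\<forall>js. length js < 4 \<longrightarrow> (\<forall>x. \<bar>pds js (u r) x\<bar> \<le> B))"
    unfolding eventually_at_right_field by blast
  \<comment> \<open>The summand 2 puts already \<open>r 0\<close> strictly below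
    \<open>r0\<close>.\<close>
  define r where "r n = r0 / (real n + 2)" for n
  have r: "0 < r n" "r n < r0" for n
  proof -
    have "r0 * 1 < r0 * (real n + 2)" using r0(1) by (intro mult_strict_left_mono) auto
    then show "r n < r0" by (simp add: r_def divide_less_eq)
    show "0 < r n" using r0(1) by (simp add: r_def)
  qed
  have r_lim: "r \<longlonglongrightarrow> 0"
    unfolding r_def by real_asymp
  have r_at: "filterlim r (at_right 0) sequentially"
  proof -
    have "r n \<noteq> 0" for n using r(1)[of n] by simp
    then show ?thesis using r_lim r(1) by (simp add: filterlim_at)
  qed
  have ad: "adm (r n)" for n using r0(2) r by blast
  have bd: "\<bar>pds js (u (r n)) x\<bar> \<le> B" if "length js < 4" for js n x using r0(2)[OF r] that by blast
  obtain K where K: "K \<ge> 0"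
    "\<And>f B r x. f \<in> Cb_inf \<Longrightarrow> r > 0 \<Longrightarrow> (\<And>j x. \<bar>pds [j, j] f x\<bar> \<le> B) \<Longrightarrow> (\<And>j x. \<bar>pds [j, j, j] f x\<bar> \<le> B) \<Longrightarrow>
     \<bar>L r f x - elliptic_expr a b c f x\<bar> \<le> K * B * r"
    using L_approx by blast
  define U where "U n = u (r n)" for n
  have U: "U n \<in> Cb_inf" for n unfolding U_def by (rule u(1)[OF ad])
  have LU: "\<bar>L s (U n) x - elliptic_expr a b c (U n) x\<bar> \<le> K * B * s" if "s > 0" for s n x
    using that unfolding U_def by (intro K(2) u(1) ad bd) auto
  \<comment> \<open>The difference is inserted into the equation for the step \<open>r m\<close>
    only; what remains is L (r m) - L (r n) applied to the single function \<open>U n\<close>, and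
    both operators are close to the elliptic one there.\<close>
  have diff: "\<bar>U m x - U n x\<bar> \<le> K * B * (r m + r n) / lam" for m n x
  proof (rule resolvent_estimate[OF ad[of m] Cb_inf_diff[OF U U] lam])
    fix x
    have "lam * (U m x - U n x) - L (r m) (\<lambda>x. U m x - U n x) x = L (r m) (U n) x - L (r n) (U n) x"
      using u(2)[OF ad[of m], of x] u(2)[OF ad[of n], of x]
      by (simp add: L_diff U) (simp add: U_def algebra_simps)
    also have "\<bar>\<dots>\<bar> \<le> K * B * r m + K * B * r n"
      using LU[OF r(1)[of m], of n x] LU[OF r(1)[of n], of n x] by linarith
    finally show "\<bar>lam * (U m x - U n x) - L (r m) (\<lambda>x. U m x - U n x) x\<bar> \<le> K * B * (r m + r n)"
      by (simp add: algebra_simps)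
  qed
  have cauchy: "uniformly_Cauchy_on UNIV U"
    unfolding uniformly_Cauchy_on_def
  proof (intro allI impI)
    fix e :: real assume e: "e > 0"
    have "(\<lambda>n. K * B * (2 * r n) / lam) \<longlonglongrightarrow> K * B * (2 * 0) / lam"
      using lam by (intro tendsto_intros r_lim) auto
    then have "\<forall>\<^sub>F n in sequentially. K * B * (2 * r n) / lam < e"
      using e by (intro order_tendstoD) auto
    then obtain M where M: "\<And>n. n \<ge> M \<Longrightarrow> K * B * (2 * r n) / lam < e"
      unfolding eventually_sequentially by blast
    have "dist (U m x) (U n x) < e" if "m \<ge> M" "n \<ge> M" for m n x
    proof -
      have mean: "D < e" if "X = (Y + Z) / 2" "D \<le> X" "Y < e" "Z < e" for D X Y Z :: real
        using that by simp
      have "K * B * (r m + r n) / lam = (K * B * (2 * r m) / lam + K * B * (2 * r n) / lam) / 2"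
        using lam by (simp add: field_simps)
      then show ?thesis
        unfolding dist_real_def by (rule mean[OF _ diff M[OF that(1)] M[OF that(2)]])
    qed
    then show "\<exists>M. \<forall>x\<in>UNIV. \<forall>m\<ge>M. \<forall>n\<ge>M. dist (U m x) (U n x) < e" by blast
  qed
  have "\<exists>B. \<forall>\<^sub>F n in sequentially. \<forall>x. \<bar>pds js (U n) x\<bar> \<le> B" for js
  proof -
    obtain B where "\<forall>\<^sub>F r in at_right 0. \<forall>is. length is < Suc (length js) \<longrightarrow> (\<forall>x. \<bar>pds is (u r) x\<bar> \<le> B)"
      using bernstein_bounds[OF lam f u, of "Suc (length js)"] by blast
    from eventually_compose_filterlim[OF this r_at]
    have "\<forall>\<^sub>F n in sequentially. \<forall>x. \<bar>pds js (U n) x\<bar> \<le> B"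
      unfolding U_def by eventually_elim auto
    then show ?thesis by blast
  qed
  from Cb_inf_uniform_limit[OF U this cauchy]
  obtain w where w: "w \<in> Cb_inf" "\<And>js. uniform_limit UNIV (\<lambda>n. pds js (U n)) (pds js w) sequentially"
    by blast
  have ptw: "(\<lambda>n. pds js (U n) x) \<longlonglongrightarrow> pds js w x" for js x
    using tendsto_uniform_limitI[OF w(2)] by simp
  have Dlim_tendsto: "(\<lambda>n. Dlim m (U n) x) \<longlonglongrightarrow> Dlim m w x" for m x
    using ptw[of "[_, _]"] ptw[of "[_]"] ptw[of "[]"] by (cases m rule: Dop_cases) auto
  have "lam * w x - elliptic_expr a b c w x = f x" for x
  proof (rule LIMSEQ_unique)
    show "(\<lambda>n. lam * U n x - elliptic_expr a b c (U n) x) \<longlonglongrightarrow> lam * w x - elliptic_expr a b c w x"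
      unfolding elliptic_expr_eq using ptw[of "[]" x] by (intro tendsto_intros Dlim_tendsto) auto
    have "(\<lambda>n. (lam * U n x - elliptic_expr a b c (U n) x) - f x) \<longlonglongrightarrow> 0"
    proof (rule Lim_null_comparison)
      have "lam * U n x - elliptic_expr a b c (U n) x - f x = L (r n) (U n) x - elliptic_expr a b c (U n) x" for n
        using u(2)[OF ad[of n], of x] by (simp add: U_def)
      then show "\<forall>\<^sub>F n in sequentially. norm (lam * U n x - elliptic_expr a b c (U n) x - f x) \<le> K * B * r n"
        unfolding real_norm_def using LU[OF r(1)] by (intro always_eventually allI) (simp only:)
      show "(\<lambda>n. K * B * r n) \<longlonglongrightarrow> 0" using tendsto_mult_right_zero[OF r_lim] by simp
    qed
    then show "(\<lambda>n. lam * U n x - elliptic_expr a b c (U n) x) \<longlonglongrightarrow> f x" by (simp add: LIM_zero_iff)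
  qed
  then show ?thesis using w(1) by blast
qed

theorem dissipativity_estimate:
  assumes lam: "lam > 0" and w: "w \<in> Cb_inf" and G: "\<And>x. \<bar>lam * w x - elliptic_expr a b c w x\<bar> \<le> G"
  shows "\<bar>w x\<bar> \<le> G / lam"
proof -
  have "\<exists>B\<ge>0. \<forall>j x. \<bar>pds [j, j] w x\<bar> \<le> B \<and> \<bar>pds [j, j, j] w x\<bar> \<le> B"
  proof -
    obtain B where B: "\<And>js. B js \<ge> 0" "\<And>js x. \<bar>pds js w x\<bar> \<le> B js"
      using Cb_inf_bound_ex[OF pds_Cb_inf[OF w]] by metis
    define C where "C = (\<Sum>j\<in>UNIV. B [j, j] + B [j, j, j])"
    have "B [j, j] + B [j, j, j] \<le> C" for j
      unfolding C_def using B(1) by (intro member_le_sum[of j UNIV "\<lambda>j. B [j, j] + B [j, j, j]"]) auto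
    then have "B [j, j] \<le> C" "B [j, j, j] \<le> C" for j
      using B(1)[of "[j, j]"] B(1)[of "[j, j, j]"] by (metis add.commute add_increasing2 order_refl order_trans)+
    then have "\<bar>pds [j, j] w x\<bar> \<le> C" "\<bar>pds [j, j, j] w x\<bar> \<le> C" for j x
      using B(2) order_trans by blast+
    moreover have "C \<ge> 0" unfolding C_def using B(1) by (simp add: sum_nonneg)
    ultimately show ?thesis by blast
  qed
  then obtain B where B: "B \<ge> 0" "\<And>j x. \<bar>pds [j, j] w x\<bar> \<le> B" "\<And>j x. \<bar>pds [j, j, j] w x\<bar> \<le> B" by blast
  obtain K where K: "\<And>r x. r > 0 \<Longrightarrow> \<bar>L r w x - elliptic_expr a b c w x\<bar> \<le> K * B * r"
    using L_approx w B(2,3) by blast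
  have "\<bar>w x\<bar> \<le> (G + K * B * r) / lam" if r: "adm r" for r
  proof (rule resolvent_estimate[OF r w lam])
    show "\<bar>lam * w x - L r w x\<bar> \<le> G + K * B * r" for x
      using G[of x] K[of r x] r unfolding adm_def by linarith
  qed
  moreover have "((\<lambda>r. (G + K * B * r) / lam) \<longlongrightarrow> (G + K * B * 0) / lam) (at_right 0)"
    using lam by (intro tendsto_intros) auto
  ultimately show ?thesis
    using eventually_adm by (intro tendsto_lowerbound[where F = "at_right 0"]) (auto elim: eventually_mono)
qed

end

subsection \<open>Mollification\<close>

text \<open>Up to constant factors these are the derivatives of the Poisson kernel
  \<open>1 / (1 + s\<^sup>2) = Im (1 / (s - \<i>))\<close>, and all of them are dominated by it.\<close>

definition poisson :: "nat \<Rightarrow> real \<Rightarrow> real" where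
  "poisson m s = Im (inverse ((complex_of_real s - \<i>) ^ m))"

lemma poisson_1: "poisson 1 s = 1 / (1 + s\<^sup>2)"
  by (simp add: poisson_def power2_eq_square add.commute)

lemma norm_of_real_minus_i: "(norm (complex_of_real s - \<i>))\<^sup>2 = 1 + s\<^sup>2"
  by (simp add: cmod_power2)

text \<open>For m \<ge> 2 the modulus suffices, because norm z \<ge> 1. For m = 1 the modulus decays
  only like 1 / |s|, and the exact imaginary part is taken.\<close>

lemma poisson_bound:
  assumes "m \<ge> 1"
  shows "\<bar>poisson m s\<bar> \<le> 1 / (1 + s\<^sup>2)"
proof (cases "m = 1")
  case True
  then show ?thesis using poisson_1[of s] by simp
next
  case False
  define z where "z = complex_of_real s - \<i>"
  have z2: "(norm z)\<^sup>2 = 1 + s\<^sup>2" unfolding z_def by (rule norm_of_real_minus_i)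
  have "1\<^sup>2 \<le> (norm z)\<^sup>2" unfolding z2 by simp
  then have z1: "1 \<le> norm z" by (rule power2_le_imp_le) simp
  have "\<bar>poisson m s\<bar> \<le> norm (inverse (z ^ m))"
    unfolding poisson_def z_def[symmetric] by (rule abs_Im_le_cmod)
  also have "\<dots> = 1 / norm z ^ m" by (simp add: norm_inverse norm_power divide_inverse)
  also have "\<dots> \<le> 1 / (norm z)\<^sup>2"
    using z1 False assms
    by (intro divide_left_mono power_increasing) (auto intro!: mult_pos_pos zero_less_power)
  finally show ?thesis unfolding z2 .
qed

lemma poisson_deriv:
  "(poisson m has_real_derivative (- real m * poisson (Suc m) s)) (at s)"
proof -
  define z where "z = complex_of_real s - \<i>"
  have z: "z \<noteq> 0" by (simp add: z_def complex_eq_iff)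
  have "((\<lambda>w. inverse ((w - \<i>) ^ m)) has_field_derivative - (of_nat m * inverse (z ^ Suc m))) (at (complex_of_real s))"
  proof (cases m)
    case (Suc k)
    have "((\<lambda>w. inverse ((w - \<i>) ^ m)) has_field_derivative
        - (inverse (z ^ m) * (of_nat m * z ^ (m - 1)) * inverse (z ^ m))) (at (complex_of_real s))"
      unfolding z_def using z
      by (auto intro!: derivative_eq_intros simp: z_def)
    also have "inverse (z ^ m) * (of_nat m * z ^ (m - 1)) * inverse (z ^ m) = of_nat m * inverse (z ^ Suc m)"
      using z Suc by (simp add: field_simps)
    finally show ?thesis .
  qed auto
  from has_vector_derivative_real_field[OF this]
  have "((\<lambda>s. inverse ((complex_of_real s - \<i>) ^ m)) has_vector_derivative
      - (of_nat m * inverse (z ^ Suc m))) (at s)" .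
  from bounded_linear.has_vector_derivative[OF bounded_linear_Im this]
  have "((\<lambda>s. Im (inverse ((complex_of_real s - \<i>) ^ m))) has_real_derivative
      Im (- (of_nat m * inverse (z ^ Suc m)))) (at s)"
    by (simp only: has_real_derivative_iff_has_vector_derivative)
  moreover have "Im (- (of_nat m * w)) = - real m * Im w" for w by simp
  ultimately show ?thesis unfolding poisson_def z_def by simp
qed

text \<open>The remainder carries the integrable weight at the unshifted point \<open>s\<close>, so
  it can be integrated against a bounded function.\<close>

lemma poisson_taylor:
  assumes "m \<ge> 1" "\<bar>t\<bar> \<le> R"
  shows "\<bar>poisson m (s - t) - poisson m s - t * (real m * poisson (Suc m) s)\<bar>
      \<le> real m * real (Suc m) * (2 * (1 + R\<^sup>2)) * t\<^sup>2 * (1 / (1 + s\<^sup>2))"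
proof -
  have "\<bar>poisson m (s + - t) - poisson m s - (- t) * (- real m * poisson (Suc m) s)\<bar>
      \<le> (real m * real (Suc m) * (2 * (1 + R\<^sup>2)) * (1 / (1 + s\<^sup>2))) * (- t)\<^sup>2"
  proof (rule real_taylor_bound[where f'' = "\<lambda>s. - real m * (- real (Suc m) * poisson (Suc (Suc m)) s)"])
    show "(poisson m has_real_derivative - real m * poisson (Suc m) s) (at s)" for s
      by (rule poisson_deriv)
    show "((\<lambda>s. - real m * poisson (Suc m) s) has_real_derivative
        - real m * (- real (Suc m) * poisson (Suc (Suc m)) s)) (at s)" for s
      by (rule DERIV_cmult[OF poisson_deriv])
    fix y assume y: "\<bar>y\<bar> \<le> \<bar>- t\<bar>"
    have "y\<^sup>2 \<le> R\<^sup>2" using y assms(2) by (intro abs_le_square_iff[THEN iffD1]) auto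
    \<comment> \<open>Peetre's inequality, which compares the weights at \<open>s\<close> and at
      \<open>s + y\<close>.\<close>
    have "1 + s\<^sup>2 \<le> 2 * (1 + y\<^sup>2) * (1 + (s + y)\<^sup>2)"
    proof -
      have "s\<^sup>2 \<le> 2 * (s + y)\<^sup>2 + 2 * y\<^sup>2"
        using zero_le_power2[of "s + 2 * y"] by (simp add: power2_eq_square algebra_simps)
      moreover have "0 \<le> y\<^sup>2 * (s + y)\<^sup>2" by simp
      moreover have "2 * (1 + p) * (1 + q) = 2 + 2 * p + 2 * q + 2 * (p * q)" for p q :: real
        by (simp add: algebra_simps)
      ultimately show ?thesis by (smt (verit))
    qed
    also have "\<dots> \<le> 2 * (1 + R\<^sup>2) * (1 + (s + y)\<^sup>2)"
      using \<open>y\<^sup>2 \<le> R\<^sup>2\<close> by (intro mult_right_mono) auto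
    finally have le: "1 / (1 + (s + y)\<^sup>2) \<le> (2 * (1 + R\<^sup>2)) * (1 / (1 + s\<^sup>2))"
      using add_pos_nonneg[OF zero_less_one zero_le_power2[of s]]
        add_pos_nonneg[OF zero_less_one zero_le_power2[of "s + y"]]
      by (simp add: divide_le_eq mult.commute pos_le_divide_eq)
    have "\<bar>poisson (Suc (Suc m)) (s + y)\<bar> \<le> (2 * (1 + R\<^sup>2)) * (1 / (1 + s\<^sup>2))"
      by (rule order_trans[OF poisson_bound le]) simp
    from mult_left_mono[OF this, of "real m * real (Suc m)"]
    show "\<bar>- real m * (- real (Suc m) * poisson (Suc (Suc m)) (s + y))\<bar>
        \<le> real m * real (Suc m) * (2 * (1 + R\<^sup>2)) * (1 / (1 + s\<^sup>2))"
      by (simp add: abs_mult mult.assoc del: of_nat_Suc)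
  qed
  then show ?thesis by (simp add: mult_ac del: of_nat_Suc)
qed

section \<open>Convolution with the Poisson kernel along one axis\<close>

lemma einterval_UNIV: "einterval (- \<infinity>) \<infinity> = (UNIV :: real set)"
  by (auto simp: einterval_def)

lemma cauchy_density:
  "integrable lborel (\<lambda>s :: real. 1 / (1 + s\<^sup>2))" "(\<integral>s. 1 / (1 + s\<^sup>2) \<partial>lborel) = pi"
  using integrable_inverse_1_plus_square LBINT_inverse_1_plus_square
  by (simp_all add: einterval_UNIV set_integrable_def interval_lebesgue_integral_def
      set_lebesgue_integral_def divide_inverse)

definition pconv :: "real \<Rightarrow> 'd::finite \<Rightarrow> nat \<Rightarrow> (real^'d \<Rightarrow> real) \<Rightarrow> real^'d \<Rightarrow> real" where
  "pconv r j m f x = (\<integral>s. poisson m s * f (along j x (r * s)) \<partial>lborel)"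

lemma poisson_measurable [measurable]: "poisson m \<in> borel_measurable borel"
proof (rule borel_measurable_continuous_onI)
  show "continuous_on UNIV (poisson m)"
    by (rule DERIV_continuous_on[of _ _ "\<lambda>s. - real m * poisson (Suc m) s"])
      (use poisson_deriv has_field_derivative_at_within in blast)
qed

lemma kernel_integral:
  fixes k g :: "real \<Rightarrow> real"
  assumes [measurable]: "k \<in> borel_measurable borel" "g \<in> borel_measurable borel"
    and k: "\<And>s. \<bar>k s\<bar> \<le> C * (1 / (1 + s\<^sup>2))" and g: "\<And>s. \<bar>g s\<bar> \<le> B"
  shows "integrable lborel (\<lambda>s. k s * g s)" "\<bar>\<integral>s. k s * g s \<partial>lborel\<bar> \<le> C * B * pi"
proof -
  have bd: "\<bar>k s * g s\<bar> \<le> C * B * (1 / (1 + s\<^sup>2))" for s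
  proof -
    have "\<bar>k s\<bar> * \<bar>g s\<bar> \<le> (C * (1 / (1 + s\<^sup>2))) * B" by (intro mult_mono' k g) auto
    then show ?thesis by (simp add: abs_mult mult_ac)
  qed
  have int: "integrable lborel (\<lambda>s. C * B * (1 / (1 + s\<^sup>2)))"
    using cauchy_density(1) by (rule integrable_mult_right)
  show i: "integrable lborel (\<lambda>s. k s * g s)"
    by (rule Bochner_Integration.integrable_bound[OF int]) (auto intro!: AE_I2 order_trans[OF bd abs_ge_self] simp del: times_divide_eq_right)
  have "norm (\<integral>s. k s * g s \<partial>lborel) \<le> (\<integral>s. C * B * (1 / (1 + s\<^sup>2)) \<partial>lborel)"
    by (rule Bochner_Integration.integral_norm_bound_integral[OF i int]) (use bd in simp)
  also have "\<dots> = C * B * pi"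
    using cauchy_density(2) by (simp only: integral_mult_right_zero)
  finally show "\<bar>\<integral>s. k s * g s \<partial>lborel\<bar> \<le> C * B * pi" by simp
qed

lemma poisson_integral:
  assumes "m \<ge> 1" "g \<in> borel_measurable borel" "\<And>s. \<bar>g s\<bar> \<le> B"
  shows "integrable lborel (\<lambda>s. poisson m s * g s)" "\<bar>\<integral>s. poisson m s * g s \<partial>lborel\<bar> \<le> B * pi"
  using kernel_integral[of "poisson m" g 1 B] assms poisson_bound[of m] by simp_all

lemma line_measurable:
  fixes f :: "real^'d::finite \<Rightarrow> real"
  assumes "continuous_on UNIV f"
  shows "(\<lambda>s. f (along j x (r * s))) \<in> borel_measurable borel"
  by (rule borel_measurable_continuous_onI)
    (auto intro!: continuous_on_compose2[OF assms] continuous_intros)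

text \<open>The mollification acts on one coordinate at a time, hence the set \<open>S\<close> of directions.\<close>

definition smooth_class :: "'d::finite set \<Rightarrow> (real^'d \<Rightarrow> real) set \<Rightarrow> bool" where
  "smooth_class S X \<longleftrightarrow> (\<forall>g\<in>X. bounded (range g) \<and> uniformly_continuous_on UNIV g \<and>
     (\<forall>j\<in>S. \<exists>h\<in>X. quad_taylor j g h))"

lemma smooth_class_UNIV:
  assumes "smooth_class UNIV X" "f \<in> X"
  shows "f \<in> Cb_inf"
  using assms
  by (intro Cb_inf_criterion[of f X]) (auto simp: smooth_class_def intro: uniformly_continuous_imp_continuous)

text \<open>In direction \<open>j\<close> the derivative falls on the kernel, which raises
  \<open>m\<close> by one and brings a factor m / r; in the other directions of \<open>S\<close> it
  falls on \<open>g\<close>. The constants c in the new class collect these factors.\<close>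

lemma smooth_class_pconv:
  assumes X: "smooth_class S X" and r: "r > 0"
  shows "smooth_class (insert j S) {\<lambda>x. c * pconv r j m g x | c m g. m \<ge> 1 \<and> g \<in> X}" (is "smooth_class _ ?Y")
proof -
  have cont: "continuous_on UNIV g" if "g \<in> X" for g
    using X that by (auto simp: smooth_class_def intro: uniformly_continuous_imp_continuous)
  have bnd: "\<exists>B. \<forall>x. \<bar>g x\<bar> \<le> B" if "g \<in> X" for g
    using X that by (auto simp: smooth_class_def bounded_iff)
  have lin: "pconv r j m g x - pconv r j m g y - t * pconv r j m h z =
      (\<integral>s. poisson m s * (g (along j x (r * s)) - g (along j y (r * s)) - t * h (along j z (r * s))) \<partial>lborel)"
    if m: "m \<ge> 1" and g: "g \<in> X" and h: "h \<in> X" for m g h x y z t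
  proof -
    have i: "integrable lborel (\<lambda>s. poisson m s * g (along j x (r * s)))" if g: "g \<in> X" for g x
    proof -
      obtain B where B: "\<And>x. \<bar>g x\<bar> \<le> B" using bnd[OF g] by blast
      show ?thesis
        by (rule poisson_integral(1)[OF m line_measurable[OF cont[OF g]] B])
    qed
    show ?thesis
      unfolding pconv_def right_diff_distrib mult.left_commute[of _ t]
      by (simp add: i g h)
  qed
  show ?thesis
    unfolding smooth_class_def
  proof (intro ballI)
    fix u assume "u \<in> ?Y"
    then obtain c m g where m: "m \<ge> 1" and g: "g \<in> X" and u: "u = (\<lambda>x. c * pconv r j m g x)" by blast
    obtain B where B: "\<And>x. \<bar>g x\<bar> \<le> B" using bnd[OF g] by blast
    have "\<bar>pconv r j m g x\<bar> \<le> B * pi" for x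
      unfolding pconv_def by (rule poisson_integral(2)[OF m line_measurable[OF cont[OF g]] B])
    then have "\<bar>u x\<bar> \<le> \<bar>c\<bar> * (B * pi)" for x
      unfolding u abs_mult by (intro mult_left_mono) auto
    then have 1: "bounded (range u)" by (auto simp: bounded_iff)
    have 2: "uniformly_continuous_on UNIV (pconv r j m g)"
      unfolding uniformly_continuous_on_def
    proof (intro allI impI)
      fix e :: real assume e: "e > 0"
      have "uniformly_continuous_on UNIV g" using X g by (simp add: smooth_class_def)
      then obtain d where d: "d > 0" "\<And>x y. dist y x < d \<Longrightarrow> dist (g y) (g x) < e / (2 * pi)"
        unfolding uniformly_continuous_on_def using e by (metis UNIV_I divide_pos_pos mult_pos_pos pi_gt_zero zero_less_numeral)
      have "dist (pconv r j m g y) (pconv r j m g x) < e" if "dist y x < d" for x y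
      proof -
        \<comment> \<open>The term with the factor 0 brings the difference into the three-term shape
          of \<open>lin\<close>.\<close>
        have meas: "(\<lambda>s. g (along j y (r * s)) - g (along j x (r * s)) - 0 * g (along j y (r * s))) \<in> borel_measurable borel"
          by (intro borel_measurable_diff borel_measurable_times borel_measurable_const line_measurable cont g)
        have "\<bar>pconv r j m g y - pconv r j m g x - 0 * pconv r j m g y\<bar> \<le> e / (2 * pi) * pi"
          unfolding lin[OF m g g]
          using d(2)[of "y + _" "x + _"] that
          by (intro poisson_integral(2) m meas) (simp add: dist_norm less_imp_le)
        then show ?thesis using e by (simp add: dist_real_def)
      qed
      then show "\<exists>d>0. \<forall>x\<in>UNIV. \<forall>y\<in>UNIV. dist y x < d \<longrightarrow> dist (pconv r j m g y) (pconv r j m g x) < e"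
        using d(1) by blast
    qed
    have 2: "uniformly_continuous_on UNIV u"
      using uniformly_continuous_on_cmul[OF 2, of c] by (simp add: u)
    have 3: "\<exists>h\<in>?Y. quad_taylor i u h" if i: "i \<in> insert j S" for i
    proof -
      have "\<exists>c' m' h B. m' \<ge> 1 \<and> h \<in> X \<and>
        (\<forall>x t. \<bar>t\<bar> \<le> 1 \<longrightarrow> \<bar>pconv r j m g (along i x t) - pconv r j m g x - t * (c' * pconv r j m' h x)\<bar> \<le> B * t\<^sup>2)"
      proof (cases "i = j")
        case True
        \<comment> \<open>Moving \<open>x\<close> by \<open>t\<close> along the axis shifts the
          kernel variable by t / r, which \<open>R\<close> bounds for |t| \<le> 1.\<close>
        define R where "R = 1 / r"
        define C where "C = real m * real (Suc m) * (2 * (1 + R\<^sup>2))"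
        have "\<bar>pconv r j m g (along i x t) - pconv r j m g x - t * (real m / r * pconv r j (Suc m) g x)\<bar>
            \<le> (C * B * pi / r\<^sup>2) * t\<^sup>2" if t: "\<bar>t\<bar> \<le> 1" for x t
        proof -
          define y where "y = t / r"
          have y: "\<bar>y\<bar> \<le> R" using t r by (simp add: y_def R_def divide_right_mono)
          have "pconv r j m g (along i x t) = (\<integral>s. poisson m (s - y) * g (along j x (r * s)) \<partial>lborel)"
          proof -
            have "(\<integral>s. poisson m (s - y) * g (along j x (r * s)) \<partial>lborel) =
                (\<integral>s. poisson m (y + 1 * s - y) * g (x + (r * (y + 1 * s)) *\<^sub>R ax j) \<partial>lborel)"
              using lborel_integral_real_affine[of 1 "\<lambda>s. poisson m (s - y) * g (along j x (r * s))" y] by simp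
            also have "\<dots> = pconv r j m g (along i x t)"
              unfolding pconv_def y_def True using r by (simp add: algebra_simps)
            finally show ?thesis by simp
          qed
          moreover have "integrable lborel (\<lambda>s. poisson k s * g (along j x (r * s)))" if "k \<ge> 1" for k
            by (rule poisson_integral(1)[OF that line_measurable[OF cont[OF g]] B])
          moreover have "integrable lborel (\<lambda>s. poisson m (s - y) * g (along j x (r * s)))"
          proof -
            have "integrable lborel (\<lambda>s. poisson m s * g ((along j x t) + (r * s) *\<^sub>R ax j))"
              by (rule poisson_integral(1)[OF m line_measurable[OF cont[OF g]] B])
            then have "integrable lborel (\<lambda>s. poisson m (- y + 1 * s) * g ((along j x t) + (r * (- y + 1 * s)) *\<^sub>R ax j))"
              by (rule lborel_integrable_real_affine) simp
            then show ?thesis unfolding y_def using r by (simp add: algebra_simps)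
          qed
          ultimately have "pconv r j m g (along i x t) - pconv r j m g x - t * (real m / r * pconv r j (Suc m) g x) =
            (\<integral>s. (poisson m (s - y) - poisson m s - y * (real m * poisson (Suc m) s)) * g (along j x (r * s)) \<partial>lborel)"
            using m unfolding pconv_def[of r j m g x] pconv_def[of r j "Suc m" g x]
            by (simp add: left_diff_distrib mult.assoc) (simp add: y_def)
          also have "\<bar>\<dots>\<bar> \<le> C * y\<^sup>2 * B * pi"
            by (rule kernel_integral(2)[OF _ line_measurable[OF cont[OF g]] _ B])
              (use poisson_taylor[OF m y] in \<open>auto simp: C_def\<close>)
          also have "\<dots> = (C * B * pi / r\<^sup>2) * t\<^sup>2" by (simp add: y_def power_divide)
          finally show ?thesis .
        qed
        note est' = this
        show ?thesis
          by (rule exI[of _ "real m / r"], rule exI[of _ "Suc m"], rule exI[of _ g],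
              rule exI[of _ "C * B * pi / r\<^sup>2"]) (intro conjI allI impI g est', simp_all)
      next
        case False
        then have "i \<in> S" using i by simp
        then obtain h B where h: "h \<in> X" "\<And>x t. \<bar>t\<bar> \<le> 1 \<Longrightarrow> \<bar>g (along i x t) - g x - t * h x\<bar> \<le> B * t\<^sup>2"
          using X g unfolding smooth_class_def by blast
        have "\<bar>pconv r j m g (along i x t) - pconv r j m g x - t * (1 * pconv r j m h x)\<bar> \<le> (B * pi) * t\<^sup>2"
          if t: "\<bar>t\<bar> \<le> 1" for x t
        proof -
          have "pconv r j m g (along i x t) - pconv r j m g x - t * pconv r j m h x =
            (\<integral>s. poisson m s * (g (along i x t + (r * s) *\<^sub>R ax j) - g (along j x (r * s))
               - t * h (along j x (r * s))) \<partial>lborel)"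
            by (rule lin[OF m g h(1)])
          also have "\<bar>\<dots>\<bar> \<le> (B * t\<^sup>2) * pi"
          proof (rule poisson_integral(2)[OF m])
            show "\<bar>g (along i x t + (r * s) *\<^sub>R ax j) - g (along j x (r * s))
               - t * h (along j x (r * s))\<bar> \<le> B * t\<^sup>2" for s
              using h(2)[OF t, of "along j x (r * s)"] by (simp add: add_ac)
          qed (intro borel_measurable_diff borel_measurable_times borel_measurable_const line_measurable cont g h)
          finally show ?thesis by (simp add: mult_ac)
        qed
        note est' = this
        show ?thesis
          by (rule exI[of _ 1], rule exI[of _ m], rule exI[of _ h], rule exI[of _ "B * pi"]) (intro conjI allI impI h(1) m est')
      qed
      then obtain c' m' h B where h: "m' \<ge> 1" "h \<in> X"
        "\<And>x t. \<bar>t\<bar> \<le> 1 \<Longrightarrow> \<bar>pconv r j m g (along i x t) - pconv r j m g x - t * (c' * pconv r j m' h x)\<bar> \<le> B * t\<^sup>2"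
        by blast
      have "\<bar>u (along i x t) - u x - t * ((c * c') * pconv r j m' h x)\<bar> \<le> (\<bar>c\<bar> * B) * t\<^sup>2" if "\<bar>t\<bar> \<le> 1" for x t
      proof -
        have "u (along i x t) - u x - t * ((c * c') * pconv r j m' h x) =
            c * (pconv r j m g (along i x t) - pconv r j m g x - t * (c' * pconv r j m' h x))"
          by (simp add: u algebra_simps)
        then show ?thesis
          using mult_left_mono[OF h(3)[OF that], of "\<bar>c\<bar>" x] by (simp add: abs_mult mult.assoc)
      qed
      then show ?thesis
        using h(1,2) by (intro bexI[of _ "\<lambda>x. (c * c') * pconv r j m' h x"] exI) auto
    qed
    show "bounded (range u) \<and> uniformly_continuous_on UNIV u \<and>
      (\<forall>i\<in>insert j S. \<exists>h\<in>?Y. quad_taylor i u h)"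
      using 1 2 3 by blast
  qed
qed

lemma pconv_approx:
  fixes f :: "real^'d::finite \<Rightarrow> real"
  assumes bd: "bounded (range f)" and uc: "uniformly_continuous_on UNIV f" and e: "e > 0"
  shows "\<exists>r>0. \<forall>x. \<bar>1 / pi * pconv r j 1 f x - f x\<bar> \<le> e"
proof -
  obtain B where B: "\<And>x. \<bar>f x\<bar> \<le> B" using bd by (auto simp: bounded_iff)
  have B0: "B \<ge> 0" using order_trans[OF abs_ge_zero B] .
  have cont: "continuous_on UNIV f" by (rule uniformly_continuous_imp_continuous[OF uc])
  obtain d where d: "d > 0" "\<And>x y. dist y x < d \<Longrightarrow> dist (f y) (f x) < e / 2"
    using uc e unfolding uniformly_continuous_on_def by (metis UNIV_I half_gt_zero)
  define tail where "tail n s = indicator {s. real n \<le> \<bar>s\<bar>} s * (1 / (1 + s\<^sup>2))" for n and s :: real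
  have tail_int: "integrable lborel (tail n)" for n
    unfolding tail_def by (rule Bochner_Integration.integrable_bound[OF cauchy_density(1)]) (auto simp: indicator_def)
  have "(\<lambda>n. \<integral>s. tail n s \<partial>lborel) \<longlonglongrightarrow> (\<integral>s. 0 \<partial>(lborel :: real measure))"
  proof (rule integral_dominated_convergence[where w = "\<lambda>s. 1 / (1 + s\<^sup>2)"])
    show "AE s in lborel. (\<lambda>n. tail n s) \<longlonglongrightarrow> 0"
    proof (rule AE_I2)
      fix s :: real
      obtain N where N: "\<bar>s\<bar> < real N" using reals_Archimedean2 by blast
      have "\<forall>\<^sub>F n in sequentially. tail n s = 0"
        unfolding eventually_sequentially tail_def
        by (rule exI[of _ N]) (use N in \<open>auto simp: indicator_def\<close>)
      then show "(\<lambda>n. tail n s) \<longlonglongrightarrow> 0" by (rule tendsto_eventually)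
    qed
    show "tail n \<in> borel_measurable lborel" for n using tail_int by (rule borel_measurable_integrable)
    show "AE s in lborel. norm (tail n s) \<le> 1 / (1 + s\<^sup>2)" for n
      by (rule AE_I2) (auto simp: tail_def indicator_def)
  qed (simp_all add: cauchy_density)
  \<comment> \<open>Times 2 B this stays below e pi / 2. The part near the origin contributes the
    other e pi / 2, and the normalization divides by pi.\<close>
  then have "\<forall>\<^sub>F n in sequentially. (\<integral>s. tail n s \<partial>lborel) < e * pi / (4 * (B + 1))"
    using e B0 by (intro order_tendstoD) auto
  then obtain n where n: "(\<integral>s. tail n s \<partial>lborel) < e * pi / (4 * (B + 1))"
    unfolding eventually_sequentially by blast
  \<comment> \<open>For |s| < n this gives r |s| < d, within the modulus of continuity of
    \<open>f\<close>.\<close>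
  define r where "r = d / (real n + 1)"
  have r: "r > 0" using d(1) by (simp add: r_def)
  have "\<bar>1 / pi * pconv r j 1 f x - f x\<bar> \<le> e" for x
  proof -
    let ?g = "\<lambda>s. f (along j x (r * s)) - f x"
    have i1: "integrable lborel (\<lambda>s. poisson 1 s * f (along j x (r * s)))"
      by (rule poisson_integral(1)[OF order_refl line_measurable[OF cont] B])
    have i2: "integrable lborel (\<lambda>s. poisson 1 s * f x)"
      by (rule poisson_integral(1)[OF order_refl _ B]) simp
    have "(\<integral>s. poisson 1 s * f x \<partial>lborel) = pi * f x"
      unfolding poisson_1 integral_mult_left_zero cauchy_density(2) ..
    then have eq: "pconv r j 1 f x - pi * f x = (\<integral>s. poisson 1 s * ?g s \<partial>lborel)"
      unfolding pconv_def right_diff_distrib Bochner_Integration.integral_diff[OF i1 i2] by (simp only:)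
    have int: "integrable lborel (\<lambda>s. poisson 1 s * ?g s)"
      unfolding right_diff_distrib by (rule Bochner_Integration.integrable_diff[OF i1 i2])
    have bd: "\<bar>poisson 1 s * ?g s\<bar> \<le> e / 2 * (1 / (1 + s\<^sup>2)) + 2 * B * tail n s" for s
    proof -
      define w where "w = 1 / (1 + s\<^sup>2)"
      have w: "w \<ge> 0" by (simp add: w_def)
      have pg: "\<bar>poisson 1 s * ?g s\<bar> = \<bar>?g s\<bar> * w"
        unfolding abs_mult poisson_1 w_def by simp
      show ?thesis
      proof (cases "real n \<le> \<bar>s\<bar>")
        case True
        have "\<bar>?g s\<bar> \<le> 2 * B" using B[of x] B[of "along j x (r * s)"] by linarith
        then have "\<bar>?g s\<bar> * w \<le> 2 * B * w" using w by (rule mult_right_mono)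
        moreover have "0 \<le> e / 2 * w" using e w by simp
        moreover have "tail n s = w" using True by (simp add: tail_def w_def)
        ultimately show ?thesis unfolding pg w_def[symmetric] by simp
      next
        case False
        have "r * \<bar>s\<bar> \<le> r * real n" using False r by (intro mult_left_mono) auto
        also have "r * real n < d" using d(1) by (simp add: r_def field_simps)
        finally have "dist (along j x (r * s)) x < d" using r by (simp add: dist_norm abs_mult)
        then have "\<bar>?g s\<bar> \<le> e / 2" using d(2) by (simp add: dist_real_def less_imp_le)
        then have "\<bar>?g s\<bar> * w \<le> e / 2 * w" using w by (rule mult_right_mono)
        moreover have "tail n s = 0" using False by (simp add: tail_def)
        ultimately show ?thesis unfolding pg w_def[symmetric] by simp
      qed
    qed
    have i3: "integrable lborel (\<lambda>s. e / 2 * (1 / (1 + s\<^sup>2)))" "integrable lborel (\<lambda>s. 2 * B * tail n s)"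
      by (intro integrable_mult_right cauchy_density tail_int)+
    have "norm (\<integral>s. poisson 1 s * ?g s \<partial>lborel) \<le> (\<integral>s. e / 2 * (1 / (1 + s\<^sup>2)) + 2 * B * tail n s \<partial>lborel)"
      by (rule Bochner_Integration.integral_norm_bound_integral[OF int Bochner_Integration.integrable_add[OF i3]])
        (unfold real_norm_def, rule bd)
    also have "\<dots> = e / 2 * pi + 2 * B * (\<integral>s. tail n s \<partial>lborel)"
      unfolding Bochner_Integration.integral_add[OF i3] integral_mult_right_zero cauchy_density(2) ..
    also have "2 * B * (\<integral>s. tail n s \<partial>lborel) \<le> 2 * B * (e * pi / (4 * (B + 1)))"
      using n B0 by (intro mult_left_mono) auto
    also have "\<dots> = e / 2 * pi * (B / (B + 1))" using B0 by (simp add: field_simps)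
    also have "\<dots> \<le> e / 2 * pi * 1" using e B0 by (intro mult_left_mono) auto
    finally have "\<bar>pconv r j 1 f x - pi * f x\<bar> \<le> pi * e" unfolding eq by (simp add: mult_ac)
    moreover have "1 / pi * pconv r j 1 f x - f x = (pconv r j 1 f x - pi * f x) / pi"
      by (simp add: field_simps)
    ultimately show ?thesis by (simp add: divide_le_eq mult.commute)
  qed
  then show ?thesis using r by blast
qed

text \<open>Smoothness is gained one direction at a time, half of the error being reserved for the
  new direction; only one-dimensional integrals occur.\<close>

theorem Cb_inf_dense:
  fixes f :: "real^'d::finite \<Rightarrow> real"
  assumes "bounded (range f)" "uniformly_continuous_on UNIV f" "e > 0"
  shows "\<exists>g\<in>Cb_inf. \<forall>x. \<bar>g x - f x\<bar> \<le> e"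
proof -
  have "\<exists>X g. smooth_class S X \<and> g \<in> X \<and> (\<forall>x. \<bar>g x - f x\<bar> \<le> e)" if "e > 0" for S :: "'d set" and e
    using finite[of S] that
  proof (induction S arbitrary: e rule: finite_induct)
    case empty
    then show ?case using assms by (intro exI[of _ "{f}"] exI[of _ f]) (auto simp: smooth_class_def)
  next
    case (insert j S)
    then obtain X g where X: "smooth_class S X" "g \<in> X" "\<And>x. \<bar>g x - f x\<bar> \<le> e / 2"
      by (meson half_gt_zero)
    then obtain r where r: "r > 0" "\<And>x. \<bar>1 / pi * pconv r j 1 g x - g x\<bar> \<le> e / 2"
      using pconv_approx[of g "e / 2" j] insert.prems by (auto simp: smooth_class_def)
    define h where "h = (\<lambda>x. 1 / pi * pconv r j 1 g x)"
    have "h \<in> {\<lambda>x. c * pconv r j m g x | c m g. m \<ge> 1 \<and> g \<in> X}"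
      unfolding h_def using X(2) by blast
    moreover have "\<bar>h x - f x\<bar> \<le> e" for x
      using r(2)[of x] X(3)[of x] unfolding h_def by linarith
    ultimately show ?case using smooth_class_pconv[OF X(1) r(1), of j] by blast
  qed
  from this[OF assms(3), of UNIV] show ?thesis using smooth_class_UNIV by blast
qed

subsection \<open>The elliptic operator\<close>

text \<open>The operator algebra and \<open>max_dissipative\<close> ask for this sort. Small
  multiples of the constant function 1 give distinct points near any \<open>f\<close>.\<close>

instance ucb :: (metric_space) perfect_space
proof
  fix f :: "'a ucb"
  define one :: "'a ucb" where "one = Ucb (\<lambda>_. 1)"
  have one: "apply_ucb one x = 1" for x
    unfolding one_def by (simp add: Ucb_inverse uniformly_continuous_on_const)
  have "norm one = 1"
    unfolding norm_ucb_def one by simp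
  show "\<not> open {f}"
  proof
    assume "open {f}"
    then obtain e where e: "e > 0" "ball f e \<subseteq> {f}"
      by (meson insertI1 open_contains_ball)
    have "dist f (f + (e / 2) *\<^sub>R one) = e / 2"
      using e(1) \<open>norm one = 1\<close> by (simp add: dist_norm)
    then have "f + (e / 2) *\<^sub>R one \<in> ball f e" using e(1) by simp
    then have "(e / 2) *\<^sub>R one = 0" using e(2) by auto
    then show False using e(1) \<open>norm one = 1\<close> by (metis less_numeral_extra(3) half_gt_zero norm_zero scaleR_eq_0_iff zero_neq_one)
  qed
qed

lemma Cb_inf_dense_ucb:
  fixes z :: "(real^'d::finite) ucb"
  assumes "e > 0"
  shows "\<exists>g\<in>Cb_inf. norm (Ucb g - z) \<le> e"
proof -
  obtain g where g: "g \<in> Cb_inf" "\<And>x. \<bar>g x - apply_ucb z x\<bar> \<le> e"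
    using Cb_inf_dense[of "apply_ucb z" e] apply_ucb[of z] assms by auto
  have "norm (Ucb g - z) \<le> e"
    by (rule norm_ucb_le) (simp add: apply_Ucb_Cb_inf g)
  then show ?thesis using g(1) by blast
qed

context elliptic
begin

abbreviation H :: "((real^'d) ucb \<times> (real^'d) ucb) set" where "H \<equiv> elliptic_operator a b c"

lemmas H_iff = elliptic_operator_iff[OF a b c]

lemma elliptic_expr_add:
  assumes "f \<in> Cb_inf" "g \<in> Cb_inf"
  shows "elliptic_expr a b c (\<lambda>x. f x + g x) x = elliptic_expr a b c f x + elliptic_expr a b c g x"
proof -
  have "Dlim m (\<lambda>x. f x + g x) x = Dlim m f x + Dlim m g x" for m
    by (cases m rule: Dop_cases) (simp_all add: partial_deriv_Cb_add assms Cb_infD(3))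
  then show ?thesis unfolding elliptic_expr_eq by (simp add: distrib_left sum.distrib)
qed

lemma elliptic_expr_cmult:
  assumes "f \<in> Cb_inf"
  shows "elliptic_expr a b c (\<lambda>x. r * f x) x = r * elliptic_expr a b c f x"
proof -
  have "Dlim m (\<lambda>x. r * f x) x = r * Dlim m f x" for m
    by (cases m rule: Dop_cases) (simp_all add: partial_deriv_cmult assms Cb_infD(3))
  then show ?thesis unfolding elliptic_expr_eq by (simp add: sum_distrib_left mult.left_commute)
qed

lemma linear_H: "linear_operator H"
  unfolding linear_operator_def
proof
  show "single_valued H"
    by (rule single_valuedI) (auto simp: H_iff apply_ucb_inject[symmetric])
  show "subspace H"
  proof (rule subspaceI)
    show "0 \<in> H"
      using elliptic_expr_cmult[OF Cb_inf_const[of 0], of 0]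
      by (simp add: zero_prod_def H_iff Cb_inf_const fun_eq_iff)
  next
    fix z w assume "z \<in> H" "w \<in> H"
    then show "z + w \<in> H"
      by (cases z; cases w) (simp add: H_iff elliptic_expr_add Cb_inf_add fun_eq_iff)
  next
    fix r z assume "z \<in> H"
    then show "r *\<^sub>R z \<in> H"
      by (cases z) (simp add: H_iff elliptic_expr_cmult Cb_inf_cmult fun_eq_iff)
  qed
qed

lemma dissipative_H: "dissipative H"
  unfolding dissipative_def
proof (intro conjI linear_H allI impI ballI, clarify)
  fix lam :: real and f g assume lam: "lam > 0" and "(f, g) \<in> H"
  then have f: "apply_ucb f \<in> Cb_inf" and g: "apply_ucb g = elliptic_expr a b c (apply_ucb f)"
    by (auto simp: H_iff)
  have "norm f \<le> norm (lam *\<^sub>R f - g) / lam"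
  proof (rule norm_ucb_le)
    fix x
    show "\<bar>apply_ucb f x\<bar> \<le> norm (lam *\<^sub>R f - g) / lam"
    proof (rule dissipativity_estimate[OF lam f])
      show "\<bar>lam * apply_ucb f x - elliptic_expr a b c (apply_ucb f) x\<bar> \<le> norm (lam *\<^sub>R f - g)" for x
        using abs_apply_ucb_le[of "lam *\<^sub>R f - g" x] by (simp add: g)
    qed
  qed
  then show "lam * norm f \<le> norm (lam *\<^sub>R f - g)" using lam by (simp add: field_simps)
qed

lemma dense_domain_H: "closure (Domain H) = UNIV"
proof (intro equalityI subset_UNIV subsetI)
  fix z :: "(real^'d) ucb"
  show "z \<in> closure (Domain H)"
    unfolding closure_approachable
  proof (intro allI impI)
    fix e :: real assume "e > 0"
    then obtain g where g: "g \<in> Cb_inf" "norm (Ucb g - z) \<le> e / 2"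
      using Cb_inf_dense_ucb[of "e / 2" z] by auto
    then show "\<exists>y\<in>Domain H. dist y z < e"
      using \<open>e > 0\<close>
      by (intro bexI[of _ "Ucb g"]) (auto simp: Domain_elliptic_operator apply_Ucb_Cb_inf dist_norm)
  qed
qed

text \<open>Smooth right-hand sides are solved exactly, and they are dense.\<close>

lemma dense_range_H:
  assumes lam: "lam > 0"
  shows "closure ((\<lambda>(x, y). lam *\<^sub>R x - y) ` H) = UNIV"
proof (intro equalityI subset_UNIV subsetI)
  fix z :: "(real^'d) ucb"
  show "z \<in> closure ((\<lambda>(x, y). lam *\<^sub>R x - y) ` H)"
    unfolding closure_approachable
  proof (intro allI impI)
    fix e :: real assume "e > 0"
    then obtain g where g: "g \<in> Cb_inf" "norm (Ucb g - z) \<le> e / 2"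
      using Cb_inf_dense_ucb[of "e / 2" z] by auto
    obtain w where w: "w \<in> Cb_inf" "\<And>x. lam * w x - elliptic_expr a b c w x = g x"
      using smooth_solvability[OF lam g(1)] by blast
    have E: "elliptic_expr a b c w \<in> Cb_inf" by (intro elliptic_expr_Cb_inf a b c w)
    have "(Ucb w, Ucb (elliptic_expr a b c w)) \<in> H"
      by (simp add: H_iff apply_Ucb_Cb_inf w(1) E)
    moreover have "lam *\<^sub>R Ucb w - Ucb (elliptic_expr a b c w) = Ucb g"
      by (rule ucb_eqI) (simp add: apply_Ucb_Cb_inf w E g)
    ultimately have "Ucb g \<in> (\<lambda>(x, y). lam *\<^sub>R x - y) ` H" by force
    then show "\<exists>y\<in>(\<lambda>(x, y). lam *\<^sub>R x - y) ` H. dist y z < e"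
      using g(2) \<open>e > 0\<close> by (intro bexI[of _ "Ucb g"]) (auto simp: dist_norm)
  qed
qed

lemma max_dissipative_closure: "max_dissipative (closure H)"
proof
  show "dissipative (closure H)"
    by (rule dissipative_closure[OF dissipative_H dense_domain_H])
  show "\<exists>x y. (x, y) \<in> closure H \<and> lam *\<^sub>R x - y = z" if "lam > 0" for lam z
    by (rule dissipative_closure_range[OF dissipative_H that dense_range_H[OF that]])
  show "closure (Domain (closure H)) = UNIV"
    using closure_mono[OF Domain_mono[OF closure_subset[of H]]] dense_domain_H by auto
qed

end

text \<open>The last clause speaks of every C0-semigroup generated by the closure, so that the
  notation for the semigroup hides no choice; the clause before it provides one.\<close>

theorem lemma2:
  fixes a b :: "'d::finite \<Rightarrow> real^'d \<Rightarrow> real"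
    and c :: "real^'d \<Rightarrow> real"
    and kappa :: real
  assumes "\<And>j. a j \<in> Cb_inf" and "\<And>j. b j \<in> Cb_inf" and "c \<in> Cb_inf"
    and "\<And>x. c x \<le> 0"
    and "kappa > 0"
    and "\<And>x \<xi> :: real^'d.
           (\<Sum>j\<in>UNIV. (a j x)\<^sup>2 * (\<xi> $ j)\<^sup>2) \<ge> kappa * (\<Sum>j\<in>UNIV. (\<xi> $ j)\<^sup>2)"
  shows
    "(\<forall>lam>0. Cb_inf \<subseteq> (\<lambda>\<phi> x. elliptic_expr a b c \<phi> x - lam * \<phi> x) ` Cb_inf) \<and>
     dissipative (elliptic_operator a b c) \<and>
     (dissipative (closure (elliptic_operator a b c)) \<and>
      (\<exists>V. contraction_C0_semigroup V \<and> generator V = closure (elliptic_operator a b c))) \<and>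
     (\<forall>V. C0_semigroup V \<and> generator V = closure (elliptic_operator a b c) \<longrightarrow>
        (\<forall>u0.
           mild_solution (closure (elliptic_operator a b c)) u0 (\<lambda>t. blinfun_apply (V t) u0) \<and>
           (\<forall>u. mild_solution (closure (elliptic_operator a b c)) u0 u \<longrightarrow>
                (\<forall>t\<ge>0. u t = blinfun_apply (V t) u0)) \<and>
           (\<forall>t\<ge>0. (SUP x. \<bar>apply_ucb (blinfun_apply (V t) u0) x\<bar>) \<le>
                   (SUP x. \<bar>apply_ucb u0 x\<bar>))))"
proof -
  have ell: "kappa \<le> (a j x)\<^sup>2" for j x
  proof -
    have s: "(\<Sum>i\<in>UNIV. f i * (axis j 1 $ i)\<^sup>2) = f j" for f :: "'d \<Rightarrow> real"
      by (subst sum.remove[of _ j]) (auto simp: axis_def)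
    show ?thesis
      using assms(6)[of "axis j 1" x] s[of "\<lambda>_. 1"] s[of "\<lambda>i. (a i x)\<^sup>2"] by simp
  qed
  interpret elliptic a b c kappa
    by unfold_locales (use assms(1-5) ell in auto)
  interpret max: max_dissipative "closure H" by (rule max_dissipative_closure)
  have "g \<in> (\<lambda>\<phi> x. elliptic_expr a b c \<phi> x - lam * \<phi> x) ` Cb_inf" if lam: "lam > 0" and g: "g \<in> Cb_inf" for lam g
  proof -
    \<comment> \<open>The sign of the right-hand side is reversed because the equation solved is for
      lam - H, whereas the claim is about H - lam.\<close>
    obtain w where w: "w \<in> Cb_inf" "\<And>x. lam * w x - elliptic_expr a b c w x = - 1 * g x"
      using smooth_solvability[OF lam Cb_inf_cmult[OF g]] by blast
    have "g = (\<lambda>x. elliptic_expr a b c w x - lam * w x)"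
    proof
      fix x show "g x = elliptic_expr a b c w x - lam * w x" using w(2)[of x] by simp
    qed
    then show ?thesis using w(1) by (rule image_eqI)
  qed
  moreover have "mild_solution (closure H) u0 (\<lambda>t. blinfun_apply (V t) u0) \<and>
      (\<forall>u. mild_solution (closure H) u0 u \<longrightarrow> (\<forall>t\<ge>0. u t = blinfun_apply (V t) u0)) \<and>
      (\<forall>t\<ge>0. (SUP x. \<bar>apply_ucb (blinfun_apply (V t) u0) x\<bar>) \<le> (SUP x. \<bar>apply_ucb u0 x\<bar>))"
    if V: "C0_semigroup V" "generator V = closure H" for V u0
  proof -
    have m: "mild_solution (closure H) u0 (\<lambda>t. blinfun_apply (V t) u0)"
      using mild_solution_semigroup[OF V(1), of u0] V(2) by simp
    show ?thesis
      using m mild_solution_unique[OF max.diss _ m]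
        mild_solution_contraction[OF max_dissipative_closure m]
      unfolding norm_ucb_def by blast
  qed
  ultimately show ?thesis
    using dissipative_H max.diss max.hille_yosida by blast
qed

end
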